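(* Let $r$ be a positive integer. Let $F_5$ be the $5\times5$ matrix with $2$ on the diagonal, $1$ on the first super- and subdiagonal and $0$ elsewhere, and $e_1=(1,0,0,0,0)^{\mathrm T}$. (1) If $r$ is odd, let $v$ be an integer with $2^rv^2\equiv-1\pmod3$ and $x=\frac{2^rv^2+1}{3}$. Then the lattice with Gram matrix $\begin{pmatrix}2^{r+1}&2^r&0&0\\2^r&2^{r+1}&2^rv&0\\0&2^rv&2x&1\\0&0&1&2\end{pmatrix}$ is a positive definite even lattice whose discriminant module is isometrically isomorphic to $\underline{B}_{2^r}$. (2) If $r$ is even, let $v$ be an integer with $2^rv^2\equiv-8\pmod{19}$ and $x=\frac{2^rv^2+8}{19}$. Then the discriminant module of the positive definite even lattice with $8\times8$ Gram matrix $\begin{pmatrix}2\cdot2^r&2^r&0&0\\2^r&10\cdot2^r&2^rv&0\\0&2^rv&2x&e_1^{\mathrm T}\\0&0&e_1&F_5\end{pmatrix}$ is isometrically isomorphic to $\underline{B}_{2^r}$. (3) Let $v$ be an integer with $2^rv^2\equiv-3\pmod7$ and $x=\frac{2^rv^2+3}{7}$. Then the discriminant module of the positive definite even lattice with $8\times8$ Gram matrix $\begin{pmatrix}2\cdot2^r&2^r&0&0\\2^r&4\cdot2^r&2^rv&0\\0&2^rv&2x&e_1^{\mathrm T}\\0&0&e_1&F_5\end{pmatrix}$ is isometrically isomorphic to $\underline{C}_{2^r}$. Moreover, in each case the rank of the given lattice is the least among all positive definite even lattices whose discriminant module is isometrically isomorphic to $\underline{B}_{2^r}$ (cases 1 and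 2) or $\underline{C}_{2^r}$ (case 3).
   Context: A lattice $(L,B)$ is a free $\mathbb{Z}$-module of finite rank with symmetric bilinear $B\colon L\times L\to\mathbb{R}$ whose Gram matrix has nonzero determinant; even means $B(x,y)\in\mathbb{Z}$, $B(x,x)\in2\mathbb{Z}$; positive definite means $B(x,x)>0$ for $x\ne0$. The lattice with Gram matrix $G$ is $\mathbb{Z}^n$ with $B(x,y)=x^{\mathrm T}Gy$. Dual lattice $L^\sharp=\{v\in\mathbb{R}\otimes L: B(v,w)\in\mathbb{Z}\ \forall w\in L\}$; discriminant module $D_L=(L^\sharp/L,\ v+L\mapsto\frac12B(v,v)+\mathbb{Z})$. Finite quadratic modules: finite abelian groups with $Q\colon M\to\mathbb{Q}/\mathbb{Z}$, $Q(nx)=n^2Q(x)$, $Q(x+y)-Q(x)-Q(y)$ bilinear nondegenerate; isometric isomorphism = group isomorphism preserving $Q$. $\underline{B}_{2^r}=((\mathbb{Z}/2^r\mathbb{Z})^2,\ (x,y)\mapsto\frac{x^2+xy+y^2}{2^r}+\mathbb{Z})$, $\underline{C}_{2^r}=((\mathbb{Z}/2^r\mathbb{Z})^2,\ (x,y)\mapsto\frac{xy}{2^r}+\mathbb{Z})$. *)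

theory Defs
  imports
    "HOL-Analysis.Analysis"
    "HOL-Algebra.Elementary_Groups"
    "HOL-Number_Theory.Cong"
    "Jordan_Normal_Form.Determinant"
begin

no_notation Matrix.vec_index (infixl "$" 100)

text \<open>
  A lattice is given as a subset \<open>L\<close> of a real vector space. The vectors of a basis
  over the integers are required to be linearly independent over the reals, so that the real
  span of \<open>L\<close> is a copy of \<open>\<real> \<otimes> L\<close>. The form \<open>B\<close> stands for the
  real-bilinear extension to that span of the form on \<open>L\<close>; its values outside the span are
  irrelevant.
\<close>

definition int_basis :: "'v::real_vector list \<Rightarrow> 'v set \<Rightarrow> bool" where
  "int_basis bs L \<longleftrightarrow>
     distinct bs \<and> independent (set bs) \<and>
     L = {\<Sum>i<length bs. of_int (c i) *\<^sub>R bs ! i | c :: nat \<Rightarrow> int. True}"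

definition gram_matrix :: "('v \<Rightarrow> 'v \<Rightarrow> real) \<Rightarrow> 'v list \<Rightarrow> real Matrix.mat" where
  "gram_matrix B bs = Matrix.mat (length bs) (length bs) (\<lambda>(i, j). B (bs ! i) (bs ! j))"

definition bilinear_lattice :: "'v::real_vector set \<Rightarrow> ('v \<Rightarrow> 'v \<Rightarrow> real) \<Rightarrow> bool" where
  "bilinear_lattice L B \<longleftrightarrow>
     (\<forall>x\<in>span L. \<forall>y\<in>span L. B x y = B y x) \<and>
     (\<forall>x\<in>span L. \<forall>y\<in>span L. \<forall>z\<in>span L. B (x + y) z = B x z + B y z) \<and>
     (\<forall>a. \<forall>x\<in>span L. \<forall>y\<in>span L. B (a *\<^sub>R x) y = a * B x y) \<and>
     (\<exists>bs. int_basis bs L \<and> Determinant.det (gram_matrix B bs) \<noteq> 0)"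

definition lattice_rank :: "'v::real_vector set \<Rightarrow> nat" where
  "lattice_rank L = (THE n. \<exists>bs. int_basis bs L \<and> length bs = n)"

definition even_lattice :: "'v::real_vector set \<Rightarrow> ('v \<Rightarrow> 'v \<Rightarrow> real) \<Rightarrow> bool" where
  "even_lattice L B \<longleftrightarrow>
     bilinear_lattice L B \<and>
     (\<forall>x\<in>L. \<forall>y\<in>L. B x y \<in> \<int>) \<and>
     (\<forall>x\<in>L. \<exists>k::int. B x x = 2 * of_int k)"

definition positive_definite :: "'v::real_vector set \<Rightarrow> ('v \<Rightarrow> 'v \<Rightarrow> real) \<Rightarrow> bool" where
  "positive_definite L B \<longleftrightarrow> (\<forall>x\<in>L. x \<noteq> 0 \<longrightarrow> B x x > 0)"

definition dual_lattice :: "'v::real_vector set \<Rightarrow> ('v \<Rightarrow> 'v \<Rightarrow> real) \<Rightarrow> 'v set" where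
  "dual_lattice L B = {v \<in> span L. \<forall>w\<in>L. B v w \<in> \<int>}"

text \<open>
  A quadratic module is a pair of an abelian group, written with the operations of a
  \<^typ>\<open>'a monoid\<close>, and a map into \<open>\<rat>/\<int>\<close>. An element of
  \<open>\<rat>/\<int>\<close> is a coset \<open>q + \<int>\<close>, taken as a set of real numbers.
\<close>

type_synonym 'a quadratic_module = "'a monoid \<times> ('a \<Rightarrow> real set)"

definition coset_Z :: "real \<Rightarrow> real set" where
  "coset_Z q = {q + of_int k | k :: int. True}"

definition isometrically_isomorphic ::
    "'a quadratic_module \<Rightarrow> 'b quadratic_module \<Rightarrow> bool" where
  "isometrically_isomorphic M N \<longleftrightarrow>
     (\<exists>f \<in> iso (fst M) (fst N). \<forall>x \<in> carrier (fst M). snd N (f x) = snd M x)"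

definition additive_group :: "'v::ab_group_add set \<Rightarrow> 'v monoid" where
  "additive_group S = \<lparr>carrier = S, monoid.mult = (+), one = 0\<rparr>"

text \<open>
  The quadratic map sends the coset \<open>X = v + L\<close> to the union of the
  \<open>B w w / 2 + \<int>\<close> over all \<open>w \<in> X\<close>. If \<open>L\<close> is even and
  \<open>v\<close> lies in the dual lattice, these sets all agree, so the union is
  \<open>B v v / 2 + \<int>\<close>.
\<close>

definition discriminant_module ::
    "'v::real_vector set \<Rightarrow> ('v \<Rightarrow> 'v \<Rightarrow> real) \<Rightarrow> 'v set quadratic_module" where
  "discriminant_module L B =
     (additive_group (dual_lattice L B) Mod L, \<lambda>X. \<Union>w\<in>X. coset_Z (B w w / 2))"

definition module_B :: "nat \<Rightarrow> (int \<times> int) quadratic_module" where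
  "module_B q =
     (integer_mod_group q \<times>\<times> integer_mod_group q,
      \<lambda>(x, y). coset_Z (of_int (x\<^sup>2 + x * y + y\<^sup>2) / of_nat q))"

definition module_C :: "nat \<Rightarrow> (int \<times> int) quadratic_module" where
  "module_C q =
     (integer_mod_group q \<times>\<times> integer_mod_group q,
      \<lambda>(x, y). coset_Z (of_int (x * y) / of_nat q))"

definition int_vectors :: "(real ^ 'n) set" where
  "int_vectors = {x. \<forall>i. x $ i \<in> \<int>}"

definition gram_form :: "real ^ 'n ^ 'n \<Rightarrow> real ^ 'n \<Rightarrow> real ^ 'n \<Rightarrow> real" where
  "gram_form G x y = inner x (G *v y)"

definition gram4 :: "nat \<Rightarrow> real \<Rightarrow> real \<Rightarrow> real ^ 4 ^ 4" where
  "gram4 r v x = vector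
     [vector [2 ^ (r + 1), 2 ^ r,       0,         0],
      vector [2 ^ r,       2 ^ (r + 1), 2 ^ r * v, 0],
      vector [0,           2 ^ r * v,   2 * x,     1],
      vector [0,           0,           1,         2]]"

text \<open>The lower right \<open>5 \<times> 5\<close> block is the matrix \<open>F\<^sub>5\<close>.\<close>

definition gram8 :: "real \<Rightarrow> nat \<Rightarrow> real \<Rightarrow> real \<Rightarrow> real ^ 8 ^ 8" where
  "gram8 a r v x = vector
     [vector [2 * 2 ^ r, 2 ^ r,     0,         0, 0, 0, 0, 0],
      vector [2 ^ r,     a * 2 ^ r, 2 ^ r * v, 0, 0, 0, 0, 0],
      vector [0,         2 ^ r * v, 2 * x,     1, 0, 0, 0, 0],
      vector [0,         0,         1,         2, 1, 0, 0, 0],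
      vector [0,         0,         0,         1, 2, 1, 0, 0],
      vector [0,         0,         0,         0, 1, 2, 1, 0],
      vector [0,         0,         0,         0, 0, 1, 2, 1],
      vector [0,         0,         0,         0, 0, 0, 1, 2]]"

end

theory Submission
  imports Defs
begin

text \<open>
  Put \<open>q = 2\<^sup>r\<close>. For each of the three Gram matrices the vectors \<open>e\<^sub>1/q\<close> and \<open>e\<^sub>2/q\<close> generate the
  discriminant group: dividing the first two columns by \<open>q\<close> leaves an integer matrix of
  determinant \<open>1\<close>. The resulting binary forms \<open>x\<^sup>2 + xy + 5y\<^sup>2\<close> and \<open>x\<^sup>2 + xy + 2y\<^sup>2\<close> have
  discriminants \<open>-19 \<equiv> 5\<close> and \<open>-7 \<equiv> 1 (mod 8)\<close>, so Hensel's lemma makes them equivalent modulo \<open>q\<close> to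
  \<open>x\<^sup>2 + xy + y\<^sup>2\<close> and \<open>xy\<close>.

  For minimality, the signature formula of Milgram is replaced by two elementary facts. An even symmetric
  integer matrix of odd determinant has even size \<open>n\<close> and determinant \<open>(-1)\<^bsup>n/2\<^esup>\<close> modulo \<open>4\<close>, and
  Hermite's bound rules out positive definite even unimodular lattices of rank \<open>4\<close>; hence such lattices have
  rank at least \<open>8\<close>. A lattice with discriminant module \<open>C\<^sub>q\<close>, or \<open>B\<^sub>q\<close> with \<open>r\<close> even, has an even
  unimodular overlattice of the same rank. A lattice with discriminant module \<open>B\<^sub>q\<close> glues with the \<open>-q\<close>-fold of the
  \<open>A\<^sub>2\<close> lattice to an even lattice of rank \<open>n + 2\<close> and determinant \<open>3\<close>, which forces \<open>n \<equiv> 0 (mod 4)\<close>.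
\<close>

text \<open>The constants come from the determinant \<open>1\<close>. In rank \<open>8\<close> put
  \<open>d = 4 * a - 1\<close>, the determinant of the binary block divided by \<open>q\<close>. As
  \<open>6\<close> and \<open>5\<close> are the determinants of \<open>F\<^sub>5\<close> and of its
  analogue of size \<open>4\<close>, dividing the first two columns by \<open>q\<close> leaves
  determinant \<open>d * (12 * x - 5) - 12 * q * v\<^sup>2\<close>. With
  \<open>d * x = q * v\<^sup>2 + c\<close> this is \<open>12 * c - 5 * d\<close>, and
  \<open>(19, 8)\<close> and \<open>(7, 3)\<close> solve \<open>12 * c - 5 * d = 1\<close>. In rank
  \<open>4\<close> the corresponding number is \<open>4 - 3\<close>.

  For odd \<open>r\<close> an overlattice argument cannot serve \<open>B\<close>: a self-dual even
  overlattice of the rank \<open>4\<close> example would be unimodular of rank \<open>4\<close>.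
  Hence the gluing. In the \<open>-q\<close>-fold of the \<open>A\<^sub>2\<close> lattice the
  vectors \<open>e\<^sub>1/q\<close> and \<open>e\<^sub>2/q\<close> have the products
  \<open>-2/q\<close>, \<open>-2/q\<close>, \<open>-1/q\<close>, opposite to those of the
  generators. The glued lattice is indefinite, which is harmless because only its determinant modulo
  \<open>4\<close> is used.

  The order of the discriminant group is never counted in the rank bounds. Divisibility replaces it:
  if \<open>m\<close> annihilates the dual modulo the lattice, the determinant divides
  \<open>m ^ n\<close>.\<close>

unbundle no inner_syntax
notation vec_index (infixl "$v" 100)

section \<open>Even integer matrices of odd determinant\<close>

text \<open>Multiplication by the lower triangular block matrix \<open>?E\<close> clears
  \<open>S\<close>. Here \<open>Q\<close> is \<open>d\<close> times the inverse of \<open>P\<close>,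
  so nothing is divided and the identity holds over the integers. It serves for the adjugate of a
  binary pivot, for a pivot of size one and for a genuine real inverse.\<close>

lemma det_schur_complement:
  fixes P :: "'a::idom mat"
  assumes P: "P \<in> carrier_mat k k" and Q: "Q \<in> carrier_mat k k" and QP: "Q * P = d \<cdot>\<^sub>m 1\<^sub>m k"
    and R: "R \<in> carrier_mat k m" and S: "S \<in> carrier_mat m k" and Y: "Y \<in> carrier_mat m m"
  shows "Determinant.det Q * d ^ m * Determinant.det (four_block_mat P R S Y) =
    d ^ k * Determinant.det (d \<cdot>\<^sub>m Y - S * (Q * R))"
proof -
  let ?E = "four_block_mat Q (0\<^sub>m k m) (- (S * Q)) (d \<cdot>\<^sub>m 1\<^sub>m m)"
  let ?X = "four_block_mat P R S Y"
  have SQ: "- (S * Q) \<in> carrier_mat m k" and dI: "d \<cdot>\<^sub>m 1\<^sub>m m \<in> carrier_mat m m"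
    using S Q by auto
  have E: "?E \<in> carrier_mat (k + m) (k + m)" and X: "?X \<in> carrier_mat (k + m) (k + m)"
    using Q P Y by auto
  have SQP: "S * Q * P = d \<cdot>\<^sub>m S"
    using S QP by (simp add: assoc_mult_mat[OF S Q P] mult_smult_distrib[OF S one_carrier_mat])
  have 1: "Q * P + 0\<^sub>m k m * S = d \<cdot>\<^sub>m 1\<^sub>m k" using QP S P Q by auto
  have 2: "Q * R + 0\<^sub>m k m * Y = Q * R" using Q R Y by auto
  have 3: "- (S * Q) * P + d \<cdot>\<^sub>m 1\<^sub>m m * S = 0\<^sub>m m k"
  proof -
    have "- (S * Q) * P = - (d \<cdot>\<^sub>m S)" using S Q P SQP by (auto simp: uminus_mult_left_mat)
    moreover have "d \<cdot>\<^sub>m 1\<^sub>m m * S = d \<cdot>\<^sub>m S" using S by (simp add: mult_smult_assoc_mat[of _ m m])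
    ultimately show ?thesis using S by (auto intro!: eq_matI)
  qed
  have 4: "- (S * Q) * R + d \<cdot>\<^sub>m 1\<^sub>m m * Y = d \<cdot>\<^sub>m Y - S * (Q * R)"
  proof -
    have "- (S * Q) * R = - (S * (Q * R))" using S Q R by (auto simp: uminus_mult_left_mat assoc_mult_mat[OF S Q R])
    moreover have "d \<cdot>\<^sub>m 1\<^sub>m m * Y = d \<cdot>\<^sub>m Y" using Y by (simp add: mult_smult_assoc_mat[of _ m m])
    moreover have "S * (Q * R) \<in> carrier_mat m m" using S Q R by auto
    ultimately show ?thesis using Y
      by (metis comm_add_mat minus_add_uminus_mat smult_carrier_mat uminus_carrier_mat)
  qed
  have "?E * ?X = four_block_mat (d \<cdot>\<^sub>m 1\<^sub>m k) (Q * R) (0\<^sub>m m k) (d \<cdot>\<^sub>m Y - S * (Q * R))"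
    using mult_four_block_mat[OF Q zero_carrier_mat[of k m] SQ dI P R S Y] 1 2 3 4 by simp
  moreover have "Determinant.det \<dots> = d ^ k * Determinant.det (d \<cdot>\<^sub>m Y - S * (Q * R))"
  proof -
    have "Determinant.det (four_block_mat (d \<cdot>\<^sub>m 1\<^sub>m k) (Q * R) (0\<^sub>m m k) (d \<cdot>\<^sub>m Y - S * (Q * R)))
      = Determinant.det (d \<cdot>\<^sub>m 1\<^sub>m k) * Determinant.det (d \<cdot>\<^sub>m Y - S * (Q * R))"
      by (rule det_four_block_mat_lower_left_zero[where n=k and m=m]) (use Q R S Y in auto)
    then show ?thesis by simp
  qed
  moreover have "Determinant.det ?E = Determinant.det Q * d ^ m"
    using det_four_block_mat_upper_right_zero[OF Q refl SQ dI] by simp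
  ultimately show ?thesis using det_mult[OF E X] by simp
qed

lemma even_symmetric_sum:
  fixes h :: "nat \<Rightarrow> nat \<Rightarrow> int"
  assumes "\<And>i j. i < n \<Longrightarrow> j < n \<Longrightarrow> h i j = h j i" and "\<And>i. i < n \<Longrightarrow> even (h i i)"
  shows "even (\<Sum>i<n. \<Sum>j<n. h i j)"
  using assms
proof (induction n)
  case (Suc n)
  have "(\<Sum>i<Suc n. \<Sum>j<Suc n. h i j) = (\<Sum>i<n. \<Sum>j<n. h i j) + (\<Sum>i<n. h i n) + (\<Sum>j<n. h n j) + h n n"
    by (simp add: sum.distrib)
  moreover have "(\<Sum>j<n. h n j) = (\<Sum>i<n. h i n)"
    by (rule sum.cong) (use Suc.prems(1) in auto)
  ultimately show ?case using Suc by simp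
qed simp

section \<open>Bilinear forms given by matrices\<close>

definition bil :: "'a::comm_ring_1 mat \<Rightarrow> 'a Matrix.vec \<Rightarrow> 'a Matrix.vec \<Rightarrow> 'a" where
  "bil X y z = y \<bullet> (X *\<^sub>v z)"

lemma bil_sum:
  assumes "X \<in> carrier_mat n n" "y \<in> carrier_vec n" "z \<in> carrier_vec n"
  shows "bil X y z = (\<Sum>i<n. \<Sum>j<n. y $v i * X $$ (i, j) * z $v j)"
  using assms by (auto simp: bil_def scalar_prod_def sum_distrib_left lessThan_atLeast0 mult.assoc intro!: sum.cong)

lemma bil_commute:
  assumes "X \<in> carrier_mat n n" "\<forall>i<n. \<forall>j<n. X $$ (i, j) = X $$ (j, i)"
    "y \<in> carrier_vec n" "z \<in> carrier_vec n"
  shows "bil X y z = bil X z y"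
proof -
  have "bil X y z = (\<Sum>i<n. \<Sum>j<n. y $v i * X $$ (i, j) * z $v j)" using assms by (intro bil_sum)
  also have "\<dots> = (\<Sum>j<n. \<Sum>i<n. z $v j * X $$ (j, i) * y $v i)"
    by (subst sum.swap, intro sum.cong) (use assms in \<open>auto simp: algebra_simps\<close>)
  also have "\<dots> = bil X z y" using assms by (intro bil_sum[symmetric])
  finally show ?thesis .
qed

lemma bil_smult:
  assumes "X \<in> carrier_mat n n" "y \<in> carrier_vec n" "z \<in> carrier_vec n"
  shows "bil X (a \<cdot>\<^sub>v y) z = a * bil X y z" and "bil X y (a \<cdot>\<^sub>v z) = a * bil X y z"
  using assms by (simp_all add: bil_sum[of X n] sum_distrib_left algebra_simps)

lemma bil_add:
  assumes "X \<in> carrier_mat n n" "y \<in> carrier_vec n" "z \<in> carrier_vec n" "y' \<in> carrier_vec n"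
  shows "bil X (y + y') z = bil X y z + bil X y' z" and "bil X z (y + y') = bil X z y + bil X z y'"
  using assms by (simp_all add: bil_sum[of X n] sum.distrib algebra_simps)

definition even_mat :: "nat \<Rightarrow> int mat \<Rightarrow> bool" where
  "even_mat n X \<longleftrightarrow> X \<in> carrier_mat n n \<and>
     (\<forall>i<n. \<forall>j<n. X $$ (i, j) = X $$ (j, i)) \<and> (\<forall>i<n. even (X $$ (i, i)))"

lemma even_bil:
  assumes "even_mat n X" "y \<in> carrier_vec n"
  shows "even (bil X y y)"
proof -
  have "bil X y y = (\<Sum>i<n. \<Sum>j<n. y $v i * X $$ (i, j) * y $v j)"
    using assms by (intro bil_sum) (auto simp: even_mat_def)
  also have "even \<dots>"
    by (rule even_symmetric_sum) (use assms in \<open>auto simp: even_mat_def mult.commute mult.left_commute\<close>)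
  finally show ?thesis .
qed

lemma det_permute_both:
  fixes X :: "'a::comm_ring_1 mat"
  assumes X: "X \<in> carrier_mat n n" and p: "p permutes {0..<n}"
  shows "Determinant.det (Matrix.mat n n (\<lambda>(i, j). X $$ (p i, p j))) = Determinant.det X"
proof -
  define Z where "Z = Matrix.mat n n (\<lambda>(i, j). X $$ (p i, j))"
  have Z: "Z \<in> carrier_mat n n" by (simp add: Z_def)
  have pn: "p i < n" if "i < n" for i using p that by (metis atLeastLessThan_iff permutes_in_image zero_le)
  have "Determinant.det (Matrix.mat n n (\<lambda>(i, j). X $$ (p i, p j)))
      = Determinant.det (transpose_mat (Matrix.mat n n (\<lambda>(i, j). X $$ (p i, p j))))"
    by (subst det_transpose[where n=n]) auto
  also have "transpose_mat (Matrix.mat n n (\<lambda>(i, j). X $$ (p i, p j))) =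
      Matrix.mat n n (\<lambda>(i, j). transpose_mat Z $$ (p i, j))"
    using pn by (auto simp: Z_def intro!: eq_matI)
  also have "Determinant.det \<dots> = signof p * Determinant.det (transpose_mat Z)"
    by (rule det_permute_rows) (use Z p in auto)
  also have "Determinant.det (transpose_mat Z) = Determinant.det Z" by (rule det_transpose[OF Z])
  also have "Determinant.det Z = signof p * Determinant.det X"
    unfolding Z_def by (rule det_permute_rows[OF X p])
  finally show ?thesis by (simp add: sign_def)
qed

lemma det_mat_2:
  assumes A: "A \<in> carrier_mat 2 2"
  shows "Determinant.det A = A $$ (0, 0) * A $$ (1, 1) - A $$ (0, 1) * A $$ (1, 0)"
proof -
  have "Determinant.det A = (\<Sum>j<2. A $$ (0, j) * cofactor A 0 j)"
    by (rule laplace_expansion_row[OF A]) simp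
  then show ?thesis
    using A by (simp add: numeral_2_eq_2 cofactor_def det_single mat_delete_def)
qed

lemma odd_det_odd_entry:
  assumes X: "X \<in> carrier_mat n n" and "odd (Determinant.det (X :: int mat))" and "0 < n"
  shows "\<exists>j<n. odd (X $$ (0, j))"
proof (rule ccontr)
  assume "\<not> ?thesis"
  then have "even (\<Sum>j<n. X $$ (0, j) * cofactor X 0 j)" by (intro dvd_sum) auto
  with laplace_expansion_row[OF X \<open>0 < n\<close>] assms show False by simp
qed

text \<open>A \<open>2\<close>-adic splitting argument: over \<open>\<int>\<^sub>(\<^sub>2\<^sub>)\<close> an even form of odd determinant is an orthogonal
  sum of binary forms, each of which has determinant \<open>4ac - b\<^sup>2 \<equiv> -1 (mod 4)\<close>.\<close>

lemma even_mat_odd_det: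
  assumes "even_mat n X" and "odd (Determinant.det X)"
  shows "even n \<and> [Determinant.det X = (-1) ^ (n div 2)] (mod 4)"
  using assms
proof (induction n arbitrary: X rule: less_induct)
  case (less n)
  have X: "X \<in> carrier_mat n n" using less.prems by (auto simp: even_mat_def)
  show ?case
  proof (cases "n = 0")
    case True
    then show ?thesis using X by simp
  next
    case False
    then obtain j where j: "j < n" "odd (X $$ (0, j))" using odd_det_odd_entry[OF X] less.prems by auto
    then have "j \<noteq> 0" using less.prems False by (metis even_mat_def gr0I)
    define m where "m = n - 2"
    have n: "n = 2 + m" using j \<open>j \<noteq> 0\<close> by (simp add: m_def)
    \<comment> \<open>The exchange moves the odd entry next to the diagonal, so that the leading
      binary block has even diagonal and odd off-diagonal entry \<open>b\<close>.\<close>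
    define p where "p = Transposition.transpose 1 j"
    have p: "p permutes {0..<n}" unfolding p_def by (rule permutes_swap_id) (use n j in auto)
    have pn: "p i < n" if "i < n" for i using p that by (metis atLeastLessThan_iff permutes_in_image zero_le)
    define W where "W = Matrix.mat n n (\<lambda>(i, j). X $$ (p i, p j))"
    have W: "even_mat n W" using less.prems pn by (auto simp: even_mat_def W_def)
    have detW: "Determinant.det W = Determinant.det X" unfolding W_def by (rule det_permute_both[OF X p])
    define a b c where "a = W $$ (0, 0)" and "b = W $$ (0, 1)" and "c = W $$ (1, 1)"
    have sym: "W $$ (i, j) = W $$ (j, i)" if "i < n" "j < n" for i j
      using W that unfolding even_mat_def by blast
    have diag: "even (W $$ (i, i))" if "i < n" for i
      using W that unfolding even_mat_def by blast
    have b: "odd b" "W $$ (1, 0) = b" and ac: "even a" "even c"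
      using n j \<open>j \<noteq> 0\<close> sym[of 1 0] diag[of 0] diag[of 1] by (auto simp: a_def b_def c_def W_def p_def)
    \<comment> \<open>\<open>Q\<close> is the adjugate of the pivot block \<open>P\<close>; their
      product is the scalar \<open>d = a * c - b * b\<close>.\<close>
    define P Q R S Y where "P = Matrix.mat 2 2 (\<lambda>(i, j). W $$ (i, j))"
      and "Q = Matrix.mat 2 2 (\<lambda>(i, j). if i = j then (if i = 0 then c else a) else - b)"
      and "R = Matrix.mat 2 m (\<lambda>(i, j). W $$ (i, j + 2))"
      and "S = Matrix.mat m 2 (\<lambda>(i, j). W $$ (i + 2, j))"
      and "Y = Matrix.mat m m (\<lambda>(i, j). W $$ (i + 2, j + 2))"
    have carr: "P \<in> carrier_mat 2 2" "Q \<in> carrier_mat 2 2" "R \<in> carrier_mat 2 m"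
      "S \<in> carrier_mat m 2" "Y \<in> carrier_mat m m"
      by (auto simp: P_def Q_def R_def S_def Y_def)
    have WB: "W = four_block_mat P R S Y"
    proof (rule eq_matI)
      have 2: "Suc (Suc (i - 2)) = i" if "\<not> i < 2" for i using that by simp
      fix i j assume "i < dim_row (four_block_mat P R S Y)" "j < dim_col (four_block_mat P R S Y)"
      then show "W $$ (i, j) = four_block_mat P R S Y $$ (i, j)"
        by (auto simp: P_def R_def S_def Y_def 2)
    qed (use W n in \<open>auto simp: P_def Y_def even_mat_def\<close>)
    define d where "d = a * c - b * b"
    have QP: "Q * P = d \<cdot>\<^sub>m 1\<^sub>m 2"
      by (rule eq_matI) (auto simp: Q_def P_def d_def scalar_prod_def less_Suc_eq numeral_2_eq_2 a_def b_def[symmetric, simplified] c_def b(2)[simplified] algebra_simps)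
    have dQ: "Determinant.det Q = d"
      unfolding det_mat_2[OF carr(2)] by (simp add: Q_def d_def)
    have d3: "[d = -1] (mod 4)"
    proof -
      obtain a' c' b' where "a = 2 * a'" "c = 2 * c'" "b = 2 * b' + 1" using ac b by (auto elim!: evenE oddE)
      then have "d - (-1) = 4 * (a' * c' - b' * b' - b')" by (simp add: d_def algebra_simps)
      then show ?thesis by (metis cong_iff_dvd_diff dvd_triv_left)
    qed
    then have "odd d" using ac b by (simp add: d_def)
    then have "d \<noteq> 0" by auto
    \<comment> \<open>This is \<open>d\<close> times the Schur complement of the pivot. Its diagonal
      is even because \<open>W\<close> has even diagonal and \<open>Q\<close> is itself an even
      form, so the induction hypothesis applies to it.\<close>
    define Y' where "Y' = d \<cdot>\<^sub>m Y - S * (Q * R)"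
    have Y': "Y' \<in> carrier_mat m m" using carr by (auto simp: Y'_def)
    have QE: "even_mat 2 Q" using ac by (auto simp: even_mat_def Q_def)
    have entry: "Y' $$ (i, j) = d * W $$ (i + 2, j + 2) - bil Q (col R i) (col R j)" if "i < m" "j < m" for i j
    proof -
      have "row S i = col R i" using that W n by (auto simp: S_def R_def even_mat_def intro!: eq_vecI)
      moreover have "col (Q * R) j = Q *\<^sub>v col R j" using carr that by (auto intro!: eq_vecI)
      ultimately have "(S * (Q * R)) $$ (i, j) = bil Q (col R i) (col R j)"
        using carr that by (simp add: bil_def)
      then show ?thesis using carr that by (simp add: Y'_def Y_def)
    qed
    have bsym: "bil Q y z = bil Q z y" if "y \<in> carrier_vec 2" "z \<in> carrier_vec 2" for y z
      by (rule bil_commute[OF carr(2) _ that]) (simp add: Q_def)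
    have Y'E: "even_mat m Y'"
      unfolding even_mat_def
    proof (intro conjI allI impI)
      fix i j assume ij: "i < m" "j < m"
      show "Y' $$ (i, j) = Y' $$ (j, i)"
        using ij carr W n bsym[of "col R i" "col R j"] by (simp add: entry even_mat_def)
    next
      fix i assume i: "i < m"
      have "even (bil Q (col R i) (col R i))" by (rule even_bil[OF QE]) (use carr in \<open>auto intro!: carrier_vecI\<close>)
      then show "even (Y' $$ (i, i))" using i W n by (simp add: entry even_mat_def)
    qed (rule Y')
    have eq: "d * d ^ m * Determinant.det X = d ^ 2 * Determinant.det Y'"
      using det_schur_complement[OF carr(1,2) QP carr(3,4,5)] by (simp add: dQ WB[symmetric] detW Y'_def)
    then have eq: "d ^ m * Determinant.det X = d * Determinant.det Y'"
      using \<open>d \<noteq> 0\<close> by (simp add: power2_eq_square)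
    have "odd (Determinant.det Y')"
      using eq \<open>odd d\<close> less.prems(2) by (metis even_mult_iff even_power)
    with less.IH[of m Y'] n Y'E have IH: "even m" "[Determinant.det Y' = (-1) ^ (m div 2)] (mod 4)" by auto
    \<comment> \<open>As \<open>m\<close> is even, \<open>d ^ m\<close> is \<open>1\<close> modulo
      \<open>4\<close>: the scaling that avoids fractions leaves no trace, and only the factor
      \<open>d\<close> of the pivot contributes a sign.\<close>
    have "[d ^ m = (-1) ^ m] (mod 4)" by (rule cong_pow[OF d3])
    then have "[d ^ m * Determinant.det X = Determinant.det X] (mod 4)"
      using IH(1) by (metis cong_scalar_right mult_1 uminus_power_if power_one)
    moreover have "[d * Determinant.det Y' = (-1) * (-1) ^ (m div 2)] (mod 4)"
      by (rule cong_mult[OF d3 IH(2)])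
    ultimately have "[Determinant.det X = (-1) * (-1) ^ (m div 2)] (mod 4)"
      using eq by (metis cong_sym cong_trans)
    then show ?thesis using IH(1) n by simp
  qed
qed

section \<open>Hermite's bound\<close>

definition pos_mat :: "nat \<Rightarrow> int mat \<Rightarrow> bool" where
  "pos_mat n X \<longleftrightarrow> X \<in> carrier_mat n n \<and> (\<forall>i<n. \<forall>j<n. X $$ (i, j) = X $$ (j, i)) \<and>
     (\<forall>y\<in>carrier_vec n. y \<noteq> 0\<^sub>v n \<longrightarrow> 0 < bil X y y)"

lemma bil_congruence:
  assumes "X \<in> carrier_mat n n" "U \<in> carrier_mat n m" "y \<in> carrier_vec m" "z \<in> carrier_vec m"
  shows "bil (transpose_mat U * X * U) y z = bil X (U *\<^sub>v y) (U *\<^sub>v z)"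
proof -
  have "(transpose_mat U * X * U) *\<^sub>v z = transpose_mat U *\<^sub>v (X *\<^sub>v (U *\<^sub>v z))"
    using assms by (simp add: assoc_mult_mat_vec[of _ m n _ m] assoc_mult_mat_vec[of _ n n _ m]
        assoc_mult_mat_vec[of _ m n _ n] mult_carrier_mat[of _ m n] del: assoc_mult_mat)
  moreover have "y \<bullet> (transpose_mat U *\<^sub>v (X *\<^sub>v (U *\<^sub>v z))) = (U *\<^sub>v y) \<bullet> (X *\<^sub>v (U *\<^sub>v z))"
    using assms by (simp add: comm_scalar_prod[of y m] transpose_vec_mult_scalar[of _ n m] comm_scalar_prod[of "U *\<^sub>v y" n])
  ultimately show ?thesis by (simp only: bil_def)
qed

lemma congruence_index:
  assumes "X \<in> carrier_mat n n" "U \<in> carrier_mat n m" "i < m" "j < m"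
  shows "(transpose_mat U * X * U) $$ (i, j) = bil X (col U i) (col U j)"
proof -
  have "(transpose_mat U * X * U) $$ (i, j) = (transpose_mat U * (X * U)) $$ (i, j)"
    using assms by (simp add: assoc_mult_mat[of _ m n _ n _ m])
  also have "\<dots> = col U i \<bullet> col (X * U) j" using assms by simp
  also have "col (X * U) j = X *\<^sub>v col U j" using assms by (auto intro!: eq_vecI)
  finally show ?thesis by (simp add: bil_def)
qed

lemma mult_mat_vec_eq_0:
  fixes U :: "'a::idom mat"
  assumes "U \<in> carrier_mat n n" "Determinant.det U \<noteq> 0" "y \<in> carrier_vec n" "U *\<^sub>v y = 0\<^sub>v n"
  shows "y = 0\<^sub>v n"
  using det_0_iff_vec_prod_zero[OF assms(1)] assms by auto

lemma pos_mat_congruence: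
  assumes X: "pos_mat n X" and U: "U \<in> carrier_mat n n" "Determinant.det U \<noteq> 0"
  shows "pos_mat n (transpose_mat U * X * U)"
  unfolding pos_mat_def
proof (intro conjI allI impI ballI)
  have Xc: "X \<in> carrier_mat n n" using X by (simp add: pos_mat_def)
  show "transpose_mat U * X * U \<in> carrier_mat n n" using Xc U by auto
  show "(transpose_mat U * X * U) $$ (i, j) = (transpose_mat U * X * U) $$ (j, i)" if "i < n" "j < n" for i j
  proof -
    have "bil X (col U i) (col U j) = bil X (col U j) (col U i)"
      by (rule bil_commute[OF Xc]) (use X U in \<open>auto simp: pos_mat_def\<close>)
    then show ?thesis using that congruence_index[OF Xc U(1)] by simp
  qed
  fix y :: "int Matrix.vec" assume y: "y \<in> carrier_vec n" "y \<noteq> 0\<^sub>v n"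
  then have "U *\<^sub>v y \<noteq> 0\<^sub>v n" using mult_mat_vec_eq_0[OF U] by auto
  moreover have "U *\<^sub>v y \<in> carrier_vec n" using U y by auto
  ultimately show "0 < bil (transpose_mat U * X * U) y y"
    using X by (simp add: bil_congruence[OF Xc U(1) y(1) y(1)] pos_mat_def)
qed

text \<open>Rounds \<open>- \<rho> / a\<close> to a nearest integer. The bound is squared to match
  the completed square of the Hermite induction.\<close>

lemma nearest_multiple:
  fixes a \<rho> :: int
  assumes "0 < a"
  obtains t where "4 * (a * t + \<rho>)\<^sup>2 \<le> a\<^sup>2"
proof -
  define t where "t = - ((2 * \<rho> + a) div (2 * a))"
  have "2 * \<rho> + a = 2 * a * ((2 * \<rho> + a) div (2 * a)) + (2 * \<rho> + a) mod (2 * a)" by simp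
  then have "2 * (a * t + \<rho>) = (2 * \<rho> + a) mod (2 * a) - a" by (simp add: t_def algebra_simps)
  moreover have "0 \<le> (2 * \<rho> + a) mod (2 * a)" "(2 * \<rho> + a) mod (2 * a) < 2 * a" using assms by auto
  ultimately have "\<bar>2 * (a * t + \<rho>)\<bar> \<le> \<bar>a\<bar>" using assms by linarith
  then have "(2 * (a * t + \<rho>))\<^sup>2 \<le> a\<^sup>2" by (simp only: abs_le_square_iff)
  then show ?thesis using that[of t] by (simp only: power_mult_distrib) simp
qed

text \<open>The factor \<open>W $$ (0, 0)\<close> clears the denominators of the usual completed
  square. The remaining form \<open>g\<close> is that entry times its Schur complement, so the
  Hermite induction never leaves integer matrices.\<close>

lemma bil_complete_square:
  fixes W :: "int mat"
  assumes W: "W \<in> carrier_mat (Suc m) (Suc m)" "\<forall>i<Suc m. \<forall>j<Suc m. W $$ (i, j) = W $$ (j, i)"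
    and c: "c \<in> carrier_vec m"
    and g: "g = Matrix.mat m m (\<lambda>(i, j). W $$ (0, 0) * W $$ (Suc i, Suc j) - W $$ (Suc i, 0) * W $$ (0, Suc j))"
  shows "W $$ (0, 0) * bil W (vCons t c) (vCons t c) =
    (W $$ (0, 0) * t + (\<Sum>j<m. W $$ (0, Suc j) * c $v j))\<^sup>2 + bil g c c"
proof -
  define \<rho> where "\<rho> = (\<Sum>j<m. W $$ (0, Suc j) * c $v j)"
  define K where "K = (\<Sum>i<m. \<Sum>j<m. c $v i * W $$ (Suc i, Suc j) * c $v j)"
  have "bil W (vCons t c) (vCons t c) =
      (\<Sum>i<Suc m. \<Sum>j<Suc m. vCons t c $v i * W $$ (i, j) * vCons t c $v j)"
    by (rule bil_sum) (use W c in auto)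
  also have "\<dots> = t * W $$ (0, 0) * t + (\<Sum>j<m. t * W $$ (0, Suc j) * c $v j)
      + ((\<Sum>i<m. c $v i * W $$ (Suc i, 0) * t) + K)"
    by (simp add: sum.lessThan_Suc_shift sum.distrib K_def del: sum.lessThan_Suc)
  also have "(\<Sum>i<m. c $v i * W $$ (Suc i, 0) * t) = t * \<rho>"
    unfolding \<rho>_def sum_distrib_left using W(2) by (intro sum.cong) auto
  also have "(\<Sum>j<m. t * W $$ (0, Suc j) * c $v j) = t * \<rho>"
    unfolding \<rho>_def sum_distrib_left by (intro sum.cong) auto
  finally have 1: "bil W (vCons t c) (vCons t c) = t * W $$ (0, 0) * t + t * \<rho> + (t * \<rho> + K)" .
  have "bil g c c = (\<Sum>i<m. \<Sum>j<m. c $v i * g $$ (i, j) * c $v j)"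
    by (rule bil_sum) (use c g in auto)
  also have "\<dots> = (\<Sum>i<m. \<Sum>j<m. W $$ (0, 0) * (c $v i * W $$ (Suc i, Suc j) * c $v j)
       - (W $$ (0, Suc i) * c $v i) * (W $$ (0, Suc j) * c $v j))"
    using W(2) by (intro sum.cong refl) (simp add: g algebra_simps)
  also have "\<dots> = W $$ (0, 0) * K - \<rho> * \<rho>"
    by (simp add: sum_subtractf K_def \<rho>_def sum_distrib_left[symmetric] sum_product)
  finally show ?thesis unfolding 1 \<rho>_def[symmetric] by (simp add: power2_eq_square algebra_simps)
qed

lemma det_complete_square:
  fixes W :: "int mat"
  assumes W: "W \<in> carrier_mat (Suc m) (Suc m)"
    and g: "g = Matrix.mat m m (\<lambda>(i, j). W $$ (0, 0) * W $$ (Suc i, Suc j) - W $$ (Suc i, 0) * W $$ (0, Suc j))"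
  shows "W $$ (0, 0) ^ m * Determinant.det W = W $$ (0, 0) * Determinant.det g"
proof -
  define P R S Y where "P = Matrix.mat 1 1 (\<lambda>(i, j). W $$ (i, j))"
    and "R = Matrix.mat 1 m (\<lambda>(i, j). W $$ (i, Suc j))"
    and "S = Matrix.mat m 1 (\<lambda>(i, j). W $$ (Suc i, j))"
    and "Y = Matrix.mat m m (\<lambda>(i, j). W $$ (Suc i, Suc j))"
  have carr: "P \<in> carrier_mat 1 1" "R \<in> carrier_mat 1 m" "S \<in> carrier_mat m 1" "Y \<in> carrier_mat m m"
    by (auto simp: P_def R_def S_def Y_def)
  have WB: "W = four_block_mat P R S Y"
    using W by (auto simp: P_def R_def S_def Y_def intro!: eq_matI)
  have "1\<^sub>m 1 * P = W $$ (0, 0) \<cdot>\<^sub>m 1\<^sub>m 1" using carr by (auto simp: P_def intro!: eq_matI)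
  from det_schur_complement[OF carr(1) one_carrier_mat this carr(2-4)]
  have "W $$ (0, 0) ^ m * Determinant.det W = W $$ (0, 0) * Determinant.det (W $$ (0, 0) \<cdot>\<^sub>m Y - S * (1\<^sub>m 1 * R))"
    by (simp add: WB[symmetric])
  also have "W $$ (0, 0) \<cdot>\<^sub>m Y - S * (1\<^sub>m 1 * R) = g"
    using carr by (auto simp: g Y_def S_def R_def scalar_prod_def intro!: eq_matI)
  finally show ?thesis .
qed

text \<open>Hermite's bound \<open>min \<le> (4/3)\<^bsup>(n-1)/2\<^esup> det\<^bsup>1/n\<^esup>\<close>, with the minimum taken over the vectors that
  extend to a basis so that no theory of primitive vectors is needed.\<close>

lemma hermite_bound:
  assumes "pos_mat (Suc m) X"
  shows "\<exists>U. U \<in> carrier_mat (Suc m) (Suc m) \<and> \<bar>Determinant.det U\<bar> = 1 \<and>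
    bil X (col U 0) (col U 0) ^ Suc m * 3 ^ \<Sum>{..m} \<le> 4 ^ \<Sum>{..m} * Determinant.det X"
  using assms
proof (induction m arbitrary: X)
  case 0
  then have "X \<in> carrier_mat 1 1" by (simp add: pos_mat_def)
  moreover from this have "bil X (unit_vec 1 0) (unit_vec 1 0) = X $$ (0, 0)"
    by (subst bil_sum[of _ 1]) auto
  ultimately show ?case by (intro exI[of _ "1\<^sub>m 1"]) (auto simp: det_single)
next
  case (Suc m X)
  define n where "n = Suc (Suc m)"
  define unim where "unim U \<longleftrightarrow> U \<in> carrier_mat n n \<and> \<bar>Determinant.det U\<bar> = 1" for U :: "int mat"
  define val where "val U = nat (bil X (col U 0) (col U 0))" for U :: "int mat"
  have X: "pos_mat n X" "X \<in> carrier_mat n n" using Suc.prems by (auto simp: pos_mat_def n_def)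
  have "unim (1\<^sub>m n)" by (simp add: unim_def)
  \<comment> \<open>Well-ordering supplies the minimum. Truncation by \<open>nat\<close> does no
    harm: the minimal value \<open>a\<close> turns out positive, so comparing naturals compares the
    integers.\<close>
  then obtain U where U: "unim U" and Umin: "\<And>U'. unim U' \<Longrightarrow> val U \<le> val U'"
    using ex_has_least_nat[of unim "1\<^sub>m n" val] by blast
  have Uc: "U \<in> carrier_mat n n" "Determinant.det U \<noteq> 0" using U by (auto simp: unim_def)
  define W where "W = transpose_mat U * X * U"
  have W: "pos_mat n W" unfolding W_def by (rule pos_mat_congruence[OF X(1) Uc])
  then have Wc: "W \<in> carrier_mat n n" and Wsym: "\<forall>i<n. \<forall>j<n. W $$ (i, j) = W $$ (j, i)"
    by (auto simp: pos_mat_def)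
  have "Determinant.det W = (Determinant.det U)\<^sup>2 * Determinant.det X"
    using Uc X(2) by (simp add: W_def det_mult[of _ n] det_transpose[of _ n] power2_eq_square)
  also have "(Determinant.det U)\<^sup>2 = 1" using U by (metis unim_def power2_abs one_power2)
  finally have detW: "Determinant.det W = Determinant.det X" by simp
  define a where "a = W $$ (0, 0)"
  have a: "a = bil X (col U 0) (col U 0)"
    unfolding a_def W_def by (rule congruence_index[OF X(2) Uc(1)]) (simp_all add: n_def)
  have bilW: "bil W y y = bil X (U *\<^sub>v y) (U *\<^sub>v y)" if "y \<in> carrier_vec n" for y
    unfolding W_def by (rule bil_congruence[OF X(2) Uc(1) that that])
  have "unit_vec n 0 \<noteq> (0\<^sub>v n :: int Matrix.vec)"
    by (metis index_unit_vec(1) index_zero_vec(1) n_def zero_less_Suc zero_neq_one)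
  moreover have "bil W (unit_vec n 0) (unit_vec n 0) = a"
    using Wc by (simp add: bil_def a_def n_def)
  ultimately have a0: "a > 0" using W by (metis pos_mat_def unit_vec_carrier)
  have min: "a \<le> bil W (col T 0) (col T 0)" if "unim T" for T
  proof -
    have T: "T \<in> carrier_mat n n" using that by (simp add: unim_def)
    have "unim (U * T)" using that U by (auto simp: unim_def det_mult[of _ n] abs_mult)
    moreover have "col (U * T) 0 = U *\<^sub>v col T 0" using T Uc by (auto simp: n_def intro!: eq_vecI)
    ultimately have "nat a \<le> nat (bil W (col T 0) (col T 0))"
      using Umin[of "U * T"] T bilW[of "col T 0"] by (simp add: val_def a carrier_vecI)
    then show ?thesis using a0 by linarith
  qed
  define g where "g = Matrix.mat (Suc m) (Suc m)
    (\<lambda>(i, j). W $$ (0, 0) * W $$ (Suc i, Suc j) - W $$ (Suc i, 0) * W $$ (0, Suc j))"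
  define \<rho> where "\<rho> c = (\<Sum>j<Suc m. W $$ (0, Suc j) * c $v j)" for c
  have square: "a * bil W (vCons t c) (vCons t c) = (a * t + \<rho> c)\<^sup>2 + bil g c c"
    if "c \<in> carrier_vec (Suc m)" for t c
    unfolding a_def \<rho>_def
    by (rule bil_complete_square[OF _ _ that g_def]) (use Wc Wsym in \<open>auto simp: n_def\<close>)
  have "a * (a ^ m * Determinant.det W) = a * Determinant.det g"
    using det_complete_square[OF _ g_def] Wc by (simp add: a_def n_def mult_ac)
  then have detg: "Determinant.det g = a ^ m * Determinant.det X" using a0 detW by simp
  have gc: "g \<in> carrier_mat (Suc m) (Suc m)" by (simp add: g_def)
  have "pos_mat (Suc m) g"
    unfolding pos_mat_def
  proof (intro conjI allI impI ballI)
    fix i j assume "i < Suc m" "j < Suc m"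
    then show "g $$ (i, j) = g $$ (j, i)" using Wsym by (simp add: g_def n_def mult.commute)
  next
    fix y :: "int Matrix.vec" assume y: "y \<in> carrier_vec (Suc m)" "y \<noteq> 0\<^sub>v (Suc m)"
    \<comment> \<open>Positivity of \<open>g\<close> at \<open>y\<close> is read off from
      \<open>W\<close> at an integer vector: after scaling \<open>y\<close> by \<open>a\<close>, the
      first coordinate \<open>- \<rho> y\<close> cancels the completed square exactly.\<close>
    have r: "\<rho> (a \<cdot>\<^sub>v y) = a * \<rho> y"
      unfolding \<rho>_def sum_distrib_left using y by (intro sum.cong) auto
    have "bil g (a \<cdot>\<^sub>v y) (a \<cdot>\<^sub>v y) = a\<^sup>2 * bil g y y"
      using y gc by (simp add: bil_smult[of g "Suc m"] power2_eq_square)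
    then have "a * bil W (vCons (- \<rho> y) (a \<cdot>\<^sub>v y)) (vCons (- \<rho> y) (a \<cdot>\<^sub>v y)) = a * (a * bil g y y)"
      using square[of "a \<cdot>\<^sub>v y" "- \<rho> y"] y r by (simp add: power2_eq_square)
    then have "bil W (vCons (- \<rho> y) (a \<cdot>\<^sub>v y)) (vCons (- \<rho> y) (a \<cdot>\<^sub>v y)) = a * bil g y y"
      using a0 by simp
    moreover have "vCons (- \<rho> y) (a \<cdot>\<^sub>v y) \<noteq> 0\<^sub>v n"
    proof
      assume *: "vCons (- \<rho> y) (a \<cdot>\<^sub>v y) = 0\<^sub>v n"
      have "y $v i = 0" if "i < Suc m" for i
        using arg_cong[OF *, of "\<lambda>v. v $v Suc i"] that y a0 by (simp add: n_def)
      then show False using y by auto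
    qed
    ultimately have "0 < a * bil g y y"
      using W y by (metis n_def pos_mat_def smult_carrier_vec vCons_carrier_vec)
    then show "0 < bil g y y" using a0 by (simp add: zero_less_mult_iff)
  qed (rule gc)
  from Suc.IH[OF this] obtain V where V: "V \<in> carrier_mat (Suc m) (Suc m)" "\<bar>Determinant.det V\<bar> = 1"
    and Vb: "bil g (col V 0) (col V 0) ^ Suc m * 3 ^ \<Sum>{..m} \<le> 4 ^ \<Sum>{..m} * Determinant.det g" by blast
  define c where "c = col V 0"
  define b where "b = bil g c c"
  have c: "c \<in> carrier_vec (Suc m)" using V by (simp add: c_def carrier_vecI)
  \<comment> \<open>The short vector \<open>c\<close> of \<open>g\<close> is lifted so that the
    square is at most \<open>a\<^sup>2 / 4\<close>. Minimality of \<open>a\<close> then yields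
    \<open>a\<^sup>2 \<le> a\<^sup>2 / 4 + b\<close>.\<close>
  obtain t where t: "4 * (a * t + \<rho> c)\<^sup>2 \<le> a\<^sup>2" using nearest_multiple[OF a0] by blast
  \<comment> \<open>The second column of \<open>T\<close> is the lift \<open>vCons t c\<close>, and
    \<open>T\<close> is unimodular because \<open>V\<close> is. Swapping columns puts the lift
    first, where minimality can be applied to it.\<close>
  define T where "T = four_block_mat (1\<^sub>m 1) (Matrix.mat 1 (Suc m) (\<lambda>(i, j). if j = 0 then t else 0)) (0\<^sub>m (Suc m) 1) V"
  have T: "T \<in> carrier_mat n n"
    using four_block_carrier_mat[OF one_carrier_mat V(1), of 1] by (simp add: T_def n_def)
  have "Determinant.det T = Determinant.det V"
    unfolding T_def by (subst det_four_block_mat_lower_left_zero[where n=1 and m="Suc m"]) (use V in auto)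
  then have "unim (swapcols 0 1 T)"
    using V T det_swapcols[of 0 n 1 T] by (simp add: unim_def n_def)
  moreover have "col (swapcols 0 1 T) 0 = vCons t c"
    using V T by (auto simp: n_def c_def T_def vec_index_vCons intro!: eq_vecI)
  ultimately have "a \<le> bil W (vCons t c) (vCons t c)" using min[of "swapcols 0 1 T"] by simp
  then have "a * a \<le> a * bil W (vCons t c) (vCons t c)" using a0 by simp
  then have 3: "3 * a\<^sup>2 \<le> 4 * b" using square[OF c, of t] t by (simp add: b_def power2_eq_square)
  \<comment> \<open>The factor \<open>a ^ m\<close> matches the one in the determinant of
    \<open>g\<close> and is cancelled at the end.\<close>
  have "a ^ m * (a ^ Suc (Suc m) * 3 ^ \<Sum>{..Suc m}) = (3 * a\<^sup>2) ^ Suc m * 3 ^ \<Sum>{..m}"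
    by (simp add: power_mult_distrib power2_eq_square power_add)
  also have "\<dots> \<le> (4 * b) ^ Suc m * 3 ^ \<Sum>{..m}"
    by (intro mult_right_mono power_mono 3) auto
  also have "\<dots> = 4 ^ Suc m * (b ^ Suc m * 3 ^ \<Sum>{..m})" by (simp only: power_mult_distrib mult_ac)
  also have "\<dots> \<le> 4 ^ Suc m * (4 ^ \<Sum>{..m} * Determinant.det g)"
    using Vb by (intro mult_left_mono) (auto simp: b_def c_def)
  also have "\<dots> = a ^ m * (4 ^ \<Sum>{..Suc m} * Determinant.det X)"
    by (simp add: detg power_add)
  finally have "a ^ Suc (Suc m) * 3 ^ \<Sum>{..Suc m} \<le> 4 ^ \<Sum>{..Suc m} * Determinant.det X"
    using a0 by (simp only: mult_le_cancel_left_pos zero_less_power)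
  then show ?case using U by (auto simp: unim_def n_def a intro!: exI[of _ U])
qed

lemma bil_col_pos:
  assumes "pos_mat n X" "U \<in> carrier_mat n n" "\<bar>Determinant.det U\<bar> = 1" "0 < n"
  shows "0 < bil X (col U 0) (col U 0)"
proof -
  have "U *\<^sub>v unit_vec n 0 = col U 0" using assms by (auto intro!: eq_vecI)
  moreover have "unit_vec n 0 \<noteq> (0\<^sub>v n :: int Matrix.vec)"
    by (metis index_unit_vec(1) index_zero_vec(1) assms(4) zero_neq_one)
  ultimately have "col U 0 \<noteq> 0\<^sub>v n"
    using mult_mat_vec_eq_0[OF assms(2) _ unit_vec_carrier] assms(3) by fastforce
  then show ?thesis using assms by (auto simp: pos_mat_def)
qed

text \<open>Read off from Hermite's bound: its left side is a power of a positive value.\<close>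

lemma pos_mat_det_pos:
  assumes "pos_mat n X"
  shows "0 < Determinant.det X"
proof (cases n)
  case 0
  then show ?thesis using assms by (simp add: pos_mat_def)
next
  case (Suc m)
  then obtain U where U: "U \<in> carrier_mat n n" "\<bar>Determinant.det U\<bar> = 1"
    and b: "bil X (col U 0) (col U 0) ^ Suc m * 3 ^ \<Sum>{..m} \<le> 4 ^ \<Sum>{..m} * Determinant.det X"
    using hermite_bound assms by blast
  have "0 < bil X (col U 0) (col U 0) ^ Suc m * 3 ^ \<Sum>{..m}"
    using bil_col_pos[OF assms U] Suc by simp
  with b have "0 < 4 ^ \<Sum>{..m} * Determinant.det X" by linarith
  then show ?thesis by (simp add: zero_less_mult_iff)
qed

text \<open>The congruence modulo \<open>4\<close> forces \<open>n div 2\<close> to be even, so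
  \<open>4\<close> divides \<open>n\<close>. In rank \<open>4\<close> Hermite's bound gives a vector
  whose value has fourth power at most \<open>4096 / 729 < 16\<close>, whereas a positive even value
  is at least \<open>2\<close>.\<close>

lemma even_unimodular_rank:
  assumes E: "even_mat n X" and P: "pos_mat n X" and d: "Determinant.det X = 1" and "0 < n"
  shows "8 \<le> n"
proof -
  have n: "even n" "[1 = (-1 :: int) ^ (n div 2)] (mod 4)" using even_mat_odd_det[OF E] d by auto
  have "even (n div 2)" using n(2) by (cases "even (n div 2)") (auto simp: cong_def)
  then have "4 dvd n" using n(1) by presburger
  moreover have "n \<noteq> 4"
  proof
    assume "n = 4"
    with P have "pos_mat (Suc 3) X" by simp
    from hermite_bound[OF this] obtain U where U: "U \<in> carrier_mat n n" "\<bar>Determinant.det U\<bar> = 1"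
      and b: "bil X (col U 0) (col U 0) ^ Suc 3 * 3 ^ \<Sum>{..3} \<le> 4 ^ \<Sum>{..3::nat}"
      using d \<open>n = 4\<close> by auto
    have "\<Sum>{..3::nat} = 6" by (simp add: numeral_3_eq_3)
    with b have b: "bil X (col U 0) (col U 0) ^ 4 * 729 \<le> 4096" by simp
    have "even (bil X (col U 0) (col U 0))" using even_bil[OF E] U by auto
    with bil_col_pos[OF P U] \<open>0 < n\<close> have "2 \<le> bil X (col U 0) (col U 0)" by presburger
    then have "2 ^ 4 \<le> bil X (col U 0) (col U 0) ^ 4" by (intro power_mono) auto
    with b show False by simp
  qed
  ultimately show ?thesis using \<open>0 < n\<close> by presburger
qed

section \<open>Overlattices of the integer vectors\<close>

abbreviation real_mat :: "int mat \<Rightarrow> real mat" where "real_mat \<equiv> map_mat real_of_int"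
abbreviation real_vec :: "int Matrix.vec \<Rightarrow> real Matrix.vec" where "real_vec \<equiv> map_vec real_of_int"

definition int_vec :: "nat \<Rightarrow> real Matrix.vec \<Rightarrow> bool" where
  "int_vec n y \<longleftrightarrow> y \<in> carrier_vec n \<and> (\<forall>i<n. y $v i \<in> \<int>)"

lemma int_vecE:
  assumes "int_vec n y"
  obtains z where "z \<in> carrier_vec n" "y = real_vec z"
proof
  show "Matrix.vec n (\<lambda>i. \<lfloor>y $v i\<rfloor>) \<in> carrier_vec n" by simp
  show "y = real_vec (Matrix.vec n (\<lambda>i. \<lfloor>y $v i\<rfloor>))"
    using assms by (auto simp: int_vec_def elim!: Ints_cases intro!: eq_vecI)
qed

lemma int_vec_real_vec: "z \<in> carrier_vec n \<Longrightarrow> int_vec n (real_vec z)"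
  by (auto simp: int_vec_def)

lemma int_vec_add: "int_vec n y \<Longrightarrow> int_vec n z \<Longrightarrow> int_vec n (y + z)"
  by (auto simp: int_vec_def)

lemma int_vec_smult: "int_vec n y \<Longrightarrow> int_vec n (of_int c \<cdot>\<^sub>v y)"
  by (auto simp: int_vec_def)

lemma bil_real:
  assumes "X \<in> carrier_mat n n" "y \<in> carrier_vec n" "z \<in> carrier_vec n"
  shows "bil (real_mat X) (real_vec y) (real_vec z) = of_int (bil X y z)"
  using assms by (simp add: bil_sum[of _ n])

lemma det_real: "Determinant.det (real_mat X) = of_int (Determinant.det X)"
  by (rule of_int_hom.hom_det)

lemma bil_int:
  assumes "x \<in> carrier_vec n" "int_vec n (X *\<^sub>v y)" "int_vec n x"
  shows "bil X x y \<in> \<int>"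
proof -
  have "dim_vec (X *\<^sub>v y) = n" using assms(2) unfolding int_vec_def by (rule carrier_vecD[OF conjunct1])
  then show ?thesis
    using assms unfolding bil_def scalar_prod_def
    by (intro Ints_sum Ints_mult) (simp_all add: int_vec_def)
qed

text \<open>The columns of the inverse of \<open>X\<close> are among the vectors \<open>y\<close>,
  so \<open>m\<close> times the inverse is an integer matrix \<open>Z\<close>. Its product with
  \<open>X\<close> is \<open>m\<close> times the identity, and determinants give the claim. The
  vectors \<open>y\<close> are the coordinates of dual vectors, so \<open>H\<close> says that
  \<open>m\<close> annihilates the discriminant group.\<close>

lemma det_dvd_of_integral_multiple_inverse:
  assumes X: "X \<in> carrier_mat n n" and d0: "Determinant.det X \<noteq> 0"
    and H: "\<And>y. y \<in> carrier_vec n \<Longrightarrow> int_vec n (real_mat X *\<^sub>v y) \<Longrightarrow> int_vec n (of_int m \<cdot>\<^sub>v y)"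
  shows "Determinant.det X dvd m ^ n"
proof -
  define d where "d = Determinant.det X"
  note adj = adj_mat[OF X]
  define Z where "Z = Matrix.mat n n (\<lambda>(i, j). \<lfloor>of_int m * (real_of_int (adj_mat X $$ (i, j)) / of_int d)\<rfloor>)"
  have Zc: "Z \<in> carrier_mat n n" by (simp add: Z_def)
  have Z: "d * Z $$ (i, j) = m * adj_mat X $$ (i, j)" if "i < n" "j < n" for i j
  proof -
    define y where "y = (1 / real_of_int d) \<cdot>\<^sub>v col (real_mat (adj_mat X)) j"
    have y: "y \<in> carrier_vec n" using adj by (simp add: y_def carrier_vecI)
    have "(real_mat X *\<^sub>v y) $v k = (if k = j then 1 else 0)" if "k < n" for k
    proof -
      have "(real_mat X *\<^sub>v y) $v k = (1 / real_of_int d) * of_int ((X * adj_mat X) $$ (k, j))"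
        using X adj(1) that \<open>j < n\<close> y by (simp add: y_def scalar_prod_def sum_divide_distrib)
      also have "(X * adj_mat X) $$ (k, j) = d * (if k = j then 1 else 0)"
        using that \<open>j < n\<close> by (simp add: adj(2) d_def)
      finally show ?thesis using d0 by (auto simp: d_def)
    qed
    then have "int_vec n (real_mat X *\<^sub>v y)" using X y by (auto simp: int_vec_def)
    from H[OF y this] have "of_int m * y $v i \<in> \<int>" using that y by (auto simp: int_vec_def)
    then have "of_int m * (real_of_int (adj_mat X $$ (i, j)) / of_int d) \<in> \<int>"
      using that adj by (simp add: y_def)
    then have "real_of_int (Z $$ (i, j)) = of_int m * (real_of_int (adj_mat X $$ (i, j)) / of_int d)"
      using that by (auto simp: Z_def elim!: Ints_cases)
    then have "real_of_int (d * Z $$ (i, j)) = real_of_int (m * adj_mat X $$ (i, j))"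
      using d0 by (simp add: d_def field_simps)
    then show ?thesis by linarith
  qed
  have "d \<cdot>\<^sub>m Z = m \<cdot>\<^sub>m adj_mat X" using Z Zc adj by (auto intro!: eq_matI)
  from arg_cong[OF this, of Determinant.det]
  have "d ^ n * Determinant.det Z = m ^ n * Determinant.det (adj_mat X)" using Zc adj by simp
  then have "d ^ n * (d * Determinant.det Z) = m ^ n * (d * Determinant.det (adj_mat X))"
    by (simp add: mult.left_commute)
  also have "d * Determinant.det (adj_mat X) = d ^ n"
    using arg_cong[OF adj(2), of Determinant.det] det_mult[OF X adj(1)] by (simp add: d_def)
  finally have "d * Determinant.det Z = m ^ n" using d0 by (simp add: d_def)
  then show ?thesis unfolding d_def by (metis dvd_triv_left)
qed

lemma inverse_matE:
  fixes C :: "'a::field mat"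
  assumes C: "C \<in> carrier_mat n n" and d: "Determinant.det C \<noteq> 0"
  obtains Q where "Q \<in> carrier_mat n n" "Q * C = 1\<^sub>m n" "C * Q = 1\<^sub>m n"
proof
  note adj = adj_mat[OF C]
  let ?Q = "(1 / Determinant.det C) \<cdot>\<^sub>m adj_mat C"
  show "?Q \<in> carrier_mat n n" using adj by simp
  show "?Q * C = 1\<^sub>m n"
    using adj d by (auto simp: mult_smult_assoc_mat[OF adj(1) C] intro!: eq_matI)
  show "C * ?Q = 1\<^sub>m n"
    using adj d by (auto simp: mult_smult_distrib[OF C adj(1)] intro!: eq_matI)
qed

lemma solve_mat:
  fixes C :: "'a::field mat"
  assumes C: "C \<in> carrier_mat n n" and d: "Determinant.det C \<noteq> 0" and v: "v \<in> carrier_vec n"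
  obtains t where "t \<in> carrier_vec n" "C *\<^sub>v t = v"
proof -
  obtain Q where Q: "Q \<in> carrier_mat n n" "C * Q = 1\<^sub>m n" using inverse_matE[OF C d] by metis
  have "C *\<^sub>v (Q *\<^sub>v v) = C * Q *\<^sub>v v" by (rule assoc_mult_mat_vec[OF C Q(1) v, symmetric])
  then show ?thesis using that[of "Q *\<^sub>v v"] Q v by simp
qed

text \<open>A group between the integer vectors and their multiples by \<open>1 / q\<close>. This is
  how an overlattice looks in coordinates of a basis of the smaller lattice.\<close>

locale lattice_vecs =
  fixes n :: nat and q :: int and M :: "real Matrix.vec set"
  assumes M_carrier: "M \<subseteq> carrier_vec n"
    and M_add: "x \<in> M \<Longrightarrow> y \<in> M \<Longrightarrow> x + y \<in> M"
    and M_smult: "x \<in> M \<Longrightarrow> of_int c \<cdot>\<^sub>v x \<in> M"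
    and int_M: "int_vec n x \<Longrightarrow> x \<in> M"
    and q_pos: "0 < q"
    and q_M: "x \<in> M \<Longrightarrow> int_vec n (of_int q \<cdot>\<^sub>v x)"
begin

lemma mult_int_mem:
  assumes C: "C \<in> carrier_mat n n" and cols: "\<And>j. j < n \<Longrightarrow> col C j \<in> M" and z: "int_vec n z"
  shows "C *\<^sub>v z \<in> M"
proof -
  have zi: "\<exists>c. z $v j = of_int c" if "j < n" for j using z that by (auto simp: int_vec_def elim!: Ints_cases)
  have "Matrix.vec n (\<lambda>i. \<Sum>j<k. C $$ (i, j) * z $v j) \<in> M" if "k \<le> n" for k
    using that
  proof (induction k)
    case 0
    show ?case by (rule int_M) (simp add: int_vec_def)
  next
    case (Suc k)
    then obtain c where c: "z $v k = of_int c" using zi[of k] by auto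
    have "Matrix.vec n (\<lambda>i. \<Sum>j<Suc k. C $$ (i, j) * z $v j)
        = Matrix.vec n (\<lambda>i. \<Sum>j<k. C $$ (i, j) * z $v j) + of_int c \<cdot>\<^sub>v col C k"
      using C Suc.prems by (auto simp: c intro!: eq_vecI)
    then show ?case using Suc cols[of k] by (auto intro!: M_add M_smult)
  qed
  moreover have "C *\<^sub>v z = Matrix.vec n (\<lambda>i. \<Sum>j<n. C $$ (i, j) * z $v j)"
    using C z by (auto simp: int_vec_def scalar_prod_def lessThan_atLeast0 intro!: eq_vecI sum.cong)
  ultimately show ?thesis by simp
qed

text \<open>A system of \<open>n\<close> independent vectors of \<open>M\<close> with the least possible volume is a basis.\<close>

lemma basis_exists:
  obtains C where "C \<in> carrier_mat n n" "Determinant.det C \<noteq> 0"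
    "M = {C *\<^sub>v z | z. int_vec n z}"
proof -
  define T where "T C \<longleftrightarrow> C \<in> carrier_mat n n \<and> (\<forall>j<n. col C j \<in> M) \<and> Determinant.det C \<noteq> 0" for C
  \<comment> \<open>Every entry of \<open>q\<close> times \<open>C\<close> is an integer, so the
    scaled volume is a natural number and a least one exists.\<close>
  define val where "val C = nat \<lfloor>\<bar>of_int q ^ n * Determinant.det C\<bar>\<rfloor>" for C :: "real mat"
  have val: "real (val C) = of_int q ^ n * \<bar>Determinant.det C\<bar>" if "T C" for C
  proof -
    have C: "C \<in> carrier_mat n n" using that by (simp add: T_def)
    define e where "e i j = \<lfloor>of_int q * C $$ (i, j)\<rfloor>" for i j
    have "of_int q * C $$ (i, j) = of_int (e i j)" if "i < n" "j < n" for i j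
    proof -
      have "int_vec n (of_int q \<cdot>\<^sub>v col C j)" using \<open>T C\<close> that q_M by (auto simp: T_def)
      then have "of_int q * C $$ (i, j) \<in> \<int>" using that C by (auto simp: int_vec_def)
      then show ?thesis by (auto simp: e_def elim!: Ints_cases)
    qed
    then have "of_int q \<cdot>\<^sub>m C = real_mat (Matrix.mat n n (\<lambda>(i, j). e i j))"
      using C by (intro eq_matI) simp_all
    from arg_cong[OF this, of Determinant.det]
    have "of_int q ^ n * Determinant.det C = of_int (Determinant.det (Matrix.mat n n (\<lambda>(i, j). e i j)))" using C by (simp add: det_real)
    then have "real (val C) = \<bar>of_int q ^ n * Determinant.det C\<bar>" by (simp add: val_def)
    then show ?thesis using q_pos by (simp add: abs_mult)
  qed
  have "T (1\<^sub>m n)"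
    by (auto simp: T_def int_vec_def unit_vec_def intro!: int_M)
  then obtain C where C: "T C" and min: "\<And>C'. T C' \<Longrightarrow> val C \<le> val C'"
    using ex_has_least_nat[of T "1\<^sub>m n" val] by blast
  have Cc: "C \<in> carrier_mat n n" and cols: "\<And>j. j < n \<Longrightarrow> col C j \<in> M" and d: "Determinant.det C \<noteq> 0"
    using C by (auto simp: T_def)
  have "\<exists>z. v = C *\<^sub>v z \<and> int_vec n z" if v: "v \<in> M" for v
  proof -
    have "v \<in> carrier_vec n" using v M_carrier by auto
    then obtain t where t: "t \<in> carrier_vec n" "C *\<^sub>v t = v" using solve_mat[OF Cc d] by blast
    define fl where "fl = Matrix.vec n (\<lambda>i. real_of_int (- \<lfloor>t $v i\<rfloor>))"
    define fr where "fr = t + fl"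
    have fl: "int_vec n fl" by (simp add: fl_def int_vec_def)
    then have flc: "fl \<in> carrier_vec n" and frc: "fr \<in> carrier_vec n" using t by (auto simp: int_vec_def fr_def)
    have fr: "fr $v i = frac (t $v i)" if "i < n" for i using that t by (simp add: fr_def fl_def frac_def)
    have v': "C *\<^sub>v fr \<in> M"
      using mult_add_distrib_mat_vec[OF Cc t(1) flc] mult_int_mem[OF Cc cols fl] v t(2)
      by (auto simp: fr_def intro: M_add)
    have "frac (t $v k) = 0" if k: "k < n" for k
    proof (rule ccontr)
      assume nz: "frac (t $v k) \<noteq> 0"
      \<comment> \<open>If the coordinate \<open>t $v k\<close> had a fractional part, then by
        Cramer's rule replacing column \<open>k\<close> by \<open>C *\<^sub>v fr\<close> would
        multiply the volume by that part, a number strictly between \<open>0\<close> and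
        \<open>1\<close>.\<close>
      define C' where "C' = replace_col C (C *\<^sub>v fr) k"
      have det': "Determinant.det C' = frac (t $v k) * Determinant.det C"
        using cramer_lemma_mat[OF Cc frc k] fr[OF k] by (simp add: C'_def)
      have "T C'"
        unfolding T_def
      proof (intro conjI allI impI)
        show "C' \<in> carrier_mat n n" using Cc by (simp add: C'_def replace_col_def)
        show "Determinant.det C' \<noteq> 0" using det' nz d by simp
        fix j assume j: "j < n"
        have "col C' j = (if j = k then C *\<^sub>v fr else col C j)"
          using Cc j by (auto simp: C'_def replace_col_def intro!: eq_vecI)
        then show "col C' j \<in> M" using v' cols j by simp
      qed
      then have "real (val C) \<le> real (val C')" using min by simp
      then have "1 * (of_int q ^ n * \<bar>Determinant.det C\<bar>) \<le> frac (t $v k) * (of_int q ^ n * \<bar>Determinant.det C\<bar>)"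
        using val[OF C] val[OF \<open>T C'\<close>] by (simp add: det' abs_mult frac_ge_0 mult_ac)
      moreover have "0 < of_int q ^ n * \<bar>Determinant.det C\<bar>" using q_pos d by simp
      ultimately have "1 \<le> frac (t $v k)" by (simp only: mult_le_cancel_right_pos)
      then show False using frac_lt_1[of "t $v k"] by linarith
    qed
    then have "int_vec n t" using t by (auto simp: int_vec_def frac_eq_0_iff)
    then show ?thesis using t by blast
  qed
  then have "M = {C *\<^sub>v z | z. int_vec n z}" using mult_int_mem[OF Cc cols] by blast
  then show thesis using that Cc d by blast
qed

text \<open>In a basis of \<open>M\<close> the form becomes an even positive definite integer matrix
  \<open>G\<close>. Self-duality makes the inverse of \<open>G\<close> integral, hence the
  determinant divides \<open>1\<close>, and \<open>even_unimodular_rank\<close> applies.\<close>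

lemma even_self_dual_rank:
  assumes A: "pos_mat n A" and n: "0 < n"
    and even: "\<And>x. x \<in> M \<Longrightarrow> \<exists>k. bil (real_mat A) x x = 2 * of_int k"
    and int: "\<And>x y. x \<in> M \<Longrightarrow> y \<in> M \<Longrightarrow> bil (real_mat A) x y \<in> \<int>"
    and dual: "\<And>y. y \<in> carrier_vec n \<Longrightarrow> (\<And>x. x \<in> M \<Longrightarrow> bil (real_mat A) x y \<in> \<int>) \<Longrightarrow> y \<in> M"
  shows "8 \<le> n"
proof -
  obtain C where C: "C \<in> carrier_mat n n" "Determinant.det C \<noteq> 0" and M: "M = {C *\<^sub>v z | z. int_vec n z}"
    by (rule basis_exists)
  have Ac: "A \<in> carrier_mat n n" and RA: "real_mat A \<in> carrier_mat n n" using A by (auto simp: pos_mat_def)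
  have sym: "bil (real_mat A) x y = bil (real_mat A) y x" if "x \<in> carrier_vec n" "y \<in> carrier_vec n" for x y
    by (rule bil_commute[OF RA]) (use A that in \<open>auto simp: pos_mat_def\<close>)
  have colM: "col C j \<in> M" if "j < n" for j
  proof -
    have "col C j = C *\<^sub>v unit_vec n j" using C that by (auto intro!: eq_vecI)
    moreover have "int_vec n (unit_vec n j)" by (auto simp: int_vec_def unit_vec_def)
    ultimately show ?thesis using M by blast
  qed
  define G where "G = Matrix.mat n n (\<lambda>(i, j). \<lfloor>bil (real_mat A) (col C i) (col C j)\<rfloor>)"
  have Gc: "G \<in> carrier_mat n n" by (simp add: G_def)
  have Gij: "real_of_int (G $$ (i, j)) = bil (real_mat A) (col C i) (col C j)" if "i < n" "j < n" for i j
    using int[OF colM[OF that(1)] colM[OF that(2)]] that by (auto simp: G_def elim!: Ints_cases)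
  have G: "real_mat G = transpose_mat C * real_mat A * C"
  proof (rule eq_matI)
    fix i j assume "i < dim_row (transpose_mat C * real_mat A * C)" "j < dim_col (transpose_mat C * real_mat A * C)"
    then have "i < n" "j < n" using C by auto
    then show "real_mat G $$ (i, j) = (transpose_mat C * real_mat A * C) $$ (i, j)"
      using Gij Gc congruence_index[OF RA C(1)] by simp
  qed (use C Gc in auto)
  have Gsym: "G $$ (i, j) = G $$ (j, i)" if "i < n" "j < n" for i j
  proof -
    have "real_of_int (G $$ (i, j)) = real_of_int (G $$ (j, i))"
      unfolding Gij[OF that] Gij[OF that(2,1)] by (rule sym) (use C in \<open>auto intro: carrier_vecI\<close>)
    then show ?thesis by simp
  qed
  have GE: "even_mat n G"
    unfolding even_mat_def
  proof (intro conjI allI impI Gc Gsym)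
    fix i assume i: "i < n"
    obtain k where "bil (real_mat A) (col C i) (col C i) = 2 * of_int k" using even[OF colM[OF i]] by blast
    then have "real_of_int (G $$ (i, i)) = of_int (2 * k)" using Gij[OF i i] by simp
    then show "even (G $$ (i, i))" by (metis dvd_triv_left of_int_eq_iff)
  qed
  have GP: "pos_mat n G"
    unfolding pos_mat_def
  proof (intro conjI allI impI ballI Gc Gsym)
    fix y :: "int Matrix.vec" assume y: "y \<in> carrier_vec n" "y \<noteq> 0\<^sub>v n"
    define x where "x = C *\<^sub>v real_vec y"
    have ry: "real_vec y \<in> carrier_vec n" using y by simp
    have x: "x \<in> M" unfolding M x_def using int_vec_real_vec[OF y(1)] by blast
    then have xc: "x \<in> carrier_vec n" using M_carrier by auto
    have "real_vec y \<noteq> 0\<^sub>v n"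
    proof
      assume *: "real_vec y = 0\<^sub>v n"
      have "y $v i = 0" if "i < n" for i using arg_cong[OF *, of "\<lambda>v. v $v i"] that y by simp
      then show False using y by auto
    qed
    then have "x \<noteq> 0\<^sub>v n" using mult_mat_vec_eq_0[OF C ry] by (auto simp: x_def)
    \<comment> \<open>Positivity of \<open>A\<close> is available only at integer vectors, so
      \<open>x\<close> is first multiplied by \<open>q\<close>.\<close>
    obtain z where z: "z \<in> carrier_vec n" "of_int q \<cdot>\<^sub>v x = real_vec z" using q_M[OF x] by (rule int_vecE)
    have "z \<noteq> 0\<^sub>v n"
    proof
      assume "z = 0\<^sub>v n"
      then have *: "of_int q \<cdot>\<^sub>v x = 0\<^sub>v n" using z by (auto intro!: eq_vecI)
      have "x $v i = 0" if "i < n" for i using arg_cong[OF *, of "\<lambda>v. v $v i"] that xc q_pos by simp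
      then show False using \<open>x \<noteq> 0\<^sub>v n\<close> xc by auto
    qed
    then have "0 < bil A z z" using A z by (auto simp: pos_mat_def)
    then have "0 < bil (real_mat A) (of_int q \<cdot>\<^sub>v x) (of_int q \<cdot>\<^sub>v x)"
      using bil_real[OF Ac z(1) z(1)] z(2) by simp
    also have "\<dots> = (of_int q)\<^sup>2 * bil (real_mat A) x x"
      using xc by (simp add: bil_smult[OF RA] power2_eq_square)
    finally have "0 < bil (real_mat A) x x" by (simp add: zero_less_mult_iff)
    also have "\<dots> = bil (real_mat G) (real_vec y) (real_vec y)"
      unfolding G x_def by (rule bil_congruence[OF RA C(1) ry ry, symmetric])
    also have "\<dots> = of_int (bil G y y)" by (rule bil_real[OF Gc y(1) y(1)])
    finally show "0 < bil G y y" by simp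
  qed
  have "0 < Determinant.det G" by (rule pos_mat_det_pos[OF GP])
  have "Determinant.det G dvd 1 ^ n"
  proof (rule det_dvd_of_integral_multiple_inverse[OF Gc])
    show "Determinant.det G \<noteq> 0" using \<open>0 < Determinant.det G\<close> by simp
    fix y :: "real Matrix.vec" assume y: "y \<in> carrier_vec n" "int_vec n (real_mat G *\<^sub>v y)"
    have "C *\<^sub>v y \<in> M"
    proof (rule dual)
      show "C *\<^sub>v y \<in> carrier_vec n" using C y by auto
      fix x assume "x \<in> M"
      then obtain z where z: "x = C *\<^sub>v z" "int_vec n z" using M by blast
      then have zc: "z \<in> carrier_vec n" by (simp add: int_vec_def)
      have "bil (real_mat A) x (C *\<^sub>v y) = bil (real_mat G) z y"
        unfolding G z(1) by (rule bil_congruence[OF RA C(1) zc y(1), symmetric])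
      then show "bil (real_mat A) x (C *\<^sub>v y) \<in> \<int>" using bil_int[OF zc y(2) z(2)] by simp
    qed
    then obtain z where z: "C *\<^sub>v y = C *\<^sub>v z" "int_vec n z" using M by blast
    then have zc: "z \<in> carrier_vec n" by (simp add: int_vec_def)
    have "C *\<^sub>v (y - z) = 0\<^sub>v n"
      using mult_minus_distrib_mat_vec[OF C(1) y(1) zc] z(1) C zc by simp
    then have "y - z = 0\<^sub>v n" using mult_mat_vec_eq_0[OF C, of "y - z"] y zc by simp
    then have "(y - z) $v i = 0" if "i < n" for i using that by simp
    then have "y = z" using y zc by (intro eq_vecI) auto
    then show "int_vec n (of_int 1 \<cdot>\<^sub>v y)" using z by simp
  qed
  then have "Determinant.det G = 1" using \<open>0 < Determinant.det G\<close> by simp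
  then show ?thesis by (rule even_unimodular_rank[OF GE GP _ n])
qed

end

section \<open>Rank bounds in coordinates\<close>

text \<open>Coordinates of an even positive definite lattice whose dual is generated, modulo the
  lattice, by \<open>u\<close> and \<open>w\<close>. The products have the values that generators of
  \<open>module_B\<close> (\<open>\<epsilon> = 1\<close>) or \<open>module_C\<close>
  (\<open>\<epsilon> = 0\<close>) force: norms modulo \<open>2\<close>, the mixed product modulo
  \<open>1\<close>.\<close>

locale two_generated_dual =
  fixes n :: nat and A :: "int mat" and q \<epsilon> :: int and u w :: "real Matrix.vec"
  assumes A_even: "even_mat n A" and A_pos: "pos_mat n A" and q_pos: "0 < q"
    and u: "u \<in> carrier_vec n" "int_vec n (real_mat A *\<^sub>v u)" "int_vec n (of_int q \<cdot>\<^sub>v u)"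
    and w: "w \<in> carrier_vec n" "int_vec n (real_mat A *\<^sub>v w)" "int_vec n (of_int q \<cdot>\<^sub>v w)"
    and generated: "y \<in> carrier_vec n \<Longrightarrow> int_vec n (real_mat A *\<^sub>v y) \<Longrightarrow>
      \<exists>l c d. int_vec n l \<and> y = l + (of_int c \<cdot>\<^sub>v u + of_int d \<cdot>\<^sub>v w)"
    and uu_ex: "\<exists>k. bil (real_mat A) u u = 2 * of_int \<epsilon> / of_int q + 2 * of_int k"
    and ww_ex: "\<exists>k. bil (real_mat A) w w = 2 * of_int \<epsilon> / of_int q + 2 * of_int k"
    and uw_ex: "\<exists>k. bil (real_mat A) u w = 1 / of_int q + of_int k"
begin

abbreviation bl :: "real Matrix.vec \<Rightarrow> real Matrix.vec \<Rightarrow> real" where "bl \<equiv> bil (real_mat A)"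

lemma A_carrier: "A \<in> carrier_mat n n" "real_mat A \<in> carrier_mat n n"
  using A_pos by (auto simp: pos_mat_def)

lemma bl_commute: "x \<in> carrier_vec n \<Longrightarrow> y \<in> carrier_vec n \<Longrightarrow> bl x y = bl y x"
  by (rule bil_commute[OF A_carrier(2)]) (use A_pos in \<open>auto simp: pos_mat_def\<close>)

lemmas bl_simps = bil_add[OF A_carrier(2)] bil_smult[OF A_carrier(2)]

lemma int_vec_A: "int_vec n y \<Longrightarrow> int_vec n (real_mat A *\<^sub>v y)"
  using A_carrier by (auto simp: int_vec_def scalar_prod_def)

lemma bl_u_int: "int_vec n l \<Longrightarrow> bl l u \<in> \<int>" and bl_w_int: "int_vec n l \<Longrightarrow> bl l w \<in> \<int>"
  and bl_int: "int_vec n l \<Longrightarrow> int_vec n l' \<Longrightarrow> bl l l' \<in> \<int>"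
  using bil_int[OF _ u(2)] bil_int[OF _ w(2)] bil_int[OF _ int_vec_A] by (auto simp: int_vec_def)

text \<open>\<open>q\<close> annihilates both generators, hence the whole dual modulo the
  lattice.\<close>

lemma det_A_dvd: "Determinant.det A dvd q ^ n"
proof (rule det_dvd_of_integral_multiple_inverse[OF A_carrier(1)])
  show "Determinant.det A \<noteq> 0" using pos_mat_det_pos[OF A_pos] by simp
  fix y assume "y \<in> carrier_vec n" "int_vec n (real_mat A *\<^sub>v y)"
  then obtain l c d where l: "int_vec n l" and y: "y = l + (of_int c \<cdot>\<^sub>v u + of_int d \<cdot>\<^sub>v w)"
    using generated by blast
  have "of_int q \<cdot>\<^sub>v y = of_int q \<cdot>\<^sub>v l + (of_int c \<cdot>\<^sub>v (of_int q \<cdot>\<^sub>v u) + of_int d \<cdot>\<^sub>v (of_int q \<cdot>\<^sub>v w))"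
    using l u(1) w(1) by (auto simp: y int_vec_def algebra_simps intro!: eq_vecI)
  then show "int_vec n (of_int q \<cdot>\<^sub>v y)" using l u(3) w(3) by (auto intro!: int_vec_add int_vec_smult)
qed

text \<open>Adjoining \<open>u + e\<^sub>1/q\<close> and \<open>w + e\<^sub>2/q\<close>, where \<open>e\<^sub>1\<close> and \<open>e\<^sub>2\<close> span a copy of the
  \<open>-q\<close>-fold of the \<open>A\<^sub>2\<close> lattice, gives an even lattice of rank \<open>n + 2\<close> and determinant \<open>3\<close>.\<close>

lemma rank_mod_4:
  assumes "\<epsilon> = 1" and q2: "q = 2 ^ r"
  shows "4 dvd n"
proof -
  obtain k1 where k1: "bl u u = 2 / of_int q + 2 * of_int k1" using uu_ex assms(1) by auto
  obtain k2 where k2: "bl w w = 2 / of_int q + 2 * of_int k2" using ww_ex assms(1) by auto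
  obtain k3 where k3: "bl u w = 1 / of_int q + of_int k3" using uw_ex by auto
  obtain a where a: "a \<in> carrier_vec n" "real_mat A *\<^sub>v u = real_vec a" using u(2) by (rule int_vecE)
  obtain b where b: "b \<in> carrier_vec n" "real_mat A *\<^sub>v w = real_vec b" using w(2) by (rule int_vecE)
  have blu: "bl l u = (\<Sum>j<n. of_int (a $v j) * l $v j)" and blw: "bl l w = (\<Sum>j<n. of_int (b $v j) * l $v j)"
    if "l \<in> carrier_vec n" for l
    using that a b by (auto simp: bil_def scalar_prod_def lessThan_atLeast0 mult.commute)
  \<comment> \<open>\<open>X\<close> is going to be the Gram matrix of the glued lattice, for the
    old basis followed by the two glue vectors. \<open>R\<close> holds the products of
    \<open>u\<close> and \<open>w\<close> with the old basis. In \<open>S\<close> the fractions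
    \<open>2 / q\<close> and \<open>1 / q\<close> have been cancelled by the negative
    \<open>A\<^sub>2\<close> part, leaving integers.\<close>
  define R where "R = Matrix.mat n 2 (\<lambda>(i, j). if j = 0 then a $v i else b $v i)"
  define S where "S = Matrix.mat 2 2 (\<lambda>(i, j). if i = j then (if i = 0 then 2 * k1 else 2 * k2) else k3)"
  define X where "X = four_block_mat A R (transpose_mat R) S"
  have Rc: "R \<in> carrier_mat n 2" and Sc: "S \<in> carrier_mat 2 2" by (auto simp: R_def S_def)
  have Xc: "X \<in> carrier_mat (n + 2) (n + 2)" unfolding X_def by (rule four_block_carrier_mat[OF A_carrier(1) Sc])
  have XE: "even_mat (n + 2) X"
    unfolding even_mat_def
  proof (intro conjI allI impI Xc)
    fix i j assume ij: "i < n + 2" "j < n + 2"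
    have "A $$ (i, j) = A $$ (j, i)" if "i < n" "j < n" using A_even that by (simp add: even_mat_def)
    then show "X $$ (i, j) = X $$ (j, i)"
      using ij A_carrier(1) Rc Sc by (auto simp: X_def) (auto simp: S_def)
  next
    fix i assume i: "i < n + 2"
    have "even (A $$ (i, i))" if "i < n" using A_even that by (simp add: even_mat_def)
    then show "even (X $$ (i, i))"
      using i A_carrier(1) Rc Sc by (auto simp: X_def) (auto simp: S_def)
  qed
  define U where "U = Matrix.mat n 2 (\<lambda>(i, j). if j = 0 then u $v i else w $v i)"
  have Uc: "U \<in> carrier_mat n 2" by (simp add: U_def)
  have AU: "real_mat A * U = real_mat R"
  proof (rule eq_matI)
    fix i j assume "i < dim_row (real_mat R)" "j < dim_col (real_mat R)"
    then have ij: "i < n" "j < 2" using Rc by auto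
    have "(real_mat A * U) $$ (i, j) = (real_mat A *\<^sub>v (if j = 0 then u else w)) $v i"
      using ij A_carrier u(1) w(1) by (auto simp: U_def scalar_prod_def intro!: sum.cong)
    then show "(real_mat A * U) $$ (i, j) = real_mat R $$ (i, j)" using ij a b by (auto simp: R_def)
  qed (use A_carrier Rc Uc in auto)
  have RX: "real_mat X = four_block_mat (real_mat A) (real_mat R) (transpose_mat (real_mat R)) (real_mat S)"
    using A_carrier(1) Rc Sc by (simp add: X_def map_four_block_mat[of _ n n _ 2 _ 2] transpose_mat_def map_mat_def)
      (auto intro!: eq_matI)
  have detA: "0 < Determinant.det A" by (rule pos_mat_det_pos[OF A_pos])
  then obtain Q where Q: "Q \<in> carrier_mat n n" "Q * real_mat A = 1\<^sub>m n"
    using inverse_matE[OF A_carrier(2)] det_real[of A] by auto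
  have "1 \<cdot>\<^sub>m 1\<^sub>m n = (1\<^sub>m n :: real mat)" by (auto intro!: eq_matI)
  then have "Q * real_mat A = 1 \<cdot>\<^sub>m 1\<^sub>m n" using Q by simp
  \<comment> \<open>The Schur complement of \<open>A\<close> is the Gram matrix of the glue vectors
    projected orthogonally to the lattice: \<open>- 1 / q\<close> times the matrix of
    \<open>A\<^sub>2\<close>, of determinant \<open>3 / q\<^sup>2\<close>.\<close>
  from det_schur_complement[OF A_carrier(2) Q(1) this, of "real_mat R" 2 "transpose_mat (real_mat R)" "real_mat S"]
  have "Determinant.det Q * Determinant.det (real_mat X) =
      Determinant.det (1 \<cdot>\<^sub>m real_mat S - transpose_mat (real_mat R) * (Q * real_mat R))"
    using Rc Sc by (simp add: RX)
  also have "Q * real_mat R = U"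
    using assoc_mult_mat[OF Q(1) A_carrier(2) Uc] Q(2) Uc by (simp add: AU)
  also have "1 \<cdot>\<^sub>m real_mat S - transpose_mat (real_mat R) * U =
      Matrix.mat 2 2 (\<lambda>(i, j). if i = j then - 2 / of_int q else - 1 / of_int q)" (is "?L = ?R")
  proof (rule eq_matI)
    fix i j assume "i < dim_row ?R" "j < dim_col ?R"
    then have ij: "i < 2" "j < 2" by auto
    have "(transpose_mat (real_mat R) * U) $$ (i, j) = bl (if j = 0 then u else w) (if i = 0 then u else w)"
      using ij Rc Uc u(1) w(1)
      by (auto simp: blu blw U_def R_def scalar_prod_def lessThan_atLeast0 intro!: sum.cong)
    then show "?L $$ (i, j) = ?R $$ (i, j)"
      using ij Rc Sc Uc k1 k2 k3 bl_commute[OF u(1) w(1)] by (auto simp: S_def less_2_cases_iff)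
  qed (use Rc Sc Uc in auto)
  also have "Determinant.det ?R = 3 / (of_int q)\<^sup>2"
    by (subst det_mat_2) (auto simp: power2_eq_square)
  finally have "Determinant.det Q * Determinant.det (real_mat X) = 3 / (of_int q)\<^sup>2" .
  moreover have "Determinant.det Q * of_int (Determinant.det A) = 1"
    using det_mult[OF Q(1) A_carrier(2)] Q(2) by (simp add: det_real)
  ultimately have "real_of_int (Determinant.det X) * (of_int q)\<^sup>2 = 3 * of_int (Determinant.det A)"
    using q_pos by (simp add: det_real field_simps) (metis mult.assoc mult.commute mult_1)
  then have detX: "Determinant.det X * q\<^sup>2 = 3 * Determinant.det A"
    by (metis (mono_tags, lifting) of_int_eq_iff of_int_mult of_int_numeral of_int_power)
  have "0 < Determinant.det X * q\<^sup>2" using detX detA by simp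
  then have detX0: "0 < Determinant.det X" by (simp add: zero_less_mult_iff)
  \<comment> \<open>The aim is that \<open>3\<close> annihilates the dual of the glued lattice
    modulo that lattice. This shows that the determinant is odd without knowing the determinant of
    \<open>A\<close>.\<close>
  have "Determinant.det X dvd 3 ^ (n + 2)"
  proof (rule det_dvd_of_integral_multiple_inverse[OF Xc])
    show "Determinant.det X \<noteq> 0" using detX0 by simp
    fix y assume y: "y \<in> carrier_vec (n + 2)" "int_vec (n + 2) (real_mat X *\<^sub>v y)"
    define l where "l = Matrix.vec n (\<lambda>i. y $v i)"
    define c d where "c = y $v n" and "d = y $v (Suc n)"
    have lc: "l \<in> carrier_vec n" by (simp add: l_def)
    \<comment> \<open>The component of \<open>y\<close> in the space of the original lattice; each
      glue vector contributes its part \<open>u\<close> or \<open>w\<close>. The first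
      \<open>n\<close> rows of the integrality hypothesis say that \<open>z\<close> is dual to the
      original lattice.\<close>
    define z where "z = l + (c \<cdot>\<^sub>v u + d \<cdot>\<^sub>v w)"
    have zc: "z \<in> carrier_vec n" using lc u(1) w(1) by (simp add: z_def)
    have rows: "(\<Sum>j<n. real_of_int (X $$ (i, j)) * l $v j) + of_int (X $$ (i, n)) * c + of_int (X $$ (i, Suc n)) * d \<in> \<int>"
      if "i < n + 2" for i
    proof -
      have "(real_mat X *\<^sub>v y) $v i = (\<Sum>j<Suc (Suc n). real_of_int (X $$ (i, j)) * y $v j)"
        using that Xc y by (auto simp: scalar_prod_def lessThan_atLeast0 intro!: sum.cong)
      also have "\<dots> = (\<Sum>j<n. real_of_int (X $$ (i, j)) * l $v j) + of_int (X $$ (i, n)) * c + of_int (X $$ (i, Suc n)) * d"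
        by (simp add: l_def c_def d_def)
      finally have eq: "(real_mat X *\<^sub>v y) $v i = \<dots>" .
      have "(real_mat X *\<^sub>v y) $v i \<in> \<int>" using y(2) that unfolding int_vec_def by blast
      then show ?thesis unfolding eq .
    qed
    have "int_vec n (real_mat A *\<^sub>v z)"
      unfolding int_vec_def
    proof (intro conjI allI impI)
      fix i assume i: "i < n"
      have "(real_mat A *\<^sub>v z) = real_mat A *\<^sub>v l + (c \<cdot>\<^sub>v real_vec a + d \<cdot>\<^sub>v real_vec b)"
        using lc u(1) w(1) A_carrier
        by (simp add: z_def mult_add_distrib_mat_vec[of _ n n] mult_mat_vec[of _ n n] a(2) b(2))
      then have "(real_mat A *\<^sub>v z) $v i = (\<Sum>j<n. real_of_int (X $$ (i, j)) * l $v j) + of_int (X $$ (i, n)) * c + of_int (X $$ (i, Suc n)) * d"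
        using i A_carrier Rc Sc a(1) b(1) lc
        by (simp add: X_def scalar_prod_def lessThan_atLeast0 R_def)
      then show "(real_mat A *\<^sub>v z) $v i \<in> \<int>" using rows[of i] i by simp
    qed (use A_carrier zc in auto)
    then obtain l' c' d' where l': "int_vec n l'" and z: "z = l' + (of_int c' \<cdot>\<^sub>v u + of_int d' \<cdot>\<^sub>v w)"
      using generated[OF zc] by blast
    have l'c: "l' \<in> carrier_vec n" using l' by (simp add: int_vec_def)
    have wu: "bl w u = bl u w" by (rule bl_commute[OF w(1) u(1)])
    define iq where "iq = 1 / real_of_int q"
    have ki: "bl u u = 2 * iq + 2 * of_int k1" "bl w w = 2 * iq + 2 * of_int k2" "bl u w = iq + of_int k3"
      using k1 k2 k3 by (auto simp: iq_def)
    \<comment> \<open>The differences between the coefficients of \<open>z\<close> in terms of the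
      generators and the glue coordinates of \<open>y\<close>. The last two rows show that
      \<open>(2 * \<gamma> + \<delta>) / q\<close> and \<open>(\<gamma> + 2 * \<delta>) / q\<close>
      are integers. Inverting this system of determinant \<open>3\<close> gives integrality of
      \<open>3 * \<gamma> / q\<close> and \<open>3 * \<delta> / q\<close>.\<close>
    define \<gamma> \<delta> where "\<gamma> = of_int c' - c" and "\<delta> = of_int d' - d"
    have "(2 * \<gamma> + \<delta>) / of_int q \<in> \<int>"
    proof -
      have "bl l u + c * bl u u + d * bl w u = bl l' u + of_int c' * bl u u + of_int d' * bl w u"
        using arg_cong[OF z, of "\<lambda>x. bl x u"] lc l'c u(1) w(1) unfolding z_def by (simp add: bl_simps)
      moreover have "bl l u + 2 * of_int k1 * c + of_int k3 * d \<in> \<int>"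
        using rows[of n] A_carrier Rc Sc by (simp add: X_def blu[OF lc]) (simp add: R_def S_def)
      moreover have "bl l' u \<in> \<int>" by (rule bl_u_int[OF l'])
      ultimately have "bl l u + 2 * of_int k1 * c + of_int k3 * d - bl l' u
         - of_int (2 * k1 * c' + k3 * d') = (2 * \<gamma> + \<delta>) * iq"
        and "bl l u + 2 * of_int k1 * c + of_int k3 * d - bl l' u - of_int (2 * k1 * c' + k3 * d') \<in> \<int>"
        unfolding ki wu \<gamma>_def \<delta>_def by (simp add: algebra_simps, intro Ints_diff Ints_of_int)
      then show ?thesis by (simp add: iq_def)
    qed
    moreover have "(\<gamma> + 2 * \<delta>) / of_int q \<in> \<int>"
    proof -
      have "bl l w + c * bl u w + d * bl w w = bl l' w + of_int c' * bl u w + of_int d' * bl w w"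
        using arg_cong[OF z, of "\<lambda>x. bl x w"] lc l'c u(1) w(1) unfolding z_def by (simp add: bl_simps)
      moreover have "bl l w + of_int k3 * c + 2 * of_int k2 * d \<in> \<int>"
        using rows[of "Suc n"] A_carrier Rc Sc by (simp add: X_def blw[OF lc]) (simp add: R_def S_def)
      moreover have "bl l' w \<in> \<int>" by (rule bl_w_int[OF l'])
      ultimately have "bl l w + of_int k3 * c + 2 * of_int k2 * d - bl l' w
         - of_int (k3 * c' + 2 * k2 * d') = (\<gamma> + 2 * \<delta>) * iq"
        and "bl l w + of_int k3 * c + 2 * of_int k2 * d - bl l' w - of_int (k3 * c' + 2 * k2 * d') \<in> \<int>"
        unfolding ki wu \<gamma>_def \<delta>_def by (simp add: algebra_simps, intro Ints_diff Ints_of_int)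
      then show ?thesis by (simp add: iq_def)
    qed
    ultimately have "2 * ((2 * \<gamma> + \<delta>) / of_int q) - (\<gamma> + 2 * \<delta>) / of_int q \<in> \<int>"
      and "2 * ((\<gamma> + 2 * \<delta>) / of_int q) - (2 * \<gamma> + \<delta>) / of_int q \<in> \<int>"
      by (simp_all only: Ints_diff Ints_mult Ints_numeral)
    moreover have "2 * ((2 * \<gamma> + \<delta>) / of_int q) - (\<gamma> + 2 * \<delta>) / of_int q = 3 * \<gamma> / of_int q"
      and "2 * ((\<gamma> + 2 * \<delta>) / of_int q) - (2 * \<gamma> + \<delta>) / of_int q = 3 * \<delta> / of_int q"
      using q_pos by (simp_all add: field_simps)
    ultimately obtain g h where g: "3 * \<gamma> / of_int q = of_int g" and h: "3 * \<delta> / of_int q = of_int h"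
      by (auto elim!: Ints_cases)
    have gq: "3 * \<gamma> = of_int g * of_int q" and hq: "3 * \<delta> = of_int h * of_int q"
      using g h q_pos by (auto simp: field_simps)
    have 3: "3 * c = of_int (3 * c' - g * q)" "3 * d = of_int (3 * d' - h * q)"
      using gq hq by (auto simp: \<gamma>_def \<delta>_def)
    have l3: "int_vec n (of_int 3 \<cdot>\<^sub>v l' + (of_int g \<cdot>\<^sub>v (of_int q \<cdot>\<^sub>v u) + of_int h \<cdot>\<^sub>v (of_int q \<cdot>\<^sub>v w)))"
      by (intro int_vec_add int_vec_smult[OF l'] int_vec_smult[OF u(3)] int_vec_smult[OF w(3)])
    have "3 * l $v i \<in> \<int>" if i: "i < n" for i
    proof -
      have "l $v i + (c * u $v i + d * w $v i) = l' $v i + (of_int c' * u $v i + of_int d' * w $v i)"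
        using arg_cong[OF z, of "\<lambda>x. x $v i"] i lc l'c u(1) w(1) unfolding z_def by simp
      then have "l $v i = l' $v i + (\<gamma> * u $v i + \<delta> * w $v i)" by (simp add: \<gamma>_def \<delta>_def algebra_simps)
      then have "3 * l $v i = 3 * l' $v i + ((3 * \<gamma>) * u $v i + (3 * \<delta>) * w $v i)" by (simp add: algebra_simps)
      also have "\<dots> = (of_int 3 \<cdot>\<^sub>v l' + (of_int g \<cdot>\<^sub>v (of_int q \<cdot>\<^sub>v u) + of_int h \<cdot>\<^sub>v (of_int q \<cdot>\<^sub>v w))) $v i"
        unfolding gq hq using i l'c u(1) w(1) by simp
      finally show ?thesis using l3 i unfolding int_vec_def by metis
    qed
    moreover have "3 * c \<in> \<int>" "3 * d \<in> \<int>" unfolding 3 by auto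
    ultimately show "int_vec (n + 2) (of_int 3 \<cdot>\<^sub>v y)"
      using y(1) by (auto simp: int_vec_def l_def c_def d_def less_Suc_eq)
  qed
  \<comment> \<open>The determinant is now squeezed. It divides three times a power of
    \<open>2\<close> by \<open>detX\<close> and \<open>det_A_dvd\<close>, so being odd it divides
    \<open>3\<close>; and \<open>3\<close> divides it because \<open>q\<^sup>2\<close> is prime to
    \<open>3\<close>.\<close>
  then have oddX: "odd (Determinant.det X)"
    by (metis dvd_trans even_power odd_numeral)
  have "3 * Determinant.det A dvd 3 * q ^ n" using det_A_dvd by simp
  then have "Determinant.det X dvd 3 * 2 ^ (r * n)"
    using detX q2 by (metis dvd_trans dvd_triv_left power_mult)
  moreover have "coprime (Determinant.det X) (2 ^ (r * n))" using oddX by simp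
  ultimately have "Determinant.det X dvd 3" using coprime_dvd_mult_left_iff by blast
  moreover have "3 dvd Determinant.det X"
  proof -
    have "3 dvd Determinant.det X * 2 ^ (2 * r)" using detX q2 by (metis dvd_triv_left power_even_eq power_mult)
    moreover have "coprime (3::int) (2 ^ (2 * r))" by simp
    ultimately show ?thesis using coprime_dvd_mult_left_iff by blast
  qed
  ultimately have "Determinant.det X = 3" using detX0 zdvd_antisym_nonneg by force
  with even_mat_odd_det[OF XE oddX] have "even (n + 2)" and m: "[3 = (-1::int) ^ ((n + 2) div 2)] (mod 4)" by auto
  have "odd ((n + 2) div 2)"
    using m by (cases "even ((n + 2) div 2)") (auto simp: cong_def)
  with \<open>even (n + 2)\<close> show ?thesis by presburger
qed

text \<open>Adjoin \<open>\<alpha> u\<close> and \<open>\<beta> w\<close>. The product condition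
  makes their mixed product integral, the two divisibilities by \<open>q\<close> make their norms
  even, and \<open>H\<close> says that a dual vector pairing integrally with both lies in the
  enlarged lattice. The result is even and self-dual.\<close>

lemma rank_ge_8:
  fixes \<alpha> \<beta> :: int
  assumes "0 < n" and "\<alpha> * \<beta> = q" and "q dvd \<epsilon> * \<alpha>\<^sup>2" "q dvd \<epsilon> * \<beta>\<^sup>2"
    and H: "\<And>c d. \<beta> dvd 2 * \<epsilon> * c + d \<Longrightarrow> \<alpha> dvd c + 2 * \<epsilon> * d \<Longrightarrow> \<alpha> dvd c \<and> \<beta> dvd d"
  shows "8 \<le> n"
proof -
  obtain k1 where k1: "bl u u = 2 * of_int \<epsilon> / of_int q + 2 * of_int k1" using uu_ex by auto
  obtain k2 where k2: "bl w w = 2 * of_int \<epsilon> / of_int q + 2 * of_int k2" using ww_ex by auto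
  obtain k3 where k3: "bl u w = 1 / of_int q + of_int k3" using uw_ex by auto
  have wu: "bl w u = bl u w" by (rule bl_commute[OF w(1) u(1)])
  obtain e1 where e1: "\<epsilon> * \<alpha>\<^sup>2 = q * e1" using assms(3) by (auto elim!: dvdE)
  obtain e2 where e2: "\<epsilon> * \<beta>\<^sup>2 = q * e2" using assms(4) by (auto elim!: dvdE)
  define f where "f l c d = l + (of_int (\<alpha> * c) \<cdot>\<^sub>v u + of_int (\<beta> * d) \<cdot>\<^sub>v w)" for l and c d :: int
  define M where "M = {f l c d | l c d. int_vec n l}"
  have fc: "f l c d \<in> carrier_vec n" if "int_vec n l" for l c d
    using that u(1) w(1) by (simp add: f_def int_vec_def)
  have fM: "f l c d \<in> M" if "int_vec n l" for l c d using that unfolding M_def by blast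
  interpret lattice_vecs n q M
  proof
    show "M \<subseteq> carrier_vec n" using fc by (auto simp: M_def)
    show "0 < q" by (rule q_pos)
  next
    fix x y assume "x \<in> M" "y \<in> M"
    then obtain l c d l' c' d' where *: "x = f l c d" "y = f l' c' d'" "int_vec n l" "int_vec n l'"
      by (auto simp: M_def)
    then have "x + y = f (l + l') (c + c') (d + d')"
      using u(1) w(1) by (auto simp: f_def int_vec_def algebra_simps intro!: eq_vecI)
    then show "x + y \<in> M" using * by (auto intro!: fM int_vec_add)
  next
    fix x and e :: int assume "x \<in> M"
    then obtain l c d where *: "x = f l c d" "int_vec n l" by (auto simp: M_def)
    then have "of_int e \<cdot>\<^sub>v x = f (of_int e \<cdot>\<^sub>v l) (e * c) (e * d)"
      using u(1) w(1) by (auto simp: f_def int_vec_def algebra_simps intro!: eq_vecI)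
    then show "of_int e \<cdot>\<^sub>v x \<in> M" using * by (auto intro!: fM int_vec_smult)
  next
    fix x assume x: "int_vec n x"
    then have "x = f x 0 0" using u(1) w(1) by (auto simp: f_def int_vec_def intro!: eq_vecI)
    then show "x \<in> M" using fM[OF x, of 0 0] by simp
  next
    fix x assume "x \<in> M"
    then obtain l c d where *: "x = f l c d" "int_vec n l" by (auto simp: M_def)
    then have "of_int q \<cdot>\<^sub>v x = of_int q \<cdot>\<^sub>v l + (of_int (\<alpha> * c) \<cdot>\<^sub>v (of_int q \<cdot>\<^sub>v u) + of_int (\<beta> * d) \<cdot>\<^sub>v (of_int q \<cdot>\<^sub>v w))"
      using u(1) w(1) by (auto simp: f_def int_vec_def algebra_simps intro!: eq_vecI)
    moreover have "int_vec n \<dots>"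
      by (intro int_vec_add int_vec_smult[OF *(2)] int_vec_smult[OF u(3)] int_vec_smult[OF w(3)])
    ultimately show "int_vec n (of_int q \<cdot>\<^sub>v x)" by simp
  qed
  have expand: "bl (f l c d) (f l' c' d') = bl l l' + of_int (\<alpha> * c') * bl l u + of_int (\<beta> * d') * bl l w
      + of_int (\<alpha> * c) * bl l' u + of_int (\<beta> * d) * bl l' w
      + of_int (\<alpha>\<^sup>2 * (c * c')) * bl u u + of_int (\<beta>\<^sup>2 * (d * d')) * bl w w + of_int (q * (c * d' + c' * d)) * bl u w"
    if "int_vec n l" "int_vec n l'" for l c d l' c' d'
  proof -
    have lc: "l \<in> carrier_vec n" "l' \<in> carrier_vec n" using that by (auto simp: int_vec_def)
    have "bl u l' = bl l' u" "bl w l' = bl l' w" using bl_commute lc u(1) w(1) by auto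
    then show ?thesis
      using lc u(1) w(1)
      by (simp add: f_def bl_simps wu power2_eq_square algebra_simps flip: assms(2))
  qed
  have a2: "real_of_int (\<alpha>\<^sup>2 * c) * bl u u = of_int (2 * (e1 * c + \<alpha>\<^sup>2 * c * k1))" for c
  proof -
    have "real_of_int \<epsilon> * (of_int \<alpha>)\<^sup>2 = of_int q * of_int e1" using arg_cong[OF e1, of real_of_int] by simp
    then have "of_int \<epsilon> * (of_int \<alpha>)\<^sup>2 / of_int q = real_of_int e1" using q_pos by simp
    then have "2 * of_int c * (of_int \<epsilon> * (of_int \<alpha>)\<^sup>2 / of_int q) = 2 * of_int c * real_of_int e1" by simp
    then show ?thesis by (simp add: k1 algebra_simps)
  qed
  have b2: "real_of_int (\<beta>\<^sup>2 * c) * bl w w = of_int (2 * (e2 * c + \<beta>\<^sup>2 * c * k2))" for c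
  proof -
    have "real_of_int \<epsilon> * (of_int \<beta>)\<^sup>2 = of_int q * of_int e2" using arg_cong[OF e2, of real_of_int] by simp
    then have "of_int \<epsilon> * (of_int \<beta>)\<^sup>2 / of_int q = real_of_int e2" using q_pos by simp
    then have "2 * of_int c * (of_int \<epsilon> * (of_int \<beta>)\<^sup>2 / of_int q) = 2 * of_int c * real_of_int e2" by simp
    then show ?thesis by (simp add: k2 algebra_simps)
  qed
  have ab: "real_of_int (q * c) * bl u w = of_int (c + q * c * k3)" for c
    using q_pos by (simp add: k3 field_simps)
  show ?thesis
  proof (rule even_self_dual_rank[OF A_pos \<open>0 < n\<close>])
    fix x assume "x \<in> M"
    then obtain l c d where x: "x = f l c d" "int_vec n l" by (auto simp: M_def)
    obtain z where z: "z \<in> carrier_vec n" "l = real_vec z" using x(2) by (rule int_vecE)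
    obtain k4 where "bil A z z = 2 * k4" using even_bil[OF A_even z(1)] by (auto elim: evenE)
    then have k4: "bl l l = 2 * of_int k4" using bil_real[OF A_carrier(1) z(1) z(1)] z(2) by simp
    obtain k5 k6 where k56: "bl l u = of_int k5" "bl l w = of_int k6"
      using bl_u_int[OF x(2)] bl_w_int[OF x(2)] by (auto elim!: Ints_cases)
    have "bl x x = 2 * of_int (k4 + \<alpha> * c * k5 + \<beta> * d * k6 + (e1 * (c * c) + \<alpha>\<^sup>2 * (c * c) * k1)
        + (e2 * (d * d) + \<beta>\<^sup>2 * (d * d) * k2) + (c * d + q * (c * d) * k3))"
      unfolding x(1) expand[OF x(2) x(2)] a2 b2 ab k4 k56 by (simp add: algebra_simps)
    then show "\<exists>k. bl x x = 2 * of_int k" by blast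
  next
    fix x y assume "x \<in> M" "y \<in> M"
    then obtain l c d l' c' d' where *: "x = f l c d" "y = f l' c' d'" "int_vec n l" "int_vec n l'"
      by (auto simp: M_def)
    show "bl x y \<in> \<int>"
      unfolding * expand[OF *(3,4)] a2 b2 ab using * bl_int bl_u_int bl_w_int
      by (intro Ints_add Ints_mult) auto
  next
    fix y assume y: "y \<in> carrier_vec n" and D: "\<And>x. x \<in> M \<Longrightarrow> bl x y \<in> \<int>"
    have "int_vec n (real_mat A *\<^sub>v y)"
      unfolding int_vec_def
    proof (intro conjI allI impI)
      fix i assume i: "i < n"
      have "int_vec n (unit_vec n i)" by (auto simp: int_vec_def unit_vec_def)
      then have "bl (unit_vec n i) y \<in> \<int>" by (intro D int_M)
      then show "(real_mat A *\<^sub>v y) $v i \<in> \<int>" using A_carrier y i by (simp add: bil_def)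
    qed (use A_carrier y in auto)
    then obtain l c d where l: "int_vec n l" and yl: "y = l + (of_int c \<cdot>\<^sub>v u + of_int d \<cdot>\<^sub>v w)"
      using generated[OF y] by blast
    have lc: "l \<in> carrier_vec n" using l by (simp add: int_vec_def)
    have 0: "int_vec n (0\<^sub>v n)" by (simp add: int_vec_def)
    have f1: "f (0\<^sub>v n) 1 0 = of_int \<alpha> \<cdot>\<^sub>v u" and f2: "f (0\<^sub>v n) 0 1 = of_int \<beta> \<cdot>\<^sub>v w"
      using u(1) w(1) by (auto simp: f_def intro!: eq_vecI)
    have ul: "bl u l = bl l u" and wl: "bl w l = bl l w" using bl_commute lc u(1) w(1) by auto
    have qr: "real_of_int q = of_int \<alpha> * of_int \<beta>" using assms(2) by (metis of_int_mult)
    have nz: "real_of_int \<alpha> \<noteq> 0" "real_of_int \<beta> \<noteq> 0" using q_pos qr by auto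
    \<comment> \<open>Pairing \<open>y\<close> with \<open>\<alpha> u\<close>, and below with
      \<open>\<beta> w\<close>, leaves denominators \<open>\<beta>\<close> and
      \<open>\<alpha>\<close> because \<open>q = \<alpha> * \<beta>\<close>. These are exactly the
      divisibilities that \<open>H\<close> takes.\<close>
    have "of_int \<alpha> * (bl l u + of_int c * bl u u + of_int d * bl u w) \<in> \<int>"
      using D[OF fM[OF 0, of 1 0]] lc u(1) w(1) unfolding f1 yl by (simp add: bl_simps ul algebra_simps)
    moreover have "of_int \<alpha> * bl l u \<in> \<int>" using bl_u_int[OF l] by auto
    ultimately have "of_int \<alpha> * (bl l u + of_int c * bl u u + of_int d * bl u w) - of_int \<alpha> * bl l u
        - of_int (\<alpha> * (2 * c * k1 + d * k3)) \<in> \<int>" by (intro Ints_diff Ints_of_int)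
    also have "of_int \<alpha> * (bl l u + of_int c * bl u u + of_int d * bl u w) - of_int \<alpha> * bl l u
        - of_int (\<alpha> * (2 * c * k1 + d * k3)) = of_int (2 * \<epsilon> * c + d) / of_int \<beta>"
      using nz by (simp add: k1 k3 qr field_simps)
    finally have 1: "\<beta> dvd 2 * \<epsilon> * c + d" using nz(2) by (simp only: of_int_div_of_int_in_Ints_iff) simp
    have "of_int \<beta> * (bl l w + of_int c * bl u w + of_int d * bl w w) \<in> \<int>"
      using D[OF fM[OF 0, of 0 1]] lc u(1) w(1) unfolding f2 yl by (simp add: bl_simps wl wu algebra_simps)
    moreover have "of_int \<beta> * bl l w \<in> \<int>" using bl_w_int[OF l] by auto
    ultimately have "of_int \<beta> * (bl l w + of_int c * bl u w + of_int d * bl w w) - of_int \<beta> * bl l w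
        - of_int (\<beta> * (c * k3 + 2 * d * k2)) \<in> \<int>" by (intro Ints_diff Ints_of_int)
    also have "of_int \<beta> * (bl l w + of_int c * bl u w + of_int d * bl w w) - of_int \<beta> * bl l w
        - of_int (\<beta> * (c * k3 + 2 * d * k2)) = of_int (c + 2 * \<epsilon> * d) / of_int \<alpha>"
      using nz by (simp add: k2 k3 qr field_simps)
    finally have "\<alpha> dvd c + 2 * \<epsilon> * d" using nz(1) by (simp only: of_int_div_of_int_in_Ints_iff) simp
    from H[OF 1 this] obtain c' d' where "c = \<alpha> * c'" "d = \<beta> * d'" by (auto elim!: dvdE)
    then have "y = f l c' d'" by (simp add: yl f_def)
    then show "y \<in> M" using fM[OF l] by simp
  qed
qed

end

section \<open>Generators of the discriminant module\<close>

lemma coset_Z_eq_iff: "coset_Z a = coset_Z b \<longleftrightarrow> a - b \<in> \<int>"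
proof
  assume "coset_Z a = coset_Z b"
  moreover have "a \<in> coset_Z a" by (auto simp: coset_Z_def intro: exI[of _ 0])
  ultimately have "a \<in> coset_Z b" by simp
  then show "a - b \<in> \<int>" by (auto simp: coset_Z_def)
next
  assume "a - b \<in> \<int>"
  then obtain k where "a = b + of_int k" by (auto elim!: Ints_cases simp: algebra_simps)
  then show "coset_Z a = coset_Z b"
    by (auto simp: coset_Z_def) (metis add.assoc of_int_add, metis add.assoc diff_add_cancel of_int_add add.commute)
qed

section \<open>Integral bases and the rank\<close>

lemma int_basis_comb:
  assumes "int_basis bs L" "\<forall>i<length bs. \<exists>k::int. c i = of_int k"
  shows "(\<Sum>i<length bs. c i *\<^sub>R bs ! i) \<in> L"
proof -
  obtain k :: "nat \<Rightarrow> int" where "\<forall>i<length bs. c i = of_int (k i)" using assms(2) by metis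
  then have "(\<Sum>i<length bs. c i *\<^sub>R bs ! i) = (\<Sum>i<length bs. of_int (k i) *\<^sub>R bs ! i)"
    by (intro sum.cong) auto
  then show ?thesis using assms(1) unfolding int_basis_def by blast
qed

lemma int_basis_span:
  assumes "int_basis bs L"
  shows "span L = span (set bs)"
proof (rule span_eq[THEN iffD2], intro conjI subsetI)
  fix x assume "x \<in> L"
  then obtain c :: "nat \<Rightarrow> int" where "x = (\<Sum>i<length bs. of_int (c i) *\<^sub>R bs ! i)"
    using assms unfolding int_basis_def by blast
  then show "x \<in> span (set bs)" by (simp only:) (intro span_sum span_scale span_base nth_mem, simp)
next
  fix x assume "x \<in> set bs"
  then obtain j where j: "j < length bs" "x = bs ! j" by (auto simp: in_set_conv_nth)
  have "(\<Sum>i<length bs. (if i = j then 1 else 0) *\<^sub>R bs ! i) = (\<Sum>i<length bs. if i = j then bs ! i else 0)"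
    by (intro sum.cong) auto
  then have "(\<Sum>i<length bs. (if i = j then 1 else 0) *\<^sub>R bs ! i) = x" using j by simp
  moreover have "(\<Sum>i<length bs. (if i = j then 1 else 0) *\<^sub>R bs ! i) \<in> L"
    by (rule int_basis_comb[OF assms]) (metis of_int_0 of_int_1)
  ultimately show "x \<in> span L" by (simp add: span_base)
qed

text \<open>An integral basis is also a real basis of the span, so all of them have
  \<open>dim L\<close> elements and the definite description denotes.\<close>

lemma lattice_rank_eq:
  fixes L :: "'v::real_vector set"
  assumes "int_basis bs L"
  shows "lattice_rank L = length bs"
proof -
  have "length cs = dim L" if "int_basis cs L" for cs
    using that int_basis_span[OF that] dim_eq_card[of "set cs" L] distinct_card[of cs]
    unfolding int_basis_def by simp
  then show ?thesis unfolding lattice_rank_def using assms by (intro the_equality) auto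
qed

section \<open>The discriminant group and its quadratic map\<close>

locale even_lattice_loc =
  fixes L :: "'v::real_vector set" and B :: "'v \<Rightarrow> 'v \<Rightarrow> real"
  assumes even: "even_lattice L B"
begin

abbreviation "D \<equiv> dual_lattice L B"
abbreviation "G \<equiv> additive_group D"

lemma bilinear: "bilinear_lattice L B" using even by (simp add: even_lattice_def)

lemma B_commute: "x \<in> span L \<Longrightarrow> y \<in> span L \<Longrightarrow> B x y = B y x"
  and B_add_left: "x \<in> span L \<Longrightarrow> y \<in> span L \<Longrightarrow> z \<in> span L \<Longrightarrow> B (x + y) z = B x z + B y z"
  and B_scale_left: "x \<in> span L \<Longrightarrow> y \<in> span L \<Longrightarrow> B (a *\<^sub>R x) y = a * B x y"
  using bilinear unfolding bilinear_lattice_def by blast+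

lemma B_add_right: "x \<in> span L \<Longrightarrow> y \<in> span L \<Longrightarrow> z \<in> span L \<Longrightarrow> B z (x + y) = B z x + B z y"
  using B_add_left[of x y z] B_commute[of z] by (simp add: span_add)

lemma B_scale_right: "x \<in> span L \<Longrightarrow> y \<in> span L \<Longrightarrow> B y (a *\<^sub>R x) = a * B y x"
  using B_scale_left[of x y a] B_commute[of y] by (simp add: span_scale)

lemma B_zero_left: "y \<in> span L \<Longrightarrow> B 0 y = 0"
  using B_scale_left[of 0 y 0] by (simp add: span_zero)

lemmas B_simps = B_add_left B_add_right B_scale_left B_scale_right span_add span_scale

lemma B_sum_left:
  assumes "finite I" "\<And>i. i \<in> I \<Longrightarrow> x i \<in> span L" "y \<in> span L"
  shows "B (\<Sum>i\<in>I. c i *\<^sub>R x i) y = (\<Sum>i\<in>I. c i * B (x i) y)"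
  using assms
proof (induction I rule: finite_induct)
  case (insert i I)
  then show ?case by (simp add: B_simps span_sum)
qed (simp add: B_zero_left)

lemma basis: obtains bs where "int_basis bs L" "Determinant.det (gram_matrix B bs) \<noteq> 0"
  using bilinear unfolding bilinear_lattice_def by blast

lemma L_zero: "0 \<in> L"
proof -
  obtain bs where "int_basis bs L" by (rule basis)
  from int_basis_comb[OF this, of "\<lambda>_. 0"] show ?thesis by (auto intro: exI[of _ 0])
qed

lemma L_comb:
  assumes "x \<in> L" "y \<in> L"
  shows "of_int a *\<^sub>R x + of_int b *\<^sub>R y \<in> L"
proof -
  obtain bs where bs: "int_basis bs L" by (rule basis)
  obtain c :: "nat \<Rightarrow> int" where c: "x = (\<Sum>i<length bs. of_int (c i) *\<^sub>R bs ! i)"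
    using assms(1) bs unfolding int_basis_def by blast
  obtain d :: "nat \<Rightarrow> int" where d: "y = (\<Sum>i<length bs. of_int (d i) *\<^sub>R bs ! i)"
    using assms(2) bs unfolding int_basis_def by blast
  have "of_int a *\<^sub>R x + of_int b *\<^sub>R y = (\<Sum>i<length bs. of_int (a * c i + b * d i) *\<^sub>R bs ! i)"
    by (simp add: c d scaleR_sum_right sum.distrib algebra_simps)
  also have "\<dots> \<in> L" by (rule int_basis_comb[OF bs]) blast
  finally show ?thesis .
qed

lemma L_add: "x \<in> L \<Longrightarrow> y \<in> L \<Longrightarrow> x + y \<in> L" using L_comb[of x y 1 1] by simp
lemma L_scale: "x \<in> L \<Longrightarrow> of_int a *\<^sub>R x \<in> L" using L_comb[of x x a 0] by simp
lemma L_uminus: "x \<in> L \<Longrightarrow> - x \<in> L" using L_scale[of x "-1"] by simp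
lemma L_diff: "x \<in> L \<Longrightarrow> y \<in> L \<Longrightarrow> x - y \<in> L" using L_add[of x "- y"] L_uminus by simp

lemma L_span: "x \<in> L \<Longrightarrow> x \<in> span L" by (rule span_base)
lemma D_span: "x \<in> D \<Longrightarrow> x \<in> span L" by (simp add: dual_lattice_def)
lemma D_int: "x \<in> D \<Longrightarrow> l \<in> L \<Longrightarrow> B x l \<in> \<int>" by (simp add: dual_lattice_def)

lemma L_D: "x \<in> L \<Longrightarrow> x \<in> D"
  using even by (auto simp: dual_lattice_def even_lattice_def span_base)

lemma D_add: "x \<in> D \<Longrightarrow> y \<in> D \<Longrightarrow> x + y \<in> D"
  by (auto simp: dual_lattice_def B_simps L_span)

lemma D_scale: "x \<in> D \<Longrightarrow> of_int a *\<^sub>R x \<in> D"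
  by (auto simp: dual_lattice_def B_simps L_span)

lemma D_uminus: "x \<in> D \<Longrightarrow> - x \<in> D" using D_scale[of x "-1"] by simp

lemma G_comm_group: "comm_group G"
proof (rule comm_groupI)
  fix x assume "x \<in> carrier G"
  then show "\<exists>y\<in>carrier G. y \<otimes>\<^bsub>G\<^esub> x = \<one>\<^bsub>G\<^esub>"
    by (intro bexI[of _ "- x"]) (auto simp: additive_group_def D_uminus)
qed (auto simp: additive_group_def D_add L_D[OF L_zero] add.assoc add.commute)

lemma L_normal: "L \<lhd> G"
proof (rule comm_group.subgroup_imp_normal[OF G_comm_group])
  interpret comm_group G by (rule G_comm_group)
  show "subgroup L G"
  proof (rule subgroupI)
    fix x assume x: "x \<in> L"
    have "inv\<^bsub>G\<^esub> x = - x"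
      by (rule inv_equality) (use x in \<open>auto simp: additive_group_def L_D D_uminus\<close>)
    then show "inv\<^bsub>G\<^esub> x \<in> L" using x by (simp add: L_uminus)
  qed (use L_D L_zero L_add in \<open>auto simp: additive_group_def\<close>)
qed

definition cs :: "'v \<Rightarrow> 'v set" where "cs v = L #>\<^bsub>G\<^esub> v"

lemma mem_cs: "x \<in> cs v \<longleftrightarrow> x - v \<in> L"
proof -
  have "cs v = {l + v | l. l \<in> L}" by (auto simp: cs_def r_coset_def additive_group_def)
  then show ?thesis by (auto intro: exI[of _ "x - v"])
qed

lemma cs_eq_iff: "cs v = cs v' \<longleftrightarrow> v - v' \<in> L"
proof
  assume "cs v = cs v'"
  then show "v - v' \<in> L" using mem_cs[of v v'] mem_cs[of v v] L_zero by simp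
next
  assume v: "v - v' \<in> L"
  have "x - v \<in> L \<longleftrightarrow> x - v' \<in> L" for x
    using L_add[OF _ v, of "x - v"] L_diff[OF _ v, of "x - v'"] by (auto simp: algebra_simps)
  then show "cs v = cs v'" by (auto simp: mem_cs)
qed

lemma carrier_disc: "carrier (fst (discriminant_module L B)) = cs ` D"
  by (auto simp: discriminant_module_def FactGroup_def RCOSETS_def cs_def additive_group_def)

lemma mult_disc: "v \<in> D \<Longrightarrow> v' \<in> D \<Longrightarrow> cs v \<otimes>\<^bsub>fst (discriminant_module L B)\<^esub> cs v' = cs (v + v')"
  using normal.rcos_sum[OF L_normal, of v v']
  by (simp add: discriminant_module_def cs_def) (simp add: additive_group_def)

lemma group_disc: "group (fst (discriminant_module L B))"
  using normal.factorgroup_is_group[OF L_normal] by (simp add: discriminant_module_def)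

lemma B_self_add:
  assumes "v \<in> D" "l \<in> L"
  shows "B (v + l) (v + l) / 2 - B v v / 2 \<in> \<int>"
proof -
  have s: "v \<in> span L" "l \<in> span L" using assms D_span L_span by auto
  obtain k :: int where k: "B l l = 2 * of_int k" using even assms(2) unfolding even_lattice_def by blast
  have "B (v + l) (v + l) / 2 - B v v / 2 = B v l + of_int k"
    using s B_commute[OF s] by (simp add: B_simps k field_simps)
  then show ?thesis using D_int[OF assms] by simp
qed

lemma quad_disc:
  assumes "v \<in> D"
  shows "snd (discriminant_module L B) (cs v) = coset_Z (B v v / 2)"
proof -
  have "coset_Z (B x x / 2) = coset_Z (B v v / 2)" if "x \<in> cs v" for x
    using B_self_add[OF assms, of "x - v"] that by (simp add: coset_Z_eq_iff mem_cs)
  then have "(\<Union>x\<in>cs v. coset_Z (B x x / 2)) = (\<Union>x\<in>cs v. coset_Z (B v v / 2))" by simp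
  moreover have "v \<in> cs v" by (simp add: mem_cs L_zero)
  ultimately show ?thesis unfolding discriminant_module_def snd_conv by blast
qed

definition comb :: "'v \<Rightarrow> 'v \<Rightarrow> int \<Rightarrow> int \<Rightarrow> 'v" where
  "comb u w c d = of_int c *\<^sub>R u + of_int d *\<^sub>R w"

lemma comb_D: "u \<in> D \<Longrightarrow> w \<in> D \<Longrightarrow> comb u w c d \<in> D"
  by (simp add: comb_def D_add D_scale)

lemma comb_diff: "comb u w c d - comb u w c' d' = comb u w (c - c') (d - d')"
  by (simp add: comb_def algebra_simps)

lemma B_comb:
  assumes "u \<in> D" "w \<in> D"
  shows "B (comb u w c d) (comb u w c' d') = of_int (c * c') * B u u + of_int (c * d' + d * c') * B u w + of_int (d * d') * B w w"
proof -
  have s: "u \<in> span L" "w \<in> span L" using assms D_span by auto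
  show ?thesis using B_commute[OF s] s by (simp add: comb_def B_simps algebra_simps)
qed

end

text \<open>Since the quadratic map is half the norm modulo \<open>1\<close>, norms are recorded
  modulo \<open>2\<close>. Independence of the generators is left to follow from the products, whose
  matrix times \<open>q\<close> has determinant \<open>4 * \<epsilon>\<^sup>2 - 1\<close> modulo
  \<open>q\<close>.\<close>

definition discriminant_gens ::
    "'v::real_vector set \<Rightarrow> ('v \<Rightarrow> 'v \<Rightarrow> real) \<Rightarrow> nat \<Rightarrow> int \<Rightarrow> 'v \<Rightarrow> 'v \<Rightarrow> bool" where
  "discriminant_gens L B q \<epsilon> u w \<longleftrightarrow>
     u \<in> dual_lattice L B \<and> w \<in> dual_lattice L B \<and> of_nat q *\<^sub>R u \<in> L \<and> of_nat q *\<^sub>R w \<in> L \<and>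
     (\<forall>v\<in>dual_lattice L B. \<exists>l\<in>L. \<exists>c d :: int. v = l + (of_int c *\<^sub>R u + of_int d *\<^sub>R w)) \<and>
     (\<exists>k::int. B u u = 2 * of_int \<epsilon> / of_nat q + 2 * of_int k) \<and>
     (\<exists>k::int. B w w = 2 * of_int \<epsilon> / of_nat q + 2 * of_int k) \<and>
     (\<exists>k::int. B u w = 1 / of_nat q + of_int k)"

text \<open>One family containing both modules, so that generators and rank bounds are treated once
  for \<open>\<epsilon> = 1\<close> and \<open>\<epsilon> = 0\<close>.\<close>

definition module_eps :: "int \<Rightarrow> nat \<Rightarrow> (int \<times> int) quadratic_module" where
  "module_eps \<epsilon> q =
     (integer_mod_group q \<times>\<times> integer_mod_group q,
      \<lambda>(x, y). coset_Z (of_int (\<epsilon> * x\<^sup>2 + x * y + \<epsilon> * y\<^sup>2) / of_nat q))"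

lemma module_B_eps: "module_B = module_eps 1" and module_C_eps: "module_C = module_eps 0"
  by (auto simp: fun_eq_iff module_B_def module_C_def module_eps_def)

context even_lattice_loc
begin

text \<open>Sending a pair of coefficients to the coset of \<open>comb u w\<close> is well defined
  and onto by the generation hypotheses. It is injective because the pairing matrix is invertible
  modulo \<open>q\<close>.\<close>

lemma isometric_if_discriminant_gens:
  assumes g: "discriminant_gens L B q \<epsilon> u w" and q: "0 < q" and cop: "coprime (4 * \<epsilon>\<^sup>2 - 1) (int q)"
  shows "isometrically_isomorphic (discriminant_module L B) (module_eps \<epsilon> q)"
proof -
  have uw: "u \<in> D" "w \<in> D" and quw: "of_nat q *\<^sub>R u \<in> L" "of_nat q *\<^sub>R w \<in> L"
    and gen: "\<And>v. v \<in> D \<Longrightarrow> \<exists>l\<in>L. \<exists>c d. v = l + comb u w c d"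
    using g unfolding discriminant_gens_def comb_def by blast+
  obtain k1 k2 k3 :: int where k: "B u u = 2 * of_int \<epsilon> / of_nat q + 2 * of_int k1"
    "B w w = 2 * of_int \<epsilon> / of_nat q + 2 * of_int k2" "B u w = 1 / of_nat q + of_int k3"
    using g unfolding discriminant_gens_def by blast
  let ?N = "integer_mod_group q \<times>\<times> integer_mod_group q"
  let ?M = "fst (discriminant_module L B)"
  have N: "group ?N" by (intro DirProd_group group_integer_mod_group)
  have Nc: "carrier ?N = {0..<int q} \<times> {0..<int q}" using q by (simp add: carrier_integer_mod_group)
  define h where "h = (\<lambda>(c, d). cs (comb u w c d))"
  have multq: "comb u w (int q * a) (int q * b) \<in> L" for a b
    using L_add[OF L_scale[OF quw(1), of a] L_scale[OF quw(2), of b]] by (simp add: comb_def mult.commute)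
  have shift: "cs (comb u w c d) = cs (comb u w (c mod int q) (d mod int q))" for c d
  proof -
    have "comb u w c d - comb u w (c mod int q) (d mod int q) =
        comb u w (int q * (c div int q)) (int q * (d div int q))"
      by (simp add: comb_diff minus_mod_eq_mult_div)
    then show ?thesis unfolding cs_eq_iff using multq by simp
  qed
  have dvd: "int q dvd c \<and> int q dvd d" if "comb u w c d \<in> L" for c d
  proof -
    have "B u (comb u w c d) \<in> \<int>" "B w (comb u w c d) \<in> \<int>" using D_int[OF uw(1) that] D_int[OF uw(2) that] by auto
    moreover have "u = comb u w 1 0" "w = comb u w 0 1" by (auto simp: comb_def)
    ultimately have "B (comb u w 1 0) (comb u w c d) \<in> \<int>" "B (comb u w 0 1) (comb u w c d) \<in> \<int>" by auto
    then have "of_int c * B u u + of_int d * B u w \<in> \<int>" "of_int c * B u w + of_int d * B w w \<in> \<int>"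
      by (simp_all add: B_comb[OF uw])
    then have "of_int c * B u u + of_int d * B u w - of_int (2 * c * k1 + d * k3) \<in> \<int>"
      "of_int c * B u w + of_int d * B w w - of_int (c * k3 + 2 * d * k2) \<in> \<int>"
      by (simp_all only: Ints_diff Ints_of_int)
    moreover have "of_int c * B u u + of_int d * B u w - of_int (2 * c * k1 + d * k3) = of_int (2 * \<epsilon> * c + d) / of_int (int q)"
      "of_int c * B u w + of_int d * B w w - of_int (c * k3 + 2 * d * k2) = of_int (c + 2 * \<epsilon> * d) / of_int (int q)"
      using q by (simp_all add: k field_simps)
    ultimately have *: "int q dvd 2 * \<epsilon> * c + d" "int q dvd c + 2 * \<epsilon> * d"
      using q by (simp_all only: of_int_div_of_int_in_Ints_iff) auto
    \<comment> \<open>Elimination in the symmetric system with rows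
      \<open>(2 * \<epsilon>, 1)\<close> and \<open>(1, 2 * \<epsilon>)\<close>: each unknown is
      left with the coefficient \<open>4 * \<epsilon>\<^sup>2 - 1\<close>, a unit modulo
      \<open>q\<close>.\<close>
    have "int q dvd 2 * \<epsilon> * (2 * \<epsilon> * c + d) - (c + 2 * \<epsilon> * d)"
      "int q dvd 2 * \<epsilon> * (c + 2 * \<epsilon> * d) - (2 * \<epsilon> * c + d)"
      using * by (simp_all only: dvd_diff dvd_mult)
    then have "int q dvd (4 * \<epsilon>\<^sup>2 - 1) * c" "int q dvd (4 * \<epsilon>\<^sup>2 - 1) * d"
      by (simp_all add: power2_eq_square algebra_simps)
    then show ?thesis using cop by (metis coprime_commute coprime_dvd_mult_right_iff)
  qed
  have "h \<in> iso ?N ?M"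
    unfolding iso_def
  proof (intro CollectI conjI homI)
    fix x assume "x \<in> carrier ?N"
    then show "h x \<in> carrier ?M" using comb_D[OF uw] by (auto simp: h_def carrier_disc)
  next
    fix x y assume "x \<in> carrier ?N" "y \<in> carrier ?N"
    obtain c d c' d' where xy: "x = (c, d)" "y = (c', d')" by fastforce
    have "comb u w c d + comb u w c' d' = comb u w (c + c') (d + d')" by (simp add: comb_def algebra_simps)
    then show "h (x \<otimes>\<^bsub>?N\<^esub> y) = h x \<otimes>\<^bsub>?M\<^esub> h y"
      using mult_disc[OF comb_D[OF uw] comb_D[OF uw]] shift[of "c + c'" "d + d'"] by (simp add: xy h_def)
  next
    have "inj_on h (carrier ?N)"
    proof (rule inj_onI)
      fix x y assume *: "x \<in> carrier ?N" "y \<in> carrier ?N" "h x = h y"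
      obtain c d c' d' where xy: "x = (c, d)" "y = (c', d')" by fastforce
      have "comb u w (c - c') (d - d') \<in> L"
        using *(3) by (simp add: xy h_def cs_eq_iff comb_diff)
      then have "int q dvd c - c'" "int q dvd d - d'" using dvd by blast+
      then have "c mod int q = c' mod int q" "d mod int q = d' mod int q" by (simp_all add: mod_eq_dvd_iff)
      then show "x = y" using *(1,2) unfolding Nc by (auto simp: xy)
    qed
    moreover have "h ` carrier ?N = carrier ?M"
    proof (intro equalityI subsetI)
      fix X assume "X \<in> h ` carrier ?N"
      then show "X \<in> carrier ?M" using comb_D[OF uw] by (auto simp: h_def carrier_disc)
    next
      fix X assume "X \<in> carrier ?M"
      then obtain v where v: "X = cs v" "v \<in> D" by (auto simp: carrier_disc)
      then obtain l c d where "l \<in> L" "v = l + comb u w c d" using gen by blast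
      then have "cs v = cs (comb u w c d)" by (simp add: cs_eq_iff)
      then have "X = h (c mod int q, d mod int q)" using v shift[of c d] by (simp add: h_def)
      moreover have "(c mod int q, d mod int q) \<in> carrier ?N" using q unfolding Nc by simp
      ultimately show "X \<in> h ` carrier ?N" by blast
    qed
    ultimately show "bij_betw h (carrier ?N) (carrier ?M)" by (simp add: bij_betw_def)
  qed
  \<comment> \<open>The required isometry starts at the discriminant module, so the parametrisation
    \<open>h\<close> has to be inverted.\<close>
  then have inv: "inv_into (carrier ?N) h \<in> iso ?M ?N" and img: "h ` carrier ?N = carrier ?M"
    using group.iso_set_sym[OF N] by (auto simp: iso_def bij_betw_def)
  have "snd (module_eps \<epsilon> q) (inv_into (carrier ?N) h X) = snd (discriminant_module L B) X"
    if "X \<in> carrier ?M" for X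
  proof -
    have hX: "h (inv_into (carrier ?N) h X) = X" using that img by (metis f_inv_into_f)
    obtain c d where cd: "inv_into (carrier ?N) h X = (c, d)" by fastforce
    have X: "X = cs (comb u w c d)" using hX cd by (simp add: h_def)
    have "of_int (\<epsilon> * c\<^sup>2 + c * d + \<epsilon> * d\<^sup>2) / of_nat q - B (comb u w c d) (comb u w c d) / 2
      = of_int (- (c\<^sup>2 * k1 + c * d * k3 + d\<^sup>2 * k2))"
      using q by (simp add: B_comb[OF uw] k power2_eq_square field_simps)
    then have "of_int (\<epsilon> * c\<^sup>2 + c * d + \<epsilon> * d\<^sup>2) / of_nat q - B (comb u w c d) (comb u w c d) / 2 \<in> \<int>"
      by (simp only: Ints_of_int)
    then have "snd (module_eps \<epsilon> q) (c, d) = snd (discriminant_module L B) (cs (comb u w c d))"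
      unfolding quad_disc[OF comb_D[OF uw]] by (simp add: module_eps_def coset_Z_eq_iff)
    then show ?thesis unfolding cd X[symmetric] .
  qed
  then show ?thesis
    unfolding isometrically_isomorphic_def using inv by (intro bexI[of _ "inv_into (carrier ?N) h"]) (auto simp: module_eps_def)
qed

text \<open>Lift the preimages of \<open>(1, 0)\<close> and \<open>(0, 1)\<close>;
  \<open>1 < q\<close> ensures that these pairs are reduced residues. The quadratic map gives the
  norms and, by polarisation, the mixed product.\<close>

lemma discriminant_gens_if_isometric:
  assumes iso: "isometrically_isomorphic (discriminant_module L B) (module_eps \<epsilon> q)" and q: "1 < q"
  obtains u w where "discriminant_gens L B q \<epsilon> u w"
proof -
  let ?N = "integer_mod_group q \<times>\<times> integer_mod_group q"
  let ?M = "fst (discriminant_module L B)"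
  obtain f where f: "f \<in> iso ?M ?N"
    and fQ: "\<And>X. X \<in> carrier ?M \<Longrightarrow> snd (module_eps \<epsilon> q) (f X) = snd (discriminant_module L B) X"
    using iso unfolding isometrically_isomorphic_def by (auto simp: module_eps_def)
  have Nc: "carrier ?N = {0..<int q} \<times> {0..<int q}" using q by (simp add: carrier_integer_mod_group)
  have inj: "inj_on f (carrier ?M)" and img: "f ` carrier ?M = carrier ?N"
    using f by (auto simp: iso_def bij_betw_def)
  have fadd: "f (cs (v + v')) = ((fst (f (cs v)) + fst (f (cs v'))) mod int q, (snd (f (cs v)) + snd (f (cs v'))) mod int q)"
    if "v \<in> D" "v' \<in> D" for v v'
  proof -
    have "f (cs v \<otimes>\<^bsub>?M\<^esub> cs v') = f (cs v) \<otimes>\<^bsub>?N\<^esub> f (cs v')"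
      using f that by (auto simp: iso_def carrier_disc intro!: hom_mult)
    then show ?thesis using mult_disc[OF that] by (simp add: mult_DirProd')
  qed
  have "(1, 0) \<in> f ` carrier ?M" "(0, 1) \<in> f ` carrier ?M" unfolding img Nc using q by auto
  then obtain u w where uw: "u \<in> D" "w \<in> D" and fu: "f (cs u) = (1, 0)" and fw: "f (cs w) = (0, 1)"
    unfolding carrier_disc by force
  have f0: "f (cs 0) = (0, 0)"
  proof -
    have "cs 0 = \<one>\<^bsub>?M\<^esub>" by (auto simp: discriminant_module_def mem_cs)
    moreover have "f \<one>\<^bsub>?M\<^esub> = \<one>\<^bsub>?N\<^esub>"
      using f by (intro hom_one group_disc DirProd_group group_integer_mod_group) (auto simp: iso_def)
    ultimately show ?thesis by simp
  qed
  \<comment> \<open>Induction covers natural multiples only; this suffices because residues in the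
    carrier are nonnegative.\<close>
  have fcu: "f (cs (of_int (int c) *\<^sub>R u)) = (int c mod int q, 0)" for c
  proof (induction c)
    case (Suc c)
    have "of_int (int (Suc c)) *\<^sub>R u = of_int (int c) *\<^sub>R u + u" by (simp add: algebra_simps)
    then show ?case using fadd[OF D_scale[OF uw(1)] uw(1), of "int c"] Suc by (simp add: fu mod_add_left_eq mod_add_right_eq add.commute)
  qed (simp add: f0)
  have fdw: "f (cs (of_int (int c) *\<^sub>R w)) = (0, int c mod int q)" for c
  proof (induction c)
    case (Suc c)
    have "of_int (int (Suc c)) *\<^sub>R w = of_int (int c) *\<^sub>R w + w" by (simp add: algebra_simps)
    then show ?case using fadd[OF D_scale[OF uw(2)] uw(2), of "int c"] Suc by (simp add: fw mod_add_left_eq mod_add_right_eq add.commute)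
  qed (simp add: f0)
  have mem: "x - y \<in> L" if "x \<in> D" "y \<in> D" "f (cs x) = f (cs y)" for x y
    using inj_onD[OF inj that(3)] that carrier_disc by (auto simp: cs_eq_iff)
  have quw: "of_nat q *\<^sub>R u \<in> L" "of_nat q *\<^sub>R w \<in> L"
    using mem[OF D_scale[OF uw(1), of "int q"] L_D[OF L_zero]] mem[OF D_scale[OF uw(2), of "int q"] L_D[OF L_zero]]
      fcu[of q] fdw[of q] f0 by auto
  have gen: "\<exists>l\<in>L. \<exists>c d :: int. v = l + (of_int c *\<^sub>R u + of_int d *\<^sub>R w)" if v: "v \<in> D" for v
  proof -
    obtain a b where ab: "f (cs v) = (a, b)" by fastforce
    then have "(a, b) \<in> carrier ?N" using img v carrier_disc by (metis imageI)
    then have ab': "0 \<le> a" "a < int q" "0 \<le> b" "b < int q" unfolding Nc by auto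
    let ?x = "of_int (int (nat a)) *\<^sub>R u + of_int (int (nat b)) *\<^sub>R w"
    have "f (cs ?x) = (a, b)"
      using fadd[OF D_scale[OF uw(1)] D_scale[OF uw(2)], of "int (nat a)" "int (nat b)"] fcu[of "nat a"] fdw[of "nat b"] ab'
      by simp
    then have "v - ?x \<in> L" using mem[OF v] D_add[OF D_scale[OF uw(1)] D_scale[OF uw(2)]] ab by simp
    moreover have "v = (v - ?x) + (of_int a *\<^sub>R u + of_int b *\<^sub>R w)" using ab' by simp
    ultimately show ?thesis by blast
  qed
  have Q: "B v v / 2 - of_int (\<epsilon> * a\<^sup>2 + a * b + \<epsilon> * b\<^sup>2) / of_nat q \<in> \<int>"
    if "v \<in> D" "f (cs v) = (a, b)" for v a b
    using fQ[of "cs v"] that carrier_disc by (simp add: quad_disc module_eps_def flip: coset_Z_eq_iff)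
  have Quu: "B u u / 2 - of_int \<epsilon> / of_nat q \<in> \<int>" using Q[OF uw(1) fu] by simp
  have Qww: "B w w / 2 - of_int \<epsilon> / of_nat q \<in> \<int>" using Q[OF uw(2) fw] by simp
  have fuw: "f (cs (u + w)) = (1, 1)" using fadd[OF uw] q by (simp add: fu fw)
  have s: "u \<in> span L" "w \<in> span L" using uw D_span by auto
  \<comment> \<open>Polarisation: the value at \<open>u + w\<close> minus the values at
    \<open>u\<close> and \<open>w\<close> is the mixed product.\<close>
  have "B (u + w) (u + w) / 2 - of_int (\<epsilon> + 1 + \<epsilon>) / of_nat q - (B u u / 2 - of_int \<epsilon> / of_nat q)
      - (B w w / 2 - of_int \<epsilon> / of_nat q) \<in> \<int>"
    using Q[OF D_add[OF uw] fuw] by (intro Ints_diff[OF Ints_diff[OF _ Quu] Qww]) simp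
  also have "B (u + w) (u + w) / 2 - of_int (\<epsilon> + 1 + \<epsilon>) / of_nat q - (B u u / 2 - of_int \<epsilon> / of_nat q)
      - (B w w / 2 - of_int \<epsilon> / of_nat q) = B u w - 1 / of_nat q"
    using s B_commute[OF s] by (simp add: B_simps add_divide_distrib)
  finally have Quw: "B u w - 1 / of_nat q \<in> \<int>" .
  have "\<exists>k::int. B u u = 2 * of_int \<epsilon> / of_nat q + 2 * of_int k" "\<exists>k::int. B w w = 2 * of_int \<epsilon> / of_nat q + 2 * of_int k"
    "\<exists>k::int. B u w = 1 / of_nat q + of_int k"
    using Quu Qww Quw by (auto elim!: Ints_cases simp: algebra_simps)
  then have "discriminant_gens L B q \<epsilon> u w"
    unfolding discriminant_gens_def using uw quw gen by blast
  then show thesis by (rule that)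
qed

end

section \<open>Rank bounds for lattices\<close>

lemma int_basis_independent:
  assumes bs: "int_basis bs L" and "(\<Sum>i<length bs. c i *\<^sub>R bs ! i) = 0" "i < length bs"
  shows "c i = 0"
proof -
  have bij: "bij_betw ((!) bs) {..<length bs} (set bs)"
    using bs by (intro bij_betw_nth) (auto simp: int_basis_def)
  define r where "r v = c (inv_into {..<length bs} ((!) bs) v)" for v
  have r: "r (bs ! j) = c j" if "j < length bs" for j
    using bij that unfolding r_def by (metis bij_betw_def inv_into_f_f lessThan_iff)
  have "(\<Sum>v\<in>set bs. r v *\<^sub>R v) = (\<Sum>j<length bs. r (bs ! j) *\<^sub>R bs ! j)"
    by (rule sum.reindex_bij_betw[OF bij, symmetric])
  also have "\<dots> = (\<Sum>j<length bs. c j *\<^sub>R bs ! j)" by (intro sum.cong) (auto simp: r)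
  finally have "(\<Sum>v\<in>set bs. r v *\<^sub>R v) = 0" using assms by simp
  moreover have "independent (set bs)" using bs by (simp add: int_basis_def)
  ultimately have "r (bs ! i) = 0"
    using independentD[of "set bs" "set bs" r "bs ! i"] assms(3) by auto
  then show ?thesis using r assms(3) by simp
qed

section \<open>Coordinates with respect to an integral basis\<close>

locale based_lattice = even_lattice_loc L B for L :: "'v::real_vector set" and B +
  fixes bs :: "'v list"
  assumes bs: "int_basis bs L"
begin

abbreviation "n \<equiv> length bs"

definition vec_of :: "real Matrix.vec \<Rightarrow> 'v" where
  "vec_of c = (\<Sum>i<n. c $v i *\<^sub>R bs ! i)"

text \<open>The floor only changes the type: the products of basis vectors of an even lattice are
  integers.\<close>

definition gram :: "int mat" where
  "gram = Matrix.mat n n (\<lambda>(i, j). \<lfloor>B (bs ! i) (bs ! j)\<rfloor>)"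

lemma bij_bs: "bij_betw ((!) bs) {..<n} (set bs)"
  using bs by (intro bij_betw_nth) (auto simp: int_basis_def)

lemma vec_of_inj:
  assumes "c \<in> carrier_vec n" "vec_of c = 0"
  shows "c = 0\<^sub>v n"
  using int_basis_independent[OF bs, of "\<lambda>i. c $v i"] assms by (auto simp: vec_of_def)

lemma vec_of_span: "vec_of c \<in> span L"
  unfolding vec_of_def int_basis_span[OF bs] by (intro span_sum span_scale span_base) auto

lemma vec_of_surj:
  assumes "x \<in> span L"
  obtains c where "c \<in> carrier_vec n" "x = vec_of c"
proof -
  obtain r where "x = (\<Sum>v\<in>set bs. r v *\<^sub>R v)"
    using assms by (auto simp: int_basis_span[OF bs] span_finite)
  also have "\<dots> = (\<Sum>i<n. r (bs ! i) *\<^sub>R bs ! i)" by (rule sum.reindex_bij_betw[OF bij_bs, symmetric])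
  also have "\<dots> = vec_of (Matrix.vec n (\<lambda>i. r (bs ! i)))" unfolding vec_of_def by (intro sum.cong) auto
  finally show thesis by (intro that) simp_all
qed

lemma vec_of_lin:
  assumes "c \<in> carrier_vec n" "d \<in> carrier_vec n"
  shows "vec_of (c + d) = vec_of c + vec_of d" and "vec_of (a \<cdot>\<^sub>v c) = a *\<^sub>R vec_of c"
  using assms by (simp_all add: vec_of_def sum.distrib scaleR_sum_right algebra_simps)

lemma vec_of_eq:
  assumes "c \<in> carrier_vec n" "d \<in> carrier_vec n" "vec_of c = vec_of d"
  shows "c = d"
proof -
  have "vec_of (c + (-1) \<cdot>\<^sub>v d) = 0" using assms by (simp add: vec_of_lin)
  then have *: "c + (-1) \<cdot>\<^sub>v d = 0\<^sub>v n" using assms by (intro vec_of_inj) auto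
  have "c $v i = d $v i" if "i < n" for i
    using arg_cong[OF *, of "\<lambda>v. v $v i"] that assms by simp
  then show ?thesis using assms by (intro eq_vecI) auto
qed

lemma vec_of_L: "int_vec n c \<Longrightarrow> vec_of c \<in> L"
  unfolding vec_of_def by (rule int_basis_comb[OF bs]) (auto simp: int_vec_def elim!: Ints_cases)

lemma vec_of_L_iff:
  assumes "c \<in> carrier_vec n"
  shows "vec_of c \<in> L \<longleftrightarrow> int_vec n c"
proof
  assume "vec_of c \<in> L"
  then obtain k :: "nat \<Rightarrow> int" where "vec_of c = (\<Sum>i<n. of_int (k i) *\<^sub>R bs ! i)"
    using bs unfolding int_basis_def by blast
  also have "\<dots> = vec_of (Matrix.vec n (\<lambda>i. of_int (k i)))" unfolding vec_of_def by (intro sum.cong) auto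
  finally have "c = Matrix.vec n (\<lambda>i. of_int (k i))" using assms by (intro vec_of_eq) auto
  then show "int_vec n c" by (simp add: int_vec_def)
qed (rule vec_of_L)

lemma bs_L: "i < n \<Longrightarrow> bs ! i \<in> L"
proof -
  assume i: "i < n"
  have "vec_of (unit_vec n i) = (\<Sum>j<n. if j = i then bs ! j else 0)"
    unfolding vec_of_def using i by (intro sum.cong) auto
  then have "vec_of (unit_vec n i) = bs ! i" using i by simp
  moreover have "int_vec n (unit_vec n i)" by (auto simp: int_vec_def unit_vec_def)
  ultimately show ?thesis using vec_of_L by metis
qed

lemma gram_carrier: "gram \<in> carrier_mat n n" by (simp add: gram_def)

lemma gram_index: "i < n \<Longrightarrow> j < n \<Longrightarrow> of_int (gram $$ (i, j)) = B (bs ! i) (bs ! j)"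
  using D_int[OF L_D[OF bs_L[of i]] bs_L[of j]] by (auto simp: gram_def elim!: Ints_cases)

lemma B_vec_of_basis:
  assumes "c \<in> carrier_vec n" "i < n"
  shows "B (bs ! i) (vec_of c) = (real_mat gram *\<^sub>v c) $v i"
proof -
  have "B (bs ! i) (vec_of c) = B (vec_of c) (bs ! i)"
    using assms bs_L by (intro B_commute vec_of_span span_base)
  also have "\<dots> = (\<Sum>j<n. c $v j * B (bs ! j) (bs ! i))"
    unfolding vec_of_def by (rule B_sum_left) (use assms bs_L in \<open>auto intro: span_base\<close>)
  also have "\<dots> = (\<Sum>j<n. of_int (gram $$ (i, j)) * c $v j)"
    using assms B_commute[OF L_span[OF bs_L] L_span[OF bs_L], of _ i]
    by (intro sum.cong) (auto simp: gram_index)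
  also have "\<dots> = (real_mat gram *\<^sub>v c) $v i"
    using assms gram_carrier by (simp add: scalar_prod_def lessThan_atLeast0)
  finally show ?thesis .
qed

lemma B_vec_of:
  assumes "c \<in> carrier_vec n" "d \<in> carrier_vec n"
  shows "B (vec_of c) (vec_of d) = bil (real_mat gram) c d"
proof -
  have "B (vec_of c) (vec_of d) = (\<Sum>i<n. c $v i * B (bs ! i) (vec_of d))"
    unfolding vec_of_def[of c] by (rule B_sum_left) (use bs_L vec_of_span in \<open>auto intro: span_base\<close>)
  also have "\<dots> = (\<Sum>i<n. c $v i * (real_mat gram *\<^sub>v d) $v i)"
    using assms by (intro sum.cong) (auto simp: B_vec_of_basis simp del: index_mult_mat_vec)
  also have "\<dots> = bil (real_mat gram) c d"
    using gram_carrier by (simp add: bil_def scalar_prod_def lessThan_atLeast0)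
  finally show ?thesis .
qed

lemma vec_of_D_iff:
  assumes "c \<in> carrier_vec n"
  shows "vec_of c \<in> D \<longleftrightarrow> int_vec n (real_mat gram *\<^sub>v c)"
proof
  assume "vec_of c \<in> D"
  then have "B (bs ! i) (vec_of c) \<in> \<int>" if "i < n" for i
    using D_int[OF _ bs_L[OF that]] B_commute[OF L_span[OF bs_L[OF that]] vec_of_span, of c] by simp
  then show "int_vec n (real_mat gram *\<^sub>v c)"
    using gram_carrier assms by (simp add: int_vec_def B_vec_of_basis del: index_mult_mat_vec)
next
  assume c: "int_vec n (real_mat gram *\<^sub>v c)"
  have "B (vec_of c) l \<in> \<int>" if l: "l \<in> L" for l
  proof -
    obtain d where d: "d \<in> carrier_vec n" "l = vec_of d" using vec_of_surj[OF L_span[OF l]] by blast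
    then have "int_vec n d" using l vec_of_L_iff by simp
    then show ?thesis
      using bil_int[OF d(1) c] B_commute[OF vec_of_span L_span[OF l], of c] d B_vec_of[OF d(1) assms] by simp
  qed
  then show "vec_of c \<in> D" using vec_of_span by (simp add: dual_lattice_def)
qed

lemma gram_even: "even_mat n gram"
  unfolding even_mat_def
proof (intro conjI allI impI gram_carrier)
  fix i j assume ij: "i < n" "j < n"
  then have "real_of_int (gram $$ (i, j)) = of_int (gram $$ (j, i))"
    using B_commute[OF L_span[OF bs_L] L_span[OF bs_L]] by (simp add: gram_index)
  then show "gram $$ (i, j) = gram $$ (j, i)" by simp
next
  fix i assume i: "i < n"
  obtain k :: int where "B (bs ! i) (bs ! i) = 2 * of_int k"
    using even bs_L[OF i] unfolding even_lattice_def by blast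
  then have "real_of_int (gram $$ (i, i)) = of_int (2 * k)" using i by (simp add: gram_index)
  then show "even (gram $$ (i, i))" by (metis dvd_triv_left of_int_eq_iff)
qed

lemma gram_pos:
  assumes "positive_definite L B"
  shows "pos_mat n gram"
  unfolding pos_mat_def
proof (intro conjI ballI impI gram_carrier)
  show "\<forall>i<n. \<forall>j<n. gram $$ (i, j) = gram $$ (j, i)" using gram_even by (simp add: even_mat_def)
  fix y :: "int Matrix.vec" assume y: "y \<in> carrier_vec n" "y \<noteq> 0\<^sub>v n"
  have ry: "real_vec y \<in> carrier_vec n" using y by simp
  have "vec_of (real_vec y) \<noteq> 0"
  proof
    assume "vec_of (real_vec y) = 0"
    then have *: "real_vec y = 0\<^sub>v n" by (rule vec_of_inj[OF ry])
    have "y $v i = 0" if "i < n" for i using arg_cong[OF *, of "\<lambda>v. v $v i"] that y by simp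
    then show False using y by auto
  qed
  moreover have "vec_of (real_vec y) \<in> L" using y by (intro vec_of_L int_vec_real_vec)
  ultimately have "0 < B (vec_of (real_vec y)) (vec_of (real_vec y))"
    using assms by (simp add: positive_definite_def)
  then show "0 < bil gram y y" using B_vec_of[OF ry ry] bil_real[OF gram_carrier y(1) y(1)] by simp
qed

lemma two_generated_dual_coords:
  assumes pos: "positive_definite L B" and g: "discriminant_gens L B q \<epsilon> u w" and q: "0 < q"
  obtains u' w' where "two_generated_dual n gram (int q) \<epsilon> u' w'"
proof -
  have uw: "u \<in> D" "w \<in> D" using g by (auto simp: discriminant_gens_def)
  obtain u' where u': "u' \<in> carrier_vec n" "u = vec_of u'" using vec_of_surj[OF D_span[OF uw(1)]] by blast
  obtain w' where w': "w' \<in> carrier_vec n" "w = vec_of w'" using vec_of_surj[OF D_span[OF uw(2)]] by blast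
  have "two_generated_dual n gram (int q) \<epsilon> u' w'"
  proof
    show "even_mat n gram" "pos_mat n gram" by (rule gram_even, rule gram_pos[OF pos])
    show "0 < int q" using q by simp
    show "u' \<in> carrier_vec n" "w' \<in> carrier_vec n" by fact+
    show "int_vec n (real_mat gram *\<^sub>v u')" "int_vec n (real_mat gram *\<^sub>v w')"
      using uw u' w' vec_of_D_iff by auto
    show "int_vec n (of_int (int q) \<cdot>\<^sub>v u')" "int_vec n (of_int (int q) \<cdot>\<^sub>v w')"
      using g u' w' by (auto simp: discriminant_gens_def vec_of_lin simp flip: vec_of_L_iff)
    show "\<exists>k. bil (real_mat gram) u' u' = 2 * of_int \<epsilon> / of_int (int q) + 2 * of_int k"
      "\<exists>k. bil (real_mat gram) w' w' = 2 * of_int \<epsilon> / of_int (int q) + 2 * of_int k"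
      "\<exists>k. bil (real_mat gram) u' w' = 1 / of_int (int q) + of_int k"
      using g u' w' by (auto simp: discriminant_gens_def B_vec_of)
    fix y assume y: "y \<in> carrier_vec n" "int_vec n (real_mat gram *\<^sub>v y)"
    then have "vec_of y \<in> D" using vec_of_D_iff by simp
    then obtain l and c d :: int where l: "l \<in> L" and eq: "vec_of y = l + (of_int c *\<^sub>R u + of_int d *\<^sub>R w)"
      using g unfolding discriminant_gens_def by blast
    obtain l' where l': "l' \<in> carrier_vec n" "l = vec_of l'" using vec_of_surj[OF L_span[OF l]] by blast
    have "vec_of y = vec_of (l' + (of_int c \<cdot>\<^sub>v u' + of_int d \<cdot>\<^sub>v w'))"
      using eq l' u' w' by (simp add: vec_of_lin)
    then have "y = l' + (of_int c \<cdot>\<^sub>v u' + of_int d \<cdot>\<^sub>v w')"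
      using y l' u' w' by (intro vec_of_eq) auto
    moreover have "int_vec n l'" using l l' vec_of_L_iff by simp
    ultimately show "\<exists>l c d. int_vec n l \<and> y = l + (of_int c \<cdot>\<^sub>v u' + of_int d \<cdot>\<^sub>v w')" by blast
  qed
  then show thesis by (rule that)
qed

end

text \<open>In rank \<open>0\<close> the form vanishes, but \<open>u\<close> and \<open>w\<close>
  have a product congruent to \<open>1 / q\<close> modulo \<open>1\<close>.\<close>

lemma (in two_generated_dual) rank_pos:
  assumes "1 < q"
  shows "0 < n"
proof (rule ccontr)
  assume "\<not> 0 < n"
  then have "bl u w = 0" using u(1) w(1) A_carrier by (simp add: bil_sum[of _ n])
  then obtain k :: int where "0 = 1 / real_of_int q + of_int k" using uw_ex by auto
  then have "real_of_int (1 + k * q) = 0" using q_pos by (simp add: field_simps)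
  then have "1 + k * q = 0" by linarith
  then have "q dvd 1" by (metis add.inverse_inverse add_eq_0_iff dvd_minus_iff dvd_triv_right)
  then show False using assms by simp
qed

section \<open>Lower bounds for the rank\<close>

lemma two_generated_dual_of_isometric:
  assumes "even_lattice L B" "positive_definite L B"
    and iso: "isometrically_isomorphic (discriminant_module L B) (module_eps \<epsilon> (2 ^ r))" and r: "0 < r"
  obtains A u w where "two_generated_dual (lattice_rank L) A (2 ^ r) \<epsilon> u w" "0 < lattice_rank L"
proof -
  interpret even_lattice_loc L B by unfold_locales (rule assms(1))
  obtain bs where bs: "int_basis bs L" by (rule basis)
  interpret based_lattice L B bs by unfold_locales (rule bs)
  have "(1::nat) < 2 ^ r" using r by (rule one_less_power[rotated]) simp
  then obtain u w where g: "discriminant_gens L B (2 ^ r) \<epsilon> u w" using discriminant_gens_if_isometric[OF iso] by blast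
  obtain u' w' where *: "two_generated_dual n gram (int (2 ^ r)) \<epsilon> u' w'"
    using two_generated_dual_coords[OF assms(2) g] by auto
  have "(1::int) < 2 ^ r" using r by (rule one_less_power[rotated]) simp
  then have "0 < n" using two_generated_dual.rank_pos[OF *] by simp
  then show thesis using that * lattice_rank_eq[OF bs] by simp
qed

lemma rank_ge_4_B:
  assumes "even_lattice L B" "positive_definite L B"
    and "isometrically_isomorphic (discriminant_module L B) (module_B (2 ^ r))" and "0 < r"
  shows "4 \<le> lattice_rank L"
proof -
  obtain A u w where *: "two_generated_dual (lattice_rank L) A (2 ^ r) 1 u w" and "0 < lattice_rank L"
    using two_generated_dual_of_isometric[of L B 1 r] assms by (metis module_B_eps)
  then show ?thesis using two_generated_dual.rank_mod_4[OF * refl refl] by (simp add: dvd_imp_le)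
qed

text \<open>For even \<open>r\<close> take both multipliers equal to the square root
  \<open>s\<close> of \<open>q\<close>. Self-duality holds since the matrix of
  \<open>A\<^sub>2\<close> has determinant \<open>3\<close>, which is prime to
  \<open>s\<close>.\<close>

lemma rank_ge_8_B:
  assumes "even_lattice L B" "positive_definite L B"
    and "isometrically_isomorphic (discriminant_module L B) (module_B (2 ^ r))" and "0 < r" "even r"
  shows "8 \<le> lattice_rank L"
proof -
  obtain A u w where *: "two_generated_dual (lattice_rank L) A (2 ^ r) 1 u w" and pos: "0 < lattice_rank L"
    using two_generated_dual_of_isometric[of L B 1 r] assms by (metis module_B_eps)
  define s :: int where "s = 2 ^ (r div 2)"
  have s: "s * s = 2 ^ r" using \<open>even r\<close> by (simp add: s_def flip: power_add mult_2)
  have "coprime s 3" by (simp add: s_def)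
  show ?thesis
  proof (rule two_generated_dual.rank_ge_8[OF * pos s])
    show "2 ^ r dvd 1 * s\<^sup>2" "2 ^ r dvd 1 * s\<^sup>2" using s by (simp_all add: power2_eq_square)
    fix c d assume "s dvd 2 * 1 * c + d" "s dvd c + 2 * 1 * d"
    then have "s dvd 2 * (2 * 1 * c + d) - (c + 2 * 1 * d)" "s dvd 2 * (c + 2 * 1 * d) - (2 * 1 * c + d)"
      by (simp_all only: dvd_diff dvd_mult)
    then have "s dvd 3 * c" "s dvd 3 * d" by (simp_all add: algebra_simps)
    then show "s dvd c \<and> s dvd d" using \<open>coprime s 3\<close> by (simp add: coprime_dvd_mult_right_iff)
  qed
qed

text \<open>The first generator alone spans a self-dual isotropic subgroup, since
  \<open>x * y\<close> vanishes at \<open>y = 0\<close>; hence the multipliers \<open>1\<close> and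
  \<open>q\<close>.\<close>

lemma rank_ge_8_C:
  assumes "even_lattice L B" "positive_definite L B"
    and "isometrically_isomorphic (discriminant_module L B) (module_C (2 ^ r))" and "0 < r"
  shows "8 \<le> lattice_rank L"
proof -
  obtain A u w where *: "two_generated_dual (lattice_rank L) A (2 ^ r) 0 u w" and pos: "0 < lattice_rank L"
    using two_generated_dual_of_isometric[of L B 0 r] assms by (metis module_C_eps)
  show ?thesis
    by (rule two_generated_dual.rank_ge_8[OF * pos, of 1 "2 ^ r"]) auto
qed

section \<open>Lattices given by Gram matrices\<close>

lemma int_basis_int_vectors:
  obtains bs :: "(real ^ 'n) list" where "int_basis bs int_vectors" "length bs = CARD('n)"
proof -
  obtain es :: "'n list" where es: "set es = UNIV" "distinct es" using finite_distinct_list[OF finite_class.finite_UNIV] by blast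
  have len: "length es = CARD('n)" using distinct_card[OF es(2)] es(1) by simp
  define bs :: "(real ^ 'n) list" where "bs = map (\<lambda>i. axis i 1) es"
  have bij: "bij_betw ((!) es) {..<length es} UNIV" using es bij_betw_nth by blast
  have expand: "x = (\<Sum>k<length bs. x $ (es ! k) *\<^sub>R bs ! k)" for x :: "real ^ 'n"
  proof -
    have "x = (\<Sum>i\<in>UNIV. x $ i *\<^sub>R axis i 1)"
      using basis_expansion[of x] by (simp add: scalar_mult_eq_scaleR)
    also have "\<dots> = (\<Sum>k<length es. x $ (es ! k) *\<^sub>R axis (es ! k) 1)"
      by (rule sum.reindex_bij_betw[OF bij, symmetric])
    finally show ?thesis by (simp add: bs_def)
  qed
  have "int_basis bs int_vectors"
    unfolding int_basis_def
  proof (intro conjI)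
    show "distinct bs" using es by (auto simp: bs_def distinct_map inj_on_def axis_eq_axis)
    have "set bs \<subseteq> Basis" by (auto simp: bs_def Basis_vec_def)
    then show "independent (set bs)" using independent_Basis independent_mono by blast
    show "int_vectors = {\<Sum>i<length bs. of_int (c i) *\<^sub>R bs ! i | c :: nat \<Rightarrow> int. True}"
    proof (intro equalityI subsetI)
      fix x :: "real ^ 'n" assume "x \<in> int_vectors"
      then have "\<forall>k. \<exists>c. x $ (es ! k) = of_int c" by (auto simp: int_vectors_def elim!: Ints_cases)
      then obtain c :: "nat \<Rightarrow> int" where "\<And>k. x $ (es ! k) = of_int (c k)" by metis
      then show "x \<in> {\<Sum>i<length bs. of_int (c i) *\<^sub>R bs ! i | c :: nat \<Rightarrow> int. True}" using expand[of x] by auto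
    next
      fix x assume "x \<in> {\<Sum>i<length bs. of_int (c i) *\<^sub>R bs ! i | c :: nat \<Rightarrow> int. True}"
      then show "x \<in> int_vectors" by (auto simp: int_vectors_def bs_def axis_def intro!: Ints_sum)
    qed
  qed
  then show thesis using that len by (simp add: bs_def)
qed

lemma lattice_rank_int_vectors: "lattice_rank (int_vectors :: (real ^ 'n) set) = CARD('n)"
  using int_basis_int_vectors lattice_rank_eq by metis

lemma span_int_vectors: "span (int_vectors :: (real ^ 'n) set) = UNIV"
proof -
  have "(Basis :: (real ^ 'n) set) \<subseteq> int_vectors" by (auto simp: Basis_vec_def int_vectors_def axis_def)
  then show ?thesis using span_mono[of Basis "int_vectors :: (real ^ 'n) set"] span_Basis by auto
qed

lemma gram_form_add: "gram_form G (x + y) z = gram_form G x z + gram_form G y z"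
  and gram_form_scale: "gram_form G (a *\<^sub>R x) z = a * gram_form G x z"
  and gram_form_scale_right: "gram_form G x (a *\<^sub>R z) = a * gram_form G x z"
  and gram_form_sum: "gram_form G (\<Sum>i\<in>I. f i) z = (\<Sum>i\<in>I. gram_form G (f i) z)"
  by (simp_all add: gram_form_def inner_add_left matrix_vector_mult_scaleR inner_sum_left)

lemma gram_form_sum_right: "gram_form G z (\<Sum>i\<in>I. f i) = (\<Sum>i\<in>I. gram_form G z (f i))"
  by (induction I rule: infinite_finite_induct)
    (simp_all add: gram_form_def matrix_vector_right_distrib inner_add_right)

text \<open>A kernel vector of the Gram matrix would be a nonzero vector orthogonal to every basis
  vector, hence of norm \<open>0\<close>.\<close>

lemma bilinear_lattice_gram_form:
  assumes sym: "\<And>x y. gram_form G x y = gram_form G y x" and pos: "\<And>x. x \<noteq> 0 \<Longrightarrow> 0 < gram_form G x x"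
  shows "bilinear_lattice int_vectors (gram_form G)"
proof -
  obtain bs where bs: "int_basis bs (int_vectors :: (real ^ 'a) set)" by (rule int_basis_int_vectors)
  let ?M = "gram_matrix (gram_form G) bs" and ?n = "length bs"
  have M: "?M \<in> carrier_mat ?n ?n" by (simp add: gram_matrix_def)
  have "Determinant.det ?M \<noteq> 0"
  proof
    assume "Determinant.det ?M = 0"
    then obtain c where c: "c \<in> carrier_vec ?n" "c \<noteq> 0\<^sub>v ?n" "?M *\<^sub>v c = 0\<^sub>v ?n"
      using det_0_iff_vec_prod_zero[OF M] by auto
    define x where "x = (\<Sum>i<?n. c $v i *\<^sub>R bs ! i)"
    have "gram_form G (bs ! i) x = 0" if i: "i < ?n" for i
    proof -
      have "gram_form G (bs ! i) x = (?M *\<^sub>v c) $v i"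
        using i c(1) by (simp add: x_def gram_form_sum_right gram_form_scale_right gram_matrix_def scalar_prod_def
            lessThan_atLeast0 mult.commute)
      then show ?thesis using c(3) i by simp
    qed
    then have "gram_form G x x = 0"
      by (subst x_def) (simp add: gram_form_sum gram_form_scale)
    then have "x = 0" using pos[of x] by force
    then have "c $v i = 0" if "i < ?n" for i
      using int_basis_independent[OF bs, of "\<lambda>i. c $v i"] that by (simp add: x_def)
    then show False using c by auto
  qed
  then show ?thesis
    unfolding bilinear_lattice_def using bs sym gram_form_add gram_form_scale by blast
qed

section \<open>Changing generators modulo a power of two\<close>

lemma hensel_quadratic:
  fixes a b c :: int
  assumes "odd b" "even c"
  shows "\<exists>s. 2 ^ r dvd a * s\<^sup>2 + b * s + c"
proof (cases r)
  case (Suc k)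
  have "\<exists>s. 2 ^ Suc k dvd a * s\<^sup>2 + b * s + c"
  proof (induction k)
    case 0
    show ?case using assms by (intro exI[of _ 0]) simp
  next
    case (Suc k)
    then obtain s m where m: "a * s\<^sup>2 + b * s + c = 2 ^ Suc k * m" by (auto elim!: dvdE)
    obtain b' where b: "b + 1 = 2 * b'" using assms(1) by (metis even_plus_one_iff evenE)
    \<comment> \<open>A Newton step without division: the derivative \<open>2 * a * s + b\<close> is
      odd, hence \<open>-1\<close> modulo \<open>2\<close>, and adding the error itself cancels it
      to one further power of \<open>2\<close>.\<close>
    let ?s = "s + 2 ^ Suc k * m"
    have "a * ?s\<^sup>2 + b * ?s + c = (a * s\<^sup>2 + b * s + c) + 2 ^ Suc k * m * (2 * a * s + b) + a * (2 ^ Suc k * m)\<^sup>2"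
      by (simp add: power2_eq_square algebra_simps)
    also have "\<dots> = 2 ^ Suc k * m * (2 * a * s + (b + 1)) + a * (2 ^ Suc k * m)\<^sup>2"
      unfolding m by (simp add: algebra_simps)
    also have "\<dots> = 2 ^ Suc (Suc k) * (m * (a * s + b') + a * 2 ^ k * m\<^sup>2)"
      unfolding b by (simp add: power2_eq_square algebra_simps)
    finally show ?case by (metis dvd_triv_left)
  qed
  then show ?thesis using Suc by simp
qed auto

text \<open>The integers \<open>m11\<close>, ..., \<open>m22\<close> form a substitution matrix
  whose determinant has inverse \<open>t\<close> modulo \<open>q\<close>. The last three congruences
  say that it carries \<open>x\<^sup>2 + xy + a y\<^sup>2\<close> to the form of
  \<open>module_eps\<close>, coefficient by coefficient.\<close>

lemma discriminant_gens_change: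
  assumes "even_lattice L B"
    and uw: "u \<in> dual_lattice L B" "w \<in> dual_lattice L B" and quw: "of_nat q *\<^sub>R u \<in> L" "of_nat q *\<^sub>R w \<in> L"
    and q: "0 < q"
    and gen: "\<And>v. v \<in> dual_lattice L B \<Longrightarrow> \<exists>l\<in>L. \<exists>c d :: int. v = l + (of_int c *\<^sub>R u + of_int d *\<^sub>R w)"
    and B: "B u u = 2 / of_nat q" "B u w = 1 / of_nat q" "B w w = 2 * of_int a / of_nat q"
    and t: "[t * (m11 * m22 - m12 * m21) = 1] (mod int q)"
    and m1: "[m11\<^sup>2 + m11 * m12 + a * m12\<^sup>2 = \<epsilon>] (mod int q)"
    and m2: "[m21\<^sup>2 + m21 * m22 + a * m22\<^sup>2 = \<epsilon>] (mod int q)"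
    and m12: "[2 * m11 * m21 + (m11 * m22 + m12 * m21) + 2 * a * m12 * m22 = 1] (mod int q)"
  shows "discriminant_gens L B q \<epsilon> (of_int m11 *\<^sub>R u + of_int m12 *\<^sub>R w) (of_int m21 *\<^sub>R u + of_int m22 *\<^sub>R w)"
proof -
  interpret even_lattice_loc L B by unfold_locales (rule assms(1))
  define u' w' where "u' = comb u w m11 m12" and "w' = comb u w m21 m22"
  have uw': "u' \<in> D" "w' \<in> D" using comb_D[OF uw] by (auto simp: u'_def w'_def)
  have qcomb: "of_nat q *\<^sub>R comb u w c d \<in> L" for c d
    using L_comb[OF quw, of c d] by (simp add: comb_def algebra_simps)
  have gen': "\<exists>l\<in>L. \<exists>c d. v = l + comb u' w' c d" if v: "v \<in> D" for v
  proof -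
    obtain l c d where l: "l \<in> L" "v = l + comb u w c d" using gen[OF v] by (auto simp: comb_def)
    obtain e where e: "1 - t * (m11 * m22 - m12 * m21) = int q * e"
      using t by (metis cong_iff_dvd_diff cong_sym dvdE)
    \<comment> \<open>Cramer's rule, with \<open>t\<close> in place of the reciprocal of the
      determinant.\<close>
    let ?c = "t * (m22 * c - m21 * d)" and ?d = "t * (m11 * d - m12 * c)"
    have "comb u' w' ?c ?d = comb u w (t * (m11 * m22 - m12 * m21) * c) (t * (m11 * m22 - m12 * m21) * d)"
      unfolding u'_def w'_def comb_def by (simp add: algebra_simps)
    then have "comb u w c d - comb u' w' ?c ?d = comb u w ((1 - t * (m11 * m22 - m12 * m21)) * c) ((1 - t * (m11 * m22 - m12 * m21)) * d)"
      by (simp add: comb_diff left_diff_distrib)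
    also have "\<dots> = of_nat q *\<^sub>R comb u w (e * c) (e * d)"
      unfolding e by (simp add: comb_def algebra_simps)
    finally have "comb u w c d - comb u' w' ?c ?d \<in> L" using qcomb by simp
    then have "l + (comb u w c d - comb u' w' ?c ?d) \<in> L" using l L_add by blast
    moreover have "v = (l + (comb u w c d - comb u' w' ?c ?d)) + comb u' w' ?c ?d" using l by simp
    ultimately show ?thesis by blast
  qed
  have lift: "\<exists>k::int. of_int x / real q = of_int y / of_nat q + of_int k" if "[x = y] (mod int q)" for x y
  proof -
    have "int q dvd x - y" using that by (simp add: cong_iff_dvd_diff)
    then obtain k where "x - y = int q * k" by (rule dvdE)
    then have "x = y + int q * k" by simp
    then have "real_of_int x / real q = of_int y / of_nat q + of_int k" using q by (simp add: add_divide_distrib)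
    then show ?thesis by blast
  qed
  have "B u' u' = 2 * (of_int (m11\<^sup>2 + m11 * m12 + a * m12\<^sup>2) / of_nat q)"
    using q by (simp add: u'_def B_comb[OF uw] B power2_eq_square add_divide_distrib algebra_simps)
  moreover have "B w' w' = 2 * (of_int (m21\<^sup>2 + m21 * m22 + a * m22\<^sup>2) / of_nat q)"
    using q by (simp add: w'_def B_comb[OF uw] B power2_eq_square add_divide_distrib algebra_simps)
  moreover have "B u' w' = of_int (2 * m11 * m21 + (m11 * m22 + m12 * m21) + 2 * a * m12 * m22) / of_nat q"
    using q by (simp add: u'_def w'_def B_comb[OF uw] B add_divide_distrib algebra_simps)
  moreover obtain k1 k2 k3 :: int where
    "of_int (m11\<^sup>2 + m11 * m12 + a * m12\<^sup>2) / real q = of_int \<epsilon> / of_nat q + of_int k1"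
    "of_int (m21\<^sup>2 + m21 * m22 + a * m22\<^sup>2) / real q = of_int \<epsilon> / of_nat q + of_int k2"
    "of_int (2 * m11 * m21 + (m11 * m22 + m12 * m21) + 2 * a * m12 * m22) / real q = of_int 1 / of_nat q + of_int k3"
    using lift[OF m1] lift[OF m2] lift[OF m12] by blast
  ultimately have "B u' u' = 2 * of_int \<epsilon> / of_nat q + 2 * of_int k1" "B w' w' = 2 * of_int \<epsilon> / of_nat q + 2 * of_int k2"
    "B u' w' = 1 / of_nat q + of_int k3"
    by (simp_all only: distrib_left of_int_1 times_divide_eq_right[of 2 "of_int \<epsilon>" "real q", symmetric])
  then have "discriminant_gens L B q \<epsilon> u' w'"
    using uw' gen' qcomb[of m11 m12] qcomb[of m21 m22] unfolding discriminant_gens_def comb_def[of u' w', symmetric]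
      u'_def[symmetric] w'_def[symmetric] by blast
  then show ?thesis by (simp add: u'_def w'_def comb_def)
qed

section \<open>Positivity and duals of the explicit Gram matrices\<close>

lemma vector_4_nth:
  "(vector [a, b, c, d] :: 'a::zero ^ 4) $ 1 = a" "(vector [a, b, c, d] :: 'a ^ 4) $ 2 = b"
  "(vector [a, b, c, d] :: 'a ^ 4) $ 3 = c" "(vector [a, b, c, d] :: 'a ^ 4) $ 4 = d"
  unfolding vector_def by simp_all

lemma gram_form_gram4:
  "gram_form (gram4 r v x) y z =
     2 ^ r * (2 * y $ 1 * z $ 1 + (y $ 1 * z $ 2 + y $ 2 * z $ 1) + 2 * y $ 2 * z $ 2 + v * (y $ 2 * z $ 3 + y $ 3 * z $ 2))
     + 2 * x * y $ 3 * z $ 3 + (y $ 3 * z $ 4 + y $ 4 * z $ 3) + 2 * y $ 4 * z $ 4"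
  by (simp add: gram_form_def inner_vec_def matrix_vector_mult_def sum_4 gram4_def vector_4_nth algebra_simps)

lemma exhaust_8: "(i::8) = 1 \<or> i = 2 \<or> i = 3 \<or> i = 4 \<or> i = 5 \<or> i = 6 \<or> i = 7 \<or> i = 8"
proof (induct i)
  case (of_int z)
  then have "z = 0 \<or> z = 1 \<or> z = 2 \<or> z = 3 \<or> z = 4 \<or> z = 5 \<or> z = 6 \<or> z = 7" by fastforce
  then show ?case by auto
qed

lemma sum_8: "sum f (UNIV::8 set) = f 1 + f 2 + f 3 + f 4 + f 5 + f 6 + f 7 + f 8"
proof -
  have U: "UNIV = {1, 2, 3, 4, 5, 6, 7, 8::8}" using exhaust_8 by auto
  show ?thesis unfolding U by (simp add: ac_simps)
qed

lemma forall_8: "(\<forall>i::8. P i) \<longleftrightarrow> P 1 \<and> P 2 \<and> P 3 \<and> P 4 \<and> P 5 \<and> P 6 \<and> P 7 \<and> P 8"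
  by (metis exhaust_8)

lemma vector_8_nth:
  "(vector [a, b, c, d, e, f, g, h] :: 'a::zero ^ 8) $ 1 = a" "(vector [a, b, c, d, e, f, g, h] :: 'a ^ 8) $ 2 = b"
  "(vector [a, b, c, d, e, f, g, h] :: 'a ^ 8) $ 3 = c" "(vector [a, b, c, d, e, f, g, h] :: 'a ^ 8) $ 4 = d"
  "(vector [a, b, c, d, e, f, g, h] :: 'a ^ 8) $ 5 = e" "(vector [a, b, c, d, e, f, g, h] :: 'a ^ 8) $ 6 = f"
  "(vector [a, b, c, d, e, f, g, h] :: 'a ^ 8) $ 7 = g" "(vector [a, b, c, d, e, f, g, h] :: 'a ^ 8) $ 8 = h"
  unfolding vector_def by simp_all

lemma gram_form_gram8:
  "gram_form (gram8 a r v x) y z =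
     2 ^ r * (2 * y $ 1 * z $ 1 + (y $ 1 * z $ 2 + y $ 2 * z $ 1) + a * y $ 2 * z $ 2 + v * (y $ 2 * z $ 3 + y $ 3 * z $ 2))
     + 2 * x * y $ 3 * z $ 3 + (y $ 3 * z $ 4 + y $ 4 * z $ 3) + 2 * y $ 4 * z $ 4
     + (y $ 4 * z $ 5 + y $ 5 * z $ 4) + 2 * y $ 5 * z $ 5 + (y $ 5 * z $ 6 + y $ 6 * z $ 5) + 2 * y $ 6 * z $ 6
     + (y $ 6 * z $ 7 + y $ 7 * z $ 6) + 2 * y $ 7 * z $ 7 + (y $ 7 * z $ 8 + y $ 8 * z $ 7) + 2 * y $ 8 * z $ 8"
  by (simp add: gram_form_def inner_vec_def matrix_vector_mult_def sum_8 gram8_def vector_8_nth algebra_simps)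

lemma dual_gram_form_axis:
  assumes "y \<in> dual_lattice int_vectors (gram_form G)"
  shows "gram_form G y (axis i 1) \<in> \<int>"
proof -
  have "axis i 1 \<in> int_vectors" by (auto simp: int_vectors_def axis_def)
  then show ?thesis using assms by (simp add: dual_lattice_def)
qed

lemma even_lattice_gram_form:
  assumes "\<And>x y. gram_form G x y = gram_form G y x" "\<And>x. x \<noteq> 0 \<Longrightarrow> 0 < gram_form G x x"
    and "\<And>x y. x \<in> int_vectors \<Longrightarrow> y \<in> int_vectors \<Longrightarrow> gram_form G x y \<in> \<int>"
    and "\<And>x. x \<in> int_vectors \<Longrightarrow> \<exists>k::int. gram_form G x x = 2 * of_int k"
  shows "even_lattice int_vectors (gram_form G)" "positive_definite int_vectors (gram_form G)"
  using assms bilinear_lattice_gram_form[OF assms(1,2)] by (auto simp: even_lattice_def positive_definite_def)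

text \<open>Squares are completed from both ends. In the middle the coefficient of
  \<open>(y $ 3)\<^sup>2\<close> becomes \<open>2 / 3 - 1 / 2 = 1 / 6\<close>: the first term
  remains of \<open>2 * x\<close> after eliminating \<open>y $ 1\<close> and \<open>y $ 2\<close>,
  the second is lost to \<open>y $ 4\<close>.\<close>

lemma gram4_pos:
  fixes y :: "real ^ 4"
  assumes x: "3 * x = 2 ^ r * v\<^sup>2 + 1" and y: "y \<noteq> 0"
  shows "0 < gram_form (gram4 r v x) y y"
proof (rule ccontr)
  assume neg: "\<not> ?thesis"
  define q :: real where "q = 2 ^ r"
  have q: "q > 0" by (simp add: q_def)
  have x': "x = (q * v\<^sup>2 + 1) / 3" using x by (simp add: q_def)
  define t1 t2 t3 t4 where "t1 = 2 * q * (y $ 1 + y $ 2 / 2)\<^sup>2" and "t2 = (3 / 2) * q * (y $ 2 + (2 / 3) * v * y $ 3)\<^sup>2"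
    and "t3 = (y $ 3)\<^sup>2 / 6" and "t4 = 2 * (y $ 4 + y $ 3 / 2)\<^sup>2"
  have "gram_form (gram4 r v x) y y = t1 + t2 + t3 + t4"
    unfolding gram_form_gram4 q_def[symmetric] x' t1_def t2_def t3_def t4_def
    by (simp add: power2_eq_square field_simps)
  moreover have "t1 \<ge> 0" "t2 \<ge> 0" "t3 \<ge> 0" "t4 \<ge> 0" using q by (auto simp: t1_def t2_def t3_def t4_def)
  ultimately have t: "t1 = 0" "t2 = 0" "t3 = 0" "t4 = 0" using neg by linarith+
  have 3: "y $ 3 = 0" using t(3) by (simp add: t3_def)
  have 2: "y $ 2 = 0" using t(2) q 3 by (simp add: t2_def)
  have "y $ 1 = 0" "y $ 4 = 0" using t(1,4) q 2 3 by (simp_all add: t1_def t4_def)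
  with 2 3 have "y = 0" by (simp add: Finite_Cartesian_Product.vec_eq_iff forall_4)
  then show False using y by simp
qed

text \<open>Again squares are completed from both ends. At the third coordinate one end leaves
  \<open>2 * c / d\<close> and the other takes away \<open>5 / 6\<close>; by the relation
  \<open>ac\<close> the difference is \<open>1 / (6 * d)\<close>.\<close>

lemma gram8_pos:
  fixes y :: "real ^ 8"
  assumes x: "(2 * a - 1) * x = 2 ^ r * v\<^sup>2 + c" and ac: "12 * c = 5 * (2 * a - 1) + 1" and a: "a \<ge> 1" and y: "y \<noteq> 0"
  shows "0 < gram_form (gram8 a r v x) y y"
proof (rule ccontr)
  assume neg: "\<not> ?thesis"
  define q :: real where "q = 2 ^ r"
  define d where "d = 2 * a - 1"
  have q: "q > 0" by (simp add: q_def)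
  have d: "d > 0" using a by (simp add: d_def)
  have a': "a = (d + 1) / 2" by (simp add: d_def)
  have "c = (5 * d + 1) / 12" using ac by (simp add: d_def)
  then have x': "x = (q * v\<^sup>2 + (5 * d + 1) / 12) / d" using x d by (simp add: q_def d_def field_simps)
  define t1 t2 t3 t4 where "t1 = 2 * q * (y $ 1 + y $ 2 / 2)\<^sup>2" and "t2 = (d / 2) * q * (y $ 2 + 2 * v * y $ 3 / d)\<^sup>2"
    and "t3 = (y $ 3)\<^sup>2 / (6 * d)" and "t4 = (6 / 5) * (y $ 4 + (5 / 6) * y $ 3)\<^sup>2"
  \<comment> \<open>The pivots \<open>2\<close>, \<open>3/2\<close>, \<open>4/3\<close>,
    \<open>5/4\<close>, \<open>6/5\<close> of the block \<open>F\<^sub>5\<close>, taken from its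
    last coordinate upwards.\<close>
  define t5 t6 t7 t8 where "t5 = (5 / 4) * (y $ 5 + (4 / 5) * y $ 4)\<^sup>2" and "t6 = (4 / 3) * (y $ 6 + (3 / 4) * y $ 5)\<^sup>2"
    and "t7 = (3 / 2) * (y $ 7 + (2 / 3) * y $ 6)\<^sup>2" and "t8 = 2 * (y $ 8 + y $ 7 / 2)\<^sup>2"
  have A: "q * (2 * (y $ 1)\<^sup>2 + 2 * y $ 1 * y $ 2 + a * (y $ 2)\<^sup>2 + 2 * v * y $ 2 * y $ 3) + 2 * x * (y $ 3)\<^sup>2
      = t1 + t2 + t3 + (5 / 6) * (y $ 3)\<^sup>2"
    unfolding a' x' t1_def t2_def t3_def using d by (simp add: power2_eq_square field_simps)
  have C: "(5 / 6) * (y $ 3)\<^sup>2 + 2 * y $ 3 * y $ 4 + 2 * (y $ 4)\<^sup>2 + 2 * y $ 4 * y $ 5 + 2 * (y $ 5)\<^sup>2 + 2 * y $ 5 * y $ 6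
      + 2 * (y $ 6)\<^sup>2 + 2 * y $ 6 * y $ 7 + 2 * (y $ 7)\<^sup>2 + 2 * y $ 7 * y $ 8 + 2 * (y $ 8)\<^sup>2 = t4 + t5 + t6 + t7 + t8"
    unfolding t4_def t5_def t6_def t7_def t8_def by (simp add: power2_eq_square field_simps)
  have "gram_form (gram8 a r v x) y y =
     (q * (2 * (y $ 1)\<^sup>2 + 2 * y $ 1 * y $ 2 + a * (y $ 2)\<^sup>2 + 2 * v * y $ 2 * y $ 3) + 2 * x * (y $ 3)\<^sup>2)
     - (5 / 6) * (y $ 3)\<^sup>2 + ((5 / 6) * (y $ 3)\<^sup>2 + 2 * y $ 3 * y $ 4 + 2 * (y $ 4)\<^sup>2 + 2 * y $ 4 * y $ 5 + 2 * (y $ 5)\<^sup>2 + 2 * y $ 5 * y $ 6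
      + 2 * (y $ 6)\<^sup>2 + 2 * y $ 6 * y $ 7 + 2 * (y $ 7)\<^sup>2 + 2 * y $ 7 * y $ 8 + 2 * (y $ 8)\<^sup>2)"
    unfolding gram_form_gram8 q_def[symmetric] by (simp add: power2_eq_square algebra_simps)
  also have "\<dots> = t1 + t2 + t3 + (t4 + t5 + t6 + t7 + t8)" unfolding A C by simp
  finally have "gram_form (gram8 a r v x) y y = t1 + t2 + t3 + (t4 + t5 + t6 + t7 + t8)" .
  moreover have "t1 \<ge> 0" "t2 \<ge> 0" "t3 \<ge> 0" "t4 \<ge> 0" "t5 \<ge> 0" "t6 \<ge> 0" "t7 \<ge> 0" "t8 \<ge> 0"
    using q d by (auto simp: t1_def t2_def t3_def t4_def t5_def t6_def t7_def t8_def)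
  ultimately have t: "t1 = 0" "t2 = 0" "t3 = 0" "t4 = 0" "t5 = 0" "t6 = 0" "t7 = 0" "t8 = 0" using neg by linarith+
  have 3: "y $ 3 = 0" using t(3) d by (simp add: t3_def)
  have 2: "y $ 2 = 0" using t(2) q d 3 by (simp add: t2_def)
  have 1: "y $ 1 = 0" using t(1) q 2 by (simp add: t1_def)
  have 4: "y $ 4 = 0" using t(4) 3 by (simp add: t4_def)
  have 5: "y $ 5 = 0" using t(5) 4 by (simp add: t5_def)
  have 6: "y $ 6 = 0" using t(6) 5 by (simp add: t6_def)
  have 7: "y $ 7 = 0" using t(7) 6 by (simp add: t7_def)
  have "y $ 8 = 0" using t(8) 7 by (simp add: t8_def)
  with 1 2 3 4 5 6 7 have "y = 0" by (simp add: Finite_Cartesian_Product.vec_eq_iff forall_8)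
  then show False using y by simp
qed

lemma gram4_even:
  fixes v X :: int
  assumes X: "3 * X = 2 ^ r * v\<^sup>2 + 1"
  defines "B \<equiv> gram_form (gram4 r (of_int v) (of_int X))"
  shows "even_lattice int_vectors B" "positive_definite int_vectors B"
proof -
  have X': "3 * real_of_int X = 2 ^ r * (of_int v)\<^sup>2 + 1" using arg_cong[OF X, of real_of_int] by simp
  have int: "\<exists>k::int. y $ i = of_int k" if "y \<in> int_vectors" for y :: "real ^ 4" and i
    using that by (auto simp: int_vectors_def elim!: Ints_cases)
  have "\<exists>k::int. B y y = 2 * of_int k" if y: "y \<in> int_vectors" for y
  proof -
    obtain k1 k2 k3 k4 :: int where k: "y $ 1 = of_int k1" "y $ 2 = of_int k2" "y $ 3 = of_int k3" "y $ 4 = of_int k4"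
      using int[OF y] by meson
    have "B y y = 2 * of_int (2 ^ r * (k1\<^sup>2 + k1 * k2 + k2\<^sup>2 + v * k2 * k3) + X * k3\<^sup>2 + k3 * k4 + k4\<^sup>2)"
      unfolding B_def gram_form_gram4 k by (simp add: power2_eq_square algebra_simps)
    then show ?thesis by blast
  qed
  moreover have "B y z \<in> \<int>" if "y \<in> int_vectors" "z \<in> int_vectors" for y z
    unfolding B_def gram_form_gram4 using that
    by (intro Ints_add Ints_mult Ints_power) (auto simp: int_vectors_def)
  moreover have "B y z = B z y" for y z unfolding B_def gram_form_gram4 by (simp add: algebra_simps)
  ultimately show "even_lattice int_vectors B" "positive_definite int_vectors B"
    unfolding B_def using gram4_pos[OF X'] by (intro even_lattice_gram_form; blast)+
qed

lemma gram8_even: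
  fixes a v X c :: int
  assumes X: "(4 * a - 1) * X = 2 ^ r * v\<^sup>2 + c" and ac: "12 * c = 5 * (4 * a - 1) + 1" and a: "a \<ge> 1"
  defines "B \<equiv> gram_form (gram8 (of_int (2 * a)) r (of_int v) (of_int X))"
  shows "even_lattice int_vectors B" "positive_definite int_vectors B"
proof -
  have X': "(2 * real_of_int (2 * a) - 1) * real_of_int X = 2 ^ r * (of_int v)\<^sup>2 + of_int c"
    using arg_cong[OF X, of real_of_int] by simp
  have ac': "12 * real_of_int c = 5 * (2 * real_of_int (2 * a) - 1) + 1" using arg_cong[OF ac, of real_of_int] by simp
  have a': "real_of_int (2 * a) \<ge> 1" using a by linarith
  have int: "\<exists>k::int. y $ i = of_int k" if "y \<in> int_vectors" for y :: "real ^ 8" and i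
    using that by (auto simp: int_vectors_def elim!: Ints_cases)
  have "\<exists>k::int. B y y = 2 * of_int k" if y: "y \<in> int_vectors" for y
  proof -
    obtain k1 k2 k3 k4 :: int where k: "y $ 1 = of_int k1" "y $ 2 = of_int k2" "y $ 3 = of_int k3" "y $ 4 = of_int k4"
      using int[OF y] by meson
    obtain k5 k6 k7 k8 :: int where k': "y $ 5 = of_int k5" "y $ 6 = of_int k6" "y $ 7 = of_int k7" "y $ 8 = of_int k8"
      using int[OF y] by meson
    have "B y y = 2 * of_int (2 ^ r * (k1\<^sup>2 + k1 * k2 + a * k2\<^sup>2 + v * k2 * k3) + X * k3\<^sup>2 + k3 * k4 + k4\<^sup>2
        + k4 * k5 + k5\<^sup>2 + k5 * k6 + k6\<^sup>2 + k6 * k7 + k7\<^sup>2 + k7 * k8 + k8\<^sup>2)"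
      unfolding B_def gram_form_gram8 k k' by (simp add: power2_eq_square algebra_simps)
    then show ?thesis by blast
  qed
  moreover have "B y z \<in> \<int>" if "y \<in> int_vectors" "z \<in> int_vectors" for y z
    unfolding B_def gram_form_gram8 using that
    by (intro Ints_add Ints_mult Ints_power) (auto simp: int_vectors_def)
  moreover have "B y z = B z y" for y z unfolding B_def gram_form_gram8 by (simp add: algebra_simps)
  ultimately show "even_lattice int_vectors B" "positive_definite int_vectors B"
    unfolding B_def using gram8_pos[OF X' ac' a'] by (intro even_lattice_gram_form; blast)+
qed

text \<open>In the unknowns \<open>Y1\<close>, \<open>Y2\<close>, \<open>y3\<close>,
  \<open>y4\<close> the rows form an integral system of determinant \<open>1\<close>, so integral
  right-hand sides force integral solutions. The elimination is carried out explicitly.\<close>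

lemma gram4_dual:
  fixes v X :: int and y :: "real ^ 4"
  assumes X: "3 * X = 2 ^ r * v\<^sup>2 + 1"
    and y: "y \<in> dual_lattice int_vectors (gram_form (gram4 r (of_int v) (of_int X)))"
  shows "2 ^ r * y $ 1 \<in> \<int>" "2 ^ r * y $ 2 \<in> \<int>" "y $ 3 \<in> \<int>" "y $ 4 \<in> \<int>"
proof -
  define q :: int where "q = 2 ^ r"
  have q: "(2::real) ^ r = of_int q" by (simp add: q_def)
  have X': "3 * real_of_int X = of_int q * (of_int v)\<^sup>2 + 1" using arg_cong[OF X, of real_of_int] by (simp add: q_def)
  define Y1 Y2 y3 y4 where "Y1 = 2 ^ r * y $ 1" and "Y2 = 2 ^ r * y $ 2" and "y3 = y $ 3" and "y4 = y $ 4"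
  note rows = dual_gram_form_axis[OF y, unfolded gram_form_gram4]
  obtain r1 where r1: "2 * Y1 + Y2 = of_int r1"
    using rows[of 1] by (auto simp: axis_def Y1_def Y2_def algebra_simps elim!: Ints_cases)
  obtain r2 where r2: "Y1 + 2 * Y2 + of_int (q * v) * y3 = of_int r2"
    using rows[of 2] by (auto simp: axis_def Y1_def Y2_def y3_def q algebra_simps elim!: Ints_cases)
  obtain r3 where r3: "of_int v * Y2 + 2 * of_int X * y3 + y4 = of_int r3"
    using rows[of 3] by (auto simp: axis_def Y2_def y3_def y4_def algebra_simps elim!: Ints_cases)
  obtain r4 where r4: "y3 + 2 * y4 = of_int r4"
    using rows[of 4] by (auto simp: axis_def y3_def y4_def algebra_simps elim!: Ints_cases)
  \<comment> \<open>The first and last rows express \<open>Y2\<close> through \<open>Y1\<close> and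
    \<open>y3\<close> through \<open>y4\<close>; these are the right-hand sides of the remaining
    binary system.\<close>
  define i2 i3 where "i2 = r2 - 2 * r1 - q * v * r4" and "i3 = r3 - v * r1 - 2 * X * r4"
  have i2: "real_of_int i2 = - 3 * Y1 - 2 * of_int (q * v) * y4"
    unfolding i2_def of_int_diff of_int_mult r1[symmetric] r2[symmetric] r4[symmetric] by (simp add: algebra_simps)
  have i3: "real_of_int i3 = - 2 * of_int v * Y1 + (1 - 4 * of_int X) * y4"
    unfolding i3_def of_int_diff of_int_mult r1[symmetric] r3[symmetric] r4[symmetric] by (simp add: algebra_simps)
  \<comment> \<open>The determinant of that system; the two identities below are its solution by the
    adjugate.\<close>
  have unit: "- 3 * (1 - 4 * real_of_int X) - 4 * of_int q * (of_int v)\<^sup>2 = 1" using X' by (simp add: algebra_simps)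
  have "of_int ((1 - 4 * X) * i2 + 2 * q * v * i3) = (- 3 * (1 - 4 * real_of_int X) - 4 * of_int q * (of_int v)\<^sup>2) * Y1"
    by (simp add: i2 i3 power2_eq_square algebra_simps)
  then have Y1: "Y1 = of_int ((1 - 4 * X) * i2 + 2 * q * v * i3)" unfolding unit by simp
  have "of_int (2 * v * i2 - 3 * i3) = (- 3 * (1 - 4 * real_of_int X) - 4 * of_int q * (of_int v)\<^sup>2) * y4"
    by (simp add: i2 i3 power2_eq_square algebra_simps)
  then have y4: "y4 = of_int (2 * v * i2 - 3 * i3)" unfolding unit by simp
  have y3: "y3 = of_int (r4 - 2 * (2 * v * i2 - 3 * i3))" using r4 y4 by simp
  have Y2: "Y2 = of_int (r1 - 2 * ((1 - 4 * X) * i2 + 2 * q * v * i3))" using r1 Y1 by simp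
  show "2 ^ r * y $ 1 \<in> \<int>" "2 ^ r * y $ 2 \<in> \<int>" "y $ 3 \<in> \<int>" "y $ 4 \<in> \<int>"
    unfolding Y1_def[symmetric] Y2_def[symmetric] y3_def[symmetric] y4_def[symmetric]
    by (subst Y1 Y2 y3 y4, rule Ints_of_int)+
qed

text \<open>The chain of rows for \<open>F\<^sub>5\<close> expresses \<open>y3\<close>, ...,
  \<open>y7\<close> through \<open>y8\<close> with integer coefficients, and the first row expresses
  \<open>Y2\<close> through \<open>Y1\<close>. Only a binary system in \<open>Y1\<close> and
  \<open>y8\<close> of determinant \<open>1\<close> remains.\<close>

lemma gram8_dual:
  fixes a v X c :: int and y :: "real ^ 8"
  assumes X: "(4 * a - 1) * X = 2 ^ r * v\<^sup>2 + c" and ac: "12 * c = 5 * (4 * a - 1) + 1"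
    and y: "y \<in> dual_lattice int_vectors (gram_form (gram8 (of_int (2 * a)) r (of_int v) (of_int X)))"
  shows "2 ^ r * y $ 1 \<in> \<int>" "2 ^ r * y $ 2 \<in> \<int>" "y $ 3 \<in> \<int>" "y $ 4 \<in> \<int>"
    "y $ 5 \<in> \<int>" "y $ 6 \<in> \<int>" "y $ 7 \<in> \<int>" "y $ 8 \<in> \<int>"
proof -
  define q :: int where "q = 2 ^ r"
  have q: "(2::real) ^ r = of_int q" by (simp add: q_def)
  define d where "d = 4 * a - 1"
  define Y1 Y2 y3 y4 where "Y1 = 2 ^ r * y $ 1" and "Y2 = 2 ^ r * y $ 2" and "y3 = y $ 3" and "y4 = y $ 4"
  define y5 y6 y7 y8 where "y5 = y $ 5" and "y6 = y $ 6" and "y7 = y $ 7" and "y8 = y $ 8"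
  note rows = dual_gram_form_axis[OF y, unfolded gram_form_gram8]
  obtain r1 where r1: "2 * Y1 + Y2 = of_int r1"
    using rows[of 1] by (auto simp: axis_def Y1_def Y2_def algebra_simps elim!: Ints_cases)
  obtain r2 where r2: "Y1 + of_int (2 * a) * Y2 + of_int (q * v) * y3 = of_int r2"
    using rows[of 2] by (auto simp: axis_def Y1_def Y2_def y3_def q algebra_simps elim!: Ints_cases)
  obtain r3 where r3: "of_int v * Y2 + 2 * of_int X * y3 + y4 = of_int r3"
    using rows[of 3] by (auto simp: axis_def Y2_def y3_def y4_def algebra_simps elim!: Ints_cases)
  obtain r4 where r4: "y3 + 2 * y4 + y5 = of_int r4"
    using rows[of 4] by (auto simp: axis_def y3_def y4_def y5_def algebra_simps elim!: Ints_cases)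
  obtain r5 where r5: "y4 + 2 * y5 + y6 = of_int r5"
    using rows[of 5] by (auto simp: axis_def y4_def y5_def y6_def algebra_simps elim!: Ints_cases)
  obtain r6 where r6: "y5 + 2 * y6 + y7 = of_int r6"
    using rows[of 6] by (auto simp: axis_def y5_def y6_def y7_def algebra_simps elim!: Ints_cases)
  obtain r7 where r7: "y6 + 2 * y7 + y8 = of_int r7"
    using rows[of 7] by (auto simp: axis_def y6_def y7_def y8_def algebra_simps elim!: Ints_cases)
  obtain r8 where r8: "y7 + 2 * y8 = of_int r8"
    using rows[of 8] by (auto simp: axis_def y7_def y8_def algebra_simps elim!: Ints_cases)
  \<comment> \<open>The integral parts of \<open>y3\<close> and \<open>y4\<close> as affine
    functions of \<open>y8\<close>, obtained by back substitution from the last row.\<close>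
  define k3 k4 where "k3 = r4 - 2 * r5 + 3 * r6 - 4 * r7 + 5 * r8" and "k4 = r5 - 2 * r6 + 3 * r7 - 4 * r8"
  have e7: "y7 = of_int r8 - 2 * y8" using r8 by simp
  have e6: "y6 = of_int (r7 - 2 * r8) + 3 * y8" using r7 e7 by simp
  have e5: "y5 = of_int (r6 - 2 * r7 + 3 * r8) - 4 * y8" using r6 e7 e6 by simp
  have e4: "y4 = of_int k4 + 5 * y8" using r5 e6 e5 by (simp add: k4_def)
  have e3: "y3 = of_int k3 - 6 * y8" using r4 e5 e4 by (simp add: k3_def k4_def)
  have e2: "Y2 = of_int r1 - 2 * Y1" using r1 by simp
  define i2 i3 where "i2 = r2 - 2 * a * r1 - q * v * k3" and "i3 = r3 - v * r1 - 2 * X * k3 - k4"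
  have i2: "real_of_int i2 = - of_int d * Y1 - 6 * of_int (q * v) * y8"
    unfolding i2_def of_int_diff r2[symmetric] e2 e3 by (simp add: d_def algebra_simps)
  have i3: "real_of_int i3 = - 2 * of_int v * Y1 + (5 - 12 * of_int X) * y8"
    unfolding i3_def of_int_diff r3[symmetric] e2 e3 e4 by (simp add: algebra_simps)
  \<comment> \<open>The remaining determinant equals
    \<open>12 * (d * X - q * v\<^sup>2) - 5 * d = 12 * c - 5 * d\<close>.\<close>
  have "- d * (5 - 12 * X) - 12 * q * v\<^sup>2 = 1" using X ac by (simp add: d_def q_def algebra_simps)
  from arg_cong[OF this, of real_of_int]
  have unit: "- of_int d * (5 - 12 * real_of_int X) - 12 * of_int q * (of_int v)\<^sup>2 = 1" by simp
  have "of_int ((5 - 12 * X) * i2 + 6 * q * v * i3) = (- of_int d * (5 - 12 * real_of_int X) - 12 * of_int q * (of_int v)\<^sup>2) * Y1"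
    by (simp add: i2 i3 power2_eq_square algebra_simps)
  then have Y1: "Y1 = of_int ((5 - 12 * X) * i2 + 6 * q * v * i3)" unfolding unit by simp
  have "of_int (2 * v * i2 - d * i3) = (- of_int d * (5 - 12 * real_of_int X) - 12 * of_int q * (of_int v)\<^sup>2) * y8"
    by (simp add: i2 i3 power2_eq_square algebra_simps)
  then have y8: "y8 = of_int (2 * v * i2 - d * i3)" unfolding unit by simp
  have "Y1 \<in> \<int>" "y8 \<in> \<int>" unfolding Y1 y8 by (rule Ints_of_int)+
  then show "2 ^ r * y $ 1 \<in> \<int>" "2 ^ r * y $ 2 \<in> \<int>" "y $ 3 \<in> \<int>" "y $ 4 \<in> \<int>"
    "y $ 5 \<in> \<int>" "y $ 6 \<in> \<int>" "y $ 7 \<in> \<int>" "y $ 8 \<in> \<int>"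
    unfolding Y1_def[symmetric] Y2_def[symmetric] y3_def[symmetric] y4_def[symmetric]
      y5_def[symmetric] y6_def[symmetric] y7_def[symmetric] y8_def[symmetric] e2 e3 e4 e5 e6 e7
    by (auto intro!: Ints_add Ints_diff Ints_mult)
qed

text \<open>The vectors \<open>e\<^sub>1/q\<close> and \<open>e\<^sub>2/q\<close> already give
  \<open>x\<^sup>2 + xy + y\<^sup>2\<close>, so the substitution is the identity.\<close>

lemma gram4_isometric:
  fixes v X :: int
  assumes X: "3 * X = 2 ^ r * v\<^sup>2 + 1"
  defines "B \<equiv> gram_form (gram4 r (of_int v) (of_int X))"
  shows "isometrically_isomorphic (discriminant_module int_vectors B) (module_B (2 ^ r))"
proof -
  have even: "even_lattice int_vectors B" unfolding B_def by (rule gram4_even[OF X])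
  interpret even_lattice_loc int_vectors B by unfold_locales (rule even)
  define q :: nat where "q = 2 ^ r"
  have q: "q > 0" "real q = 2 ^ r" by (auto simp: q_def)
  define u w :: "real ^ 4" where "u = (1 / q) *\<^sub>R axis 1 1" and "w = (1 / q) *\<^sub>R axis 2 1"
  have nth: "u $ 1 = 1 / 2 ^ r" "u $ 2 = 0" "u $ 3 = 0" "u $ 4 = 0" "w $ 1 = 0" "w $ 2 = 1 / 2 ^ r" "w $ 3 = 0" "w $ 4 = 0"
    by (auto simp: u_def w_def axis_def q_def)
  have "B u z = 2 * z $ 1 + z $ 2" "B w z = z $ 1 + 2 * z $ 2 + of_int v * z $ 3" for z
    by (simp_all add: B_def gram_form_gram4 nth field_simps)
  then have D: "u \<in> D" "w \<in> D"
    unfolding dual_lattice_def span_int_vectors by (auto simp: int_vectors_def)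
  have "discriminant_gens int_vectors B q 1 (of_int 1 *\<^sub>R u + of_int 0 *\<^sub>R w) (of_int 0 *\<^sub>R u + of_int 1 *\<^sub>R w)"
  proof (rule discriminant_gens_change[OF even D _ _ q(1), where a = 1 and t = 1])
    show "of_nat q *\<^sub>R u \<in> int_vectors" "of_nat q *\<^sub>R w \<in> int_vectors"
      by (auto simp: u_def w_def int_vectors_def axis_def)
    show "B u u = 2 / of_nat q" "B u w = 1 / of_nat q" "B w w = 2 * of_int 1 / of_nat q"
      by (simp_all add: B_def gram_form_gram4 nth q)
    fix y assume "y \<in> D"
    then have y: "2 ^ r * y $ 1 \<in> \<int>" "2 ^ r * y $ 2 \<in> \<int>" "y $ 3 \<in> \<int>" "y $ 4 \<in> \<int>"
      using gram4_dual[OF X] unfolding B_def by blast+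
    then obtain c d :: int where cd: "2 ^ r * y $ 1 = of_int c" "2 ^ r * y $ 2 = of_int d" by (auto elim!: Ints_cases)
    define l where "l = y - (of_int c *\<^sub>R u + of_int d *\<^sub>R w)"
    have "l \<in> int_vectors" using y by (simp add: l_def int_vectors_def forall_4 nth flip: cd)
    then show "\<exists>l\<in>int_vectors. \<exists>c d :: int. y = l + (of_int c *\<^sub>R u + of_int d *\<^sub>R w)"
      by (intro bexI[of _ l] exI[of _ c] exI[of _ d]) (simp_all add: l_def)
  qed simp_all
  then show ?thesis
    unfolding module_B_eps q_def[symmetric] by (rule isometric_if_discriminant_gens) (auto simp: q_def)
qed

lemma gram8_isometric_module_eps:
  fixes a v X c :: int
  assumes X: "(4 * a - 1) * X = 2 ^ r * v\<^sup>2 + c" and ac: "12 * c = 5 * (4 * a - 1) + 1" and a: "a \<ge> 1"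
    and t: "[t * (m11 * m22 - m12 * m21) = 1] (mod 2 ^ r)"
    and m1: "[m11\<^sup>2 + m11 * m12 + a * m12\<^sup>2 = \<epsilon>] (mod 2 ^ r)"
    and m2: "[m21\<^sup>2 + m21 * m22 + a * m22\<^sup>2 = \<epsilon>] (mod 2 ^ r)"
    and m12: "[2 * m11 * m21 + (m11 * m22 + m12 * m21) + 2 * a * m12 * m22 = 1] (mod 2 ^ r)"
    and \<epsilon>: "odd (4 * \<epsilon>\<^sup>2 - 1)"
  defines "B \<equiv> gram_form (gram8 (of_int (2 * a)) r (of_int v) (of_int X))"
  shows "isometrically_isomorphic (discriminant_module int_vectors B) (module_eps \<epsilon> (2 ^ r))"
proof -
  have even: "even_lattice int_vectors B" unfolding B_def by (rule gram8_even[OF X ac a])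
  interpret even_lattice_loc int_vectors B by unfold_locales (rule even)
  define q :: nat where "q = 2 ^ r"
  have q: "q > 0" "real q = 2 ^ r" "int q = 2 ^ r" by (auto simp: q_def)
  define u w :: "real ^ 8" where "u = (1 / q) *\<^sub>R axis 1 1" and "w = (1 / q) *\<^sub>R axis 2 1"
  have nth: "u $ 1 = 1 / 2 ^ r" "u $ 2 = 0" "u $ 3 = 0" "u $ 4 = 0" "u $ 5 = 0" "u $ 6 = 0" "u $ 7 = 0" "u $ 8 = 0"
    "w $ 1 = 0" "w $ 2 = 1 / 2 ^ r" "w $ 3 = 0" "w $ 4 = 0" "w $ 5 = 0" "w $ 6 = 0" "w $ 7 = 0" "w $ 8 = 0"
    by (auto simp: u_def w_def axis_def q_def)
  have "B u z = 2 * z $ 1 + z $ 2" "B w z = z $ 1 + of_int (2 * a) * z $ 2 + of_int v * z $ 3" for z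
    by (simp_all add: B_def gram_form_gram8 nth field_simps)
  then have D: "u \<in> D" "w \<in> D"
    unfolding dual_lattice_def span_int_vectors by (auto simp: int_vectors_def)
  have "discriminant_gens int_vectors B q \<epsilon> (of_int m11 *\<^sub>R u + of_int m12 *\<^sub>R w) (of_int m21 *\<^sub>R u + of_int m22 *\<^sub>R w)"
  proof (rule discriminant_gens_change[OF even D _ _ q(1) _ _ _ _ t[folded q(3)] m1[folded q(3)] m2[folded q(3)] m12[folded q(3)]])
    show "of_nat q *\<^sub>R u \<in> int_vectors" "of_nat q *\<^sub>R w \<in> int_vectors"
      by (auto simp: u_def w_def int_vectors_def axis_def)
    show "B u u = 2 / of_nat q" "B u w = 1 / of_nat q" "B w w = 2 * of_int a / of_nat q"
      by (simp_all add: B_def gram_form_gram8 nth q)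
    fix y assume "y \<in> D"
    then have y: "2 ^ r * y $ 1 \<in> \<int>" "2 ^ r * y $ 2 \<in> \<int>" "y $ 3 \<in> \<int>" "y $ 4 \<in> \<int>"
      "y $ 5 \<in> \<int>" "y $ 6 \<in> \<int>" "y $ 7 \<in> \<int>" "y $ 8 \<in> \<int>"
      using gram8_dual[OF X ac] unfolding B_def by blast+
    then obtain c d :: int where cd: "2 ^ r * y $ 1 = of_int c" "2 ^ r * y $ 2 = of_int d" by (auto elim!: Ints_cases)
    define l where "l = y - (of_int c *\<^sub>R u + of_int d *\<^sub>R w)"
    have "l \<in> int_vectors" using y by (simp add: l_def int_vectors_def forall_8 nth flip: cd)
    then show "\<exists>l\<in>int_vectors. \<exists>c d :: int. y = l + (of_int c *\<^sub>R u + of_int d *\<^sub>R w)"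
      by (intro bexI[of _ l] exI[of _ c] exI[of _ d]) (simp_all add: l_def)
  qed
  then show ?thesis
    unfolding q_def[symmetric] by (rule isometric_if_discriminant_gens) (use \<epsilon> in \<open>auto simp: q_def\<close>)
qed

section \<open>Substitutions for the two matrices of rank eight\<close>

lemma odd_inverse_mod_2_power:
  fixes m :: int
  assumes "odd m"
  obtains t where "[t * m = 1] (mod 2 ^ r)"
proof -
  have "coprime m (2 ^ r)" using assms by simp
  then show thesis using cong_solve_coprime_int[of m "2 ^ r"] that by (metis mult.commute)
qed

text \<open>Keep \<open>u\<close> and replace \<open>w\<close> by
  \<open>s u + (1 - 2 * s) w\<close>. This keeps the mixed product at \<open>1 / q\<close> for every
  \<open>s\<close> and has odd determinant \<open>1 - 2 * s\<close>. The one remaining condition, on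
  the value of the new vector, is \<open>19 * s\<^sup>2 - 19 * s + 4 = 0\<close> modulo
  \<open>2 ^ r\<close>, to which Hensel's lemma applies.\<close>

lemma gram8_10_isometric:
  fixes v X :: int
  assumes X: "19 * X = 2 ^ r * v\<^sup>2 + 8"
  shows "isometrically_isomorphic
    (discriminant_module int_vectors (gram_form (gram8 10 r (of_int v) (of_int X)))) (module_B (2 ^ r))"
proof -
  obtain s :: int where "2 ^ r dvd 19 * s\<^sup>2 + (-19) * s + 4" using hensel_quadratic[of "-19" 4 r 19] by auto
  then have "2 ^ r dvd s\<^sup>2 + s * (1 - 2 * s) + 5 * (1 - 2 * s)\<^sup>2 - 1"
    by (simp add: power2_eq_square algebra_simps)
  then have s: "[s\<^sup>2 + s * (1 - 2 * s) + 5 * (1 - 2 * s)\<^sup>2 = 1] (mod 2 ^ r)" by (simp add: cong_iff_dvd_diff)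
  obtain t where t: "[t * (1 - 2 * s) = 1] (mod 2 ^ r)" using odd_inverse_mod_2_power[of "1 - 2 * s" r] by auto
  show ?thesis
    using gram8_isometric_module_eps[of 5 X r v 8 t 1 "1 - 2 * s" 0 s 1] X s t by (simp add: module_B_eps algebra_simps)
qed

text \<open>A root \<open>t\<close> of \<open>t\<^sup>2 + t + 2\<close> modulo \<open>2 ^ r\<close>
  and the conjugate root \<open>-1 - t\<close> give the isotropic vectors \<open>(t, 1)\<close> and
  \<open>(-1 - t, 1)\<close>. Their mixed value is \<open>7\<close>, so the second is scaled by the
  inverse \<open>k\<close> of \<open>7\<close>.\<close>

lemma gram8_4_isometric:
  fixes v X :: int
  assumes X: "7 * X = 2 ^ r * v\<^sup>2 + 3"
  shows "isometrically_isomorphic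
    (discriminant_module int_vectors (gram_form (gram8 4 r (of_int v) (of_int X)))) (module_C (2 ^ r))"
proof -
  obtain t :: int where "2 ^ r dvd 1 * t\<^sup>2 + 1 * t + 2" using hensel_quadratic[of 1 2 r 1] by auto
  then have t: "2 ^ r dvd t\<^sup>2 + t + 2" by simp
  have odd: "odd (7::int)" "odd (2 * t + 1)" by simp_all
  obtain k :: int where k: "[k * 7 = 1] (mod 2 ^ r)" using odd(1) by (rule odd_inverse_mod_2_power)
  obtain e where e: "[e * (2 * t + 1) = 1] (mod 2 ^ r)" using odd(2) by (rule odd_inverse_mod_2_power)
  have 1: "[t\<^sup>2 + t * 1 + 2 * 1\<^sup>2 = 0] (mod 2 ^ r)" using t by (simp add: cong_0_iff)
  have "(k * (-1 - t))\<^sup>2 + k * (-1 - t) * k + 2 * k\<^sup>2 = k\<^sup>2 * (t\<^sup>2 + t + 2)"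
    by (simp add: power2_eq_square algebra_simps)
  then have 2: "[(k * (-1 - t))\<^sup>2 + k * (-1 - t) * k + 2 * k\<^sup>2 = 0] (mod 2 ^ r)" using t by (simp add: cong_0_iff)
  have "2 * t * (k * (-1 - t)) + (t * k + 1 * (k * (-1 - t))) + 2 * 2 * 1 * k - 1 = (k * 7 - 1) - 2 * k * (t\<^sup>2 + t + 2)"
    by (simp add: power2_eq_square algebra_simps)
  moreover have "2 ^ r dvd (k * 7 - 1) - 2 * k * (t\<^sup>2 + t + 2)"
    by (rule dvd_diff[OF _ dvd_mult[OF t]]) (use k in \<open>simp add: cong_iff_dvd_diff\<close>)
  ultimately have 3: "[2 * t * (k * (-1 - t)) + (t * k + 1 * (k * (-1 - t))) + 2 * 2 * 1 * k = 1] (mod 2 ^ r)"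
    by (simp only: cong_iff_dvd_diff)
  \<comment> \<open>The determinant of the substitution is \<open>k * (2 * t + 1)\<close>, which has
    inverse \<open>e * 7\<close>.\<close>
  have "(e * 7) * (t * k - 1 * (k * (-1 - t))) = (k * 7) * (e * (2 * t + 1))" by (simp add: algebra_simps)
  then have 4: "[(e * 7) * (t * k - 1 * (k * (-1 - t))) = 1] (mod 2 ^ r)" using cong_mult[OF k e] by (simp only: mult_1)
  show ?thesis
    using gram8_isometric_module_eps[of 2 X r v 3, OF _ _ _ 4 1 2 3] X by (simp add: module_C_eps)
qed

lemma integral_quotient_of_cong:
  fixes v :: int and x :: real
  assumes "[2 ^ r * v\<^sup>2 = - c] (mod m)" "x = (2 ^ r * (of_int v)\<^sup>2 + of_int c) / of_int m" "m \<noteq> 0"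
  obtains X :: int where "m * X = 2 ^ r * v\<^sup>2 + c" "x = of_int X"
proof -
  have "m dvd 2 ^ r * v\<^sup>2 + c" using assms(1) by (simp add: cong_iff_dvd_diff)
  then obtain X where X: "2 ^ r * v\<^sup>2 + c = m * X" by (rule dvdE)
  from arg_cong[OF this, of real_of_int] have "x = of_int X" using assms(2,3) by simp
  then show thesis using that X by simp
qed

theorem theorem5p10:
  fixes r :: nat
  assumes "r > 0"
  shows
    "(\<forall>(v::int) (x::real). odd r \<and> [2 ^ r * v\<^sup>2 = -1] (mod 3) \<and>
        x = (2 ^ r * (of_int v)\<^sup>2 + 1) / 3 \<longrightarrow>
      even_lattice int_vectors (gram_form (gram4 r (of_int v) x)) \<and>
      positive_definite int_vectors (gram_form (gram4 r (of_int v) x)) \<and>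
      isometrically_isomorphic
        (discriminant_module int_vectors (gram_form (gram4 r (of_int v) x))) (module_B (2 ^ r)) \<and>
      (\<forall>(L :: 'v::real_vector set) B.
        even_lattice L B \<and> positive_definite L B \<and>
        isometrically_isomorphic (discriminant_module L B) (module_B (2 ^ r)) \<longrightarrow>
        lattice_rank (int_vectors :: (real ^ 4) set) \<le> lattice_rank L)) \<and>
     (\<forall>(v::int) (x::real). even r \<and> [2 ^ r * v\<^sup>2 = -8] (mod 19) \<and>
        x = (2 ^ r * (of_int v)\<^sup>2 + 8) / 19 \<longrightarrow>
      even_lattice int_vectors (gram_form (gram8 10 r (of_int v) x)) \<and>
      positive_definite int_vectors (gram_form (gram8 10 r (of_int v) x)) \<and>
      isometrically_isomorphic
        (discriminant_module int_vectors (gram_form (gram8 10 r (of_int v) x))) (module_B (2 ^ r)) \<and>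
      (\<forall>(L :: 'v set) B.
        even_lattice L B \<and> positive_definite L B \<and>
        isometrically_isomorphic (discriminant_module L B) (module_B (2 ^ r)) \<longrightarrow>
        lattice_rank (int_vectors :: (real ^ 8) set) \<le> lattice_rank L)) \<and>
     (\<forall>(v::int) (x::real). [2 ^ r * v\<^sup>2 = -3] (mod 7) \<and>
        x = (2 ^ r * (of_int v)\<^sup>2 + 3) / 7 \<longrightarrow>
      even_lattice int_vectors (gram_form (gram8 4 r (of_int v) x)) \<and>
      positive_definite int_vectors (gram_form (gram8 4 r (of_int v) x)) \<and>
      isometrically_isomorphic
        (discriminant_module int_vectors (gram_form (gram8 4 r (of_int v) x))) (module_C (2 ^ r)) \<and>
      (\<forall>(L :: 'v set) B.
        even_lattice L B \<and> positive_definite L B \<and>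
        isometrically_isomorphic (discriminant_module L B) (module_C (2 ^ r)) \<longrightarrow>
        lattice_rank (int_vectors :: (real ^ 8) set) \<le> lattice_rank L))"
proof (intro conjI allI impI; (elim conjE)?)
  fix v :: int and x :: real
  assume c: "[2 ^ r * v\<^sup>2 = -1] (mod 3)" "x = (2 ^ r * (of_int v)\<^sup>2 + 1) / 3"
  obtain X :: int where X: "3 * X = 2 ^ r * v\<^sup>2 + 1" and x: "x = of_int X"
    using integral_quotient_of_cong[of r v 1 3 x] c by auto
  show "even_lattice int_vectors (gram_form (gram4 r (of_int v) x))"
    "positive_definite int_vectors (gram_form (gram4 r (of_int v) x))"
    unfolding x by (rule gram4_even[OF X])+
  show "isometrically_isomorphic (discriminant_module int_vectors (gram_form (gram4 r (of_int v) x))) (module_B (2 ^ r))"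
    unfolding x by (rule gram4_isometric[OF X])
next
  fix L :: "'v set" and B
  assume "even_lattice L B" "positive_definite L B"
    "isometrically_isomorphic (discriminant_module L B) (module_B (2 ^ r))"
  then show "lattice_rank (int_vectors :: (real ^ 4) set) \<le> lattice_rank L"
    using rank_ge_4_B \<open>r > 0\<close> by (simp add: lattice_rank_int_vectors)
next
  fix v :: int and x :: real
  assume c: "[2 ^ r * v\<^sup>2 = -8] (mod 19)" "x = (2 ^ r * (of_int v)\<^sup>2 + 8) / 19"
  obtain X :: int where X: "19 * X = 2 ^ r * v\<^sup>2 + 8" and x: "x = of_int X"
    using integral_quotient_of_cong[of r v 8 19 x] c by auto
  show "even_lattice int_vectors (gram_form (gram8 10 r (of_int v) x))"
    "positive_definite int_vectors (gram_form (gram8 10 r (of_int v) x))"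
    unfolding x using gram8_even[of 5 X r v 8] X by simp_all
  show "isometrically_isomorphic (discriminant_module int_vectors (gram_form (gram8 10 r (of_int v) x))) (module_B (2 ^ r))"
    unfolding x by (rule gram8_10_isometric[OF X])
next
  fix L :: "'v set" and B
  assume "even r" "even_lattice L B" "positive_definite L B"
    "isometrically_isomorphic (discriminant_module L B) (module_B (2 ^ r))"
  then show "lattice_rank (int_vectors :: (real ^ 8) set) \<le> lattice_rank L"
    using rank_ge_8_B \<open>r > 0\<close> by (simp add: lattice_rank_int_vectors)
next
  fix v :: int and x :: real
  assume c: "[2 ^ r * v\<^sup>2 = -3] (mod 7)" "x = (2 ^ r * (of_int v)\<^sup>2 + 3) / 7"
  obtain X :: int where X: "7 * X = 2 ^ r * v\<^sup>2 + 3" and x: "x = of_int X"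
    using integral_quotient_of_cong[of r v 3 7 x] c by auto
  show "even_lattice int_vectors (gram_form (gram8 4 r (of_int v) x))"
    "positive_definite int_vectors (gram_form (gram8 4 r (of_int v) x))"
    unfolding x using gram8_even[of 2 X r v 3] X by simp_all
  show "isometrically_isomorphic (discriminant_module int_vectors (gram_form (gram8 4 r (of_int v) x))) (module_C (2 ^ r))"
    unfolding x by (rule gram8_4_isometric[OF X])
next
  fix L :: "'v set" and B
  assume "even_lattice L B" "positive_definite L B"
    "isometrically_isomorphic (discriminant_module L B) (module_C (2 ^ r))"
  then show "lattice_rank (int_vectors :: (real ^ 8) set) \<le> lattice_rank L"
    using rank_ge_8_C \<open>r > 0\<close> by (simp add: lattice_rank_int_vectors)
qed

end
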